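(* Let $F_{\mu\nu}$ be the field strength of a $\mathfrak g$-valued gauge field $A_\mu$ on a $d$-dimensional spacetime $(M,g)$, $d\ge4$. If $F_{\mu\nu}$ is null, then it is $VSI_0$. If moreover $(M,g)$ is a degenerate Kundt spacetime and $F_{\mu\nu}$ is aligned (with its Kundt vector $\ell$), then $F_{\mu\nu}$ is $VSI$.
   Context: Spacetime and frames. $(M,g)$ is (a domain of) a $d$-dimensional Lorentzian manifold, signature $(-,+,\dots,+)$, Levi-Civita connection $\nabla$. A null frame is $\{e_{(0)}=\ell,e_{(1)}=n,e_{(i)}=m_{(i)}\}$, $i=2,\dots,d-1$, with $\ell_\mu n^\mu=1$, $m^{(i)}_\mu m_{(j)}^\mu=\delta^i_j$, all other contractions zero; $D\equiv\ell^\mu\nabla_\mu$. A frame component $T_{a\dots b}$ has boost weight (number of indices $0$) minus (number of indices $1$). Gauge fields. $G$ is a real non-Abelian finite-dimensional Lie group with Lie algebra $\mathfrak g$ spanned by (matrix) generators $t_a$, $[t_a,t_b]=if^c{}_{ab}t_c$. For $A_\mu=A_\mu^at_a$: $\mathscr D_\mu=\nabla_\mu-i[A_\mu,\cdot\,]$, $F_{\mu\nu}=\nabla_\mu A_\nu-\nabla_\nu A_\mu-i[A_\mu,A_\nu]=F^a_{\mu\nu}t_a$; under a gauge transformation $U$, $F_{\mu\nu}\mapsto UF_{\mu\nu}U^\dagger$. Null and aligned. $F_{\mu\nu}$ is null (type N) if there is a null frame, common to all $F^a_{\mu\nu}$, in which only the boost weight $-1$ components $F^a_{1i}$ can be non-zero;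 it is then aligned with $\ell=e_{(0)}$. $VSI_k$, $VSI$. $F_{\mu\nu}$ is $VSI_k$ if all scalar polynomial gauge invariants (without constant term) constructed from $F_{\mu\nu}$ and its gauge covariant derivatives up to order $k$ vanish (metric and volume element are allowed in the construction); $VSI$ if it is $VSI_k$ for all $k$. Kundt spacetimes. A Kundt spacetime admits a geodetic, shear-free, twist-free, expansion-free null vector field $\ell$ (Kundt vector). It is degenerate if the Riemann tensor and all its covariant derivatives have only components of boost weight $\le0$ with respect to $\ell$; equivalently, with $\ell$ affinely parameterized and the frame parallelly propagated along $\ell$, $R_{010i}=0$ and $DR_{0101}=0$. Locally, $ds^2=2H\,du^2+2W_\alpha\,du\,dx^\alpha+2\,du\,dr+g_{\alpha\beta}(u,x)dx^\alpha dx^\beta$, $\ell=\partial_r$, $W_\alpha$ at most linear and $H$ at most quadratic in $r$. *)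

theory Defs
  imports "HOL-Analysis.Analysis"
begin

section \<open>Smooth functions on open subsets of coordinate space\<close>

definition partial_deriv ::
  "'n::finite \<Rightarrow> (real^'n \<Rightarrow> 'v::real_normed_vector) \<Rightarrow> real^'n \<Rightarrow> 'v" where
  "partial_deriv i f x = frechet_derivative f (at x) (axis i 1)"

primrec Ck_on ::
  "nat \<Rightarrow> (real^'n::finite \<Rightarrow> 'v::real_normed_vector) \<Rightarrow> (real^'n) set \<Rightarrow> bool" where
  "Ck_on 0 f S \<longleftrightarrow> continuous_on S f"
| "Ck_on (Suc k) f S \<longleftrightarrow> f differentiable_on S \<and> (\<forall>i. Ck_on k (partial_deriv i f) S)"

definition smooth_on ::
  "(real^'n::finite \<Rightarrow> 'v::real_normed_vector) \<Rightarrow> (real^'n) set \<Rightarrow> bool" where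
  "smooth_on f S \<longleftrightarrow> (\<forall>k. Ck_on k f S)"


section \<open>Tensor calculus in a chart\<close>

text \<open>
  All tensors carry covariant indices only. A covariant tensor of rank r at a point is given by its
  components, a function of index lists; only its values on lists of length r matter. A tensor
  field in a chart has type \<open>'n list \<Rightarrow> real^'n \<Rightarrow> 'v\<close>. Indices created by differentiation are put in
  front.
\<close>

type_synonym ('n, 'v) tensor = "'n list \<Rightarrow> 'v"
type_synonym ('n, 'v) tensor_field = "'n list \<Rightarrow> real^'n \<Rightarrow> 'v"
type_synonym 'n metric = "real^'n \<Rightarrow> real^'n^'n"

definition metric_form :: "real^'n::finite^'n \<Rightarrow> real^'n \<Rightarrow> real^'n \<Rightarrow> real" where
  "metric_form h v w = v \<bullet> (h *v w)"

text \<open>Symmetric matrices of signature \<open>(-,+,\<dots>,+)\<close>.\<close>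

definition lorentzian :: "real^'n::finite^'n \<Rightarrow> bool" where
  "lorentzian h \<longleftrightarrow> transpose h = h \<and>
     (\<exists>(P :: real^'n^'n) i0. invertible P \<and>
        transpose P ** h ** P = (\<chi> i j. if i = j then (if i = i0 then -1 else 1) else 0))"

definition lorentz_metric_on :: "'n::finite metric \<Rightarrow> (real^'n) set \<Rightarrow> bool" where
  "lorentz_metric_on g S \<longleftrightarrow> smooth_on g S \<and> (\<forall>x\<in>S. lorentzian (g x))"

definition christoffel :: "'n::finite metric \<Rightarrow> real^'n \<Rightarrow> 'n \<Rightarrow> 'n \<Rightarrow> 'n \<Rightarrow> real" where
  "christoffel g x \<rho> \<mu> \<nu> = 1/2 * (\<Sum>\<sigma>\<in>UNIV. matrix_inv (g x) $ \<rho> $ \<sigma> *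
     (partial_deriv \<mu> (\<lambda>y. g y $ \<sigma> $ \<nu>) x + partial_deriv \<nu> (\<lambda>y. g y $ \<sigma> $ \<mu>) x
       - partial_deriv \<sigma> (\<lambda>y. g y $ \<mu> $ \<nu>) x))"

text \<open>The Levi-Civita derivative: \<open>covd g T (\<kappa> # \<nu>s)\<close> is \<open>\<nabla>\<^sub>\<kappa> T\<^bsub>\<nu>s\<^esub>\<close>.\<close>

fun covd ::
  "'n::finite metric \<Rightarrow> ('n, 'v::real_normed_vector) tensor_field \<Rightarrow> ('n, 'v) tensor_field" where
  "covd g T [] x = 0"
| "covd g T (\<kappa> # \<nu>s) x = partial_deriv \<kappa> (T \<nu>s) x
     - (\<Sum>i<length \<nu>s. \<Sum>\<rho>\<in>UNIV. christoffel g x \<rho> \<kappa> (\<nu>s ! i) *\<^sub>R T (\<nu>s[i := \<rho>]) x)"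

text \<open>\<open>riemann_up g x \<rho> \<sigma> \<mu> \<nu>\<close> is \<open>R\<^sup>\<rho>\<^bsub>\<sigma>\<mu>\<nu>\<^esub>\<close>.\<close>

definition riemann_up :: "'n::finite metric \<Rightarrow> real^'n \<Rightarrow> 'n \<Rightarrow> 'n \<Rightarrow> 'n \<Rightarrow> 'n \<Rightarrow> real" where
  "riemann_up g x \<rho> \<sigma> \<mu> \<nu> =
     partial_deriv \<mu> (\<lambda>y. christoffel g y \<rho> \<nu> \<sigma>) x - partial_deriv \<nu> (\<lambda>y. christoffel g y \<rho> \<mu> \<sigma>) x
     + (\<Sum>\<alpha>\<in>UNIV. christoffel g x \<rho> \<mu> \<alpha> * christoffel g x \<alpha> \<nu> \<sigma>
                 - christoffel g x \<rho> \<nu> \<alpha> * christoffel g x \<alpha> \<mu> \<sigma>)"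

definition riemann :: "'n::finite metric \<Rightarrow> ('n, real) tensor_field" where
  "riemann g \<mu>s x = (\<Sum>\<alpha>\<in>UNIV. g x $ (\<mu>s!0) $ \<alpha> * riemann_up g x \<alpha> (\<mu>s!1) (\<mu>s!2) (\<mu>s!3))"


section \<open>Null frames and boost weight\<close>

text \<open>Frame vectors are numbered \<open>0, \<dots>, d - 1\<close>: \<open>e 0 = \<ell>\<close>, \<open>e 1 = n\<close>, \<open>e i = m\<^sub>i\<close> for \<open>2 \<le> i < d\<close>.\<close>

definition null_frame :: "real^'n::finite^'n \<Rightarrow> (nat \<Rightarrow> real^'n) \<Rightarrow> bool" where
  "null_frame h e \<longleftrightarrow>
     metric_form h (e 0) (e 0) = 0 \<and> metric_form h (e 1) (e 1) = 0 \<and> metric_form h (e 0) (e 1) = 1 \<and>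
     (\<forall>i\<in>{2..<CARD('n)}. metric_form h (e 0) (e i) = 0 \<and> metric_form h (e 1) (e i) = 0) \<and>
     (\<forall>i\<in>{2..<CARD('n)}. \<forall>j\<in>{2..<CARD('n)}. metric_form h (e i) (e j) = (if i = j then 1 else 0))"

definition frame_comp ::
  "(nat \<Rightarrow> real^'n::finite) \<Rightarrow> ('n, 'v::real_vector) tensor \<Rightarrow> nat list \<Rightarrow> 'v" where
  "frame_comp e T as =
     (\<Sum>\<mu>s\<in>{\<mu>s. length \<mu>s = length as}. (\<Prod>i<length as. e (as ! i) $ (\<mu>s ! i)) *\<^sub>R T \<mu>s)"

definition boost_weight :: "nat list \<Rightarrow> int" where
  "boost_weight as = int (count_list as 0) - int (count_list as 1)"


section \<open>Gauge group and gauge fields in a chart\<close>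

definition cscale :: "complex \<Rightarrow> complex^'N^'N \<Rightarrow> complex^'N^'N" where
  "cscale c X = (\<chi> i j. c * X $ i $ j)"

definition commutator :: "complex^'N::finite^'N \<Rightarrow> complex^'N^'N \<Rightarrow> complex^'N^'N" where
  "commutator X Y = X ** Y - Y ** X"

definition matrix_exp :: "complex^'N::finite^'N \<Rightarrow> complex^'N^'N" where
  "matrix_exp X = (\<Sum>k. (1 / fact k) *\<^sub>R (((**) X ^^ k) (mat 1)))"

text \<open>With the convention that group elements are \<open>exp (i s X)\<close>, \<open>X\<close> in the Lie algebra.\<close>

definition lie_algebra_of :: "(complex^'N::finite^'N) set \<Rightarrow> (complex^'N^'N) set" where
  "lie_algebra_of G = {X. \<forall>s::real. matrix_exp (cscale (\<i> * of_real s) X) \<in> G}"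

text \<open>
  \<open>G\<close> is a non-Abelian real Lie group of complex matrices, not assumed closed, connected or unitary,
  and \<open>t\<close> is a basis of its Lie algebra. The Lie structure of a (not necessarily closed) Lie
  subgroup of \<open>GL(N,\<complex>)\<close> is determined by its one-parameter subgroups.
\<close>

definition gauge_group :: "(complex^'N::finite^'N) set \<Rightarrow> ('a::finite \<Rightarrow> complex^'N^'N) \<Rightarrow> bool" where
  "gauge_group G t \<longleftrightarrow>
     mat 1 \<in> G \<and> (\<forall>U\<in>G. invertible U \<and> matrix_inv U \<in> G) \<and> (\<forall>U\<in>G. \<forall>V\<in>G. U ** V \<in> G) \<and>
     (\<exists>U\<in>G. \<exists>V\<in>G. U ** V \<noteq> V ** U) \<and>
     inj t \<and> independent (range t) \<and> span (range t) = lie_algebra_of G \<and>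
     (\<exists>f :: 'a \<Rightarrow> 'a \<Rightarrow> 'a \<Rightarrow> real.
        \<forall>a b. commutator (t a) (t b) = (\<Sum>c\<in>UNIV. cscale (\<i> * of_real (f c a b)) (t c)))"

text \<open>The real coefficient \<open>X\<^sup>a\<close> in \<open>X = X\<^sup>a t\<^sub>a\<close>.\<close>

definition gen_coeff :: "('a \<Rightarrow> complex^'N::finite^'N) \<Rightarrow> 'a \<Rightarrow> complex^'N^'N \<Rightarrow> real" where
  "gen_coeff t a X = representation (range t) X (t a)"

type_synonym ('n, 'N) potential = "'n \<Rightarrow> real^'n \<Rightarrow> complex^'N^'N"

definition potential_on ::
  "('a \<Rightarrow> complex^'N::finite^'N) \<Rightarrow> ('n::finite, 'N) potential \<Rightarrow> (real^'n) set \<Rightarrow> bool" where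
  "potential_on t A S \<longleftrightarrow> (\<forall>\<mu>. smooth_on (A \<mu>) S \<and> (\<forall>x\<in>S. A \<mu> x \<in> span (range t)))"

definition field_strength ::
  "'n::finite metric \<Rightarrow> ('n, 'N::finite) potential \<Rightarrow> ('n, complex^'N^'N) tensor_field" where
  "field_strength g A \<mu>s x =
     (let \<mu> = \<mu>s ! 0; \<nu> = \<mu>s ! 1; A' = (\<lambda>\<nu>s. A (hd \<nu>s))
      in covd g A' [\<mu>, \<nu>] x - covd g A' [\<nu>, \<mu>] x - cscale \<i> (commutator (A \<mu> x) (A \<nu> x)))"

definition gauge_covd ::
  "'n::finite metric \<Rightarrow> ('n, 'N::finite) potential \<Rightarrow> ('n, complex^'N^'N) tensor_field
     \<Rightarrow> ('n, complex^'N^'N) tensor_field" where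
  "gauge_covd g A T \<mu>s x =
     covd g T \<mu>s x - cscale \<i> (commutator (A (hd \<mu>s) x) (T (tl \<mu>s) x))"

text \<open>The values at a point of \<open>F\<close> and all its gauge covariant derivatives; the \<open>j\<close>-th is a tensor
  of rank \<open>j + 2\<close>.\<close>

type_synonym ('n, 'N) jet = "nat \<Rightarrow> ('n, complex^'N^'N) tensor"

definition field_jet ::
  "'n::finite metric \<Rightarrow> ('n, 'N::finite) potential \<Rightarrow> real^'n \<Rightarrow> ('n, 'N) jet" where
  "field_jet g A x j \<mu>s = (gauge_covd g A ^^ j) (field_strength g A) \<mu>s x"


section \<open>Scalar polynomial gauge invariants\<close>

text \<open>
  \<open>\<beta>\<close> numbers the coordinates and thereby fixes one of the two orientations; on vectors
  \<open>v\<^sub>0, \<dots>, v\<^bsub>d-1\<^esub>\<close> the volume element is \<open>sqrt \<bar>det h\<bar> * det (v\<^sub>0, \<dots>, v\<^bsub>d-1\<^esub>)\<close>.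
\<close>

definition volume_element :: "('n::finite \<Rightarrow> nat) \<Rightarrow> real^'n^'n \<Rightarrow> ('n, real) tensor" where
  "volume_element \<beta> h \<mu>s = sqrt \<bar>det h\<bar> * det (\<chi> i. axis (\<mu>s ! \<beta> i) (1::real))"

text \<open>
  Tensors of rank \<open>r\<close> constructed polynomially from \<open>F\<^sup>a\<close> and its gauge covariant derivatives up to
  order \<open>k\<close>, the metric and the volume element. They are functions of the metric and the jet of
  \<open>F\<close> at a point, so that the coefficients are the same at all points. Arbitrary coefficients are
  allowed for the gauge indices: gauge invariance is imposed on the resulting scalar.
\<close>

type_synonym ('n, 'N) concomitant = "real^'n^'n \<Rightarrow> ('n, 'N) jet \<Rightarrow> ('n, complex) tensor"

inductive constructible ::
  "('a \<Rightarrow> complex^'N::finite^'N) \<Rightarrow> nat \<Rightarrow> nat \<Rightarrow> ('n::finite, 'N) concomitant \<Rightarrow> bool"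
  for t k where
  field: "j \<le> k \<Longrightarrow> constructible t k (j + 2) (\<lambda>h J \<mu>s. of_real (gen_coeff t a (J j \<mu>s)))"
| metric: "constructible t k 2 (\<lambda>h J \<mu>s. of_real (h $ (\<mu>s ! 0) $ (\<mu>s ! 1)))"
| volume: "bij_betw \<beta> (UNIV :: 'n set) {..<CARD('n)} \<Longrightarrow>
    constructible t k CARD('n) (\<lambda>h J \<mu>s. of_real (volume_element \<beta> h \<mu>s))"
| add: "constructible t k r P \<Longrightarrow> constructible t k r Q \<Longrightarrow>
    constructible t k r (\<lambda>h J \<mu>s. P h J \<mu>s + Q h J \<mu>s)"
| scale: "constructible t k r P \<Longrightarrow> constructible t k r (\<lambda>h J \<mu>s. c * P h J \<mu>s)"
| prod: "constructible t k r P \<Longrightarrow> constructible t k s Q \<Longrightarrow>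
    constructible t k (r + s) (\<lambda>h J \<mu>s. P h J (take r \<mu>s) * Q h J (drop r \<mu>s))"
| perm: "constructible t k r P \<Longrightarrow> \<pi> permutes {..<r} \<Longrightarrow>
    constructible t k r (\<lambda>h J \<mu>s. P h J (map (\<lambda>i. \<mu>s ! \<pi> i) [0..<r]))"
| contract: "constructible t k (r + 2) P \<Longrightarrow>
    constructible t k r (\<lambda>h J \<mu>s.
      \<Sum>\<alpha>\<in>UNIV. \<Sum>\<gamma>\<in>UNIV. of_real (matrix_inv h $ \<alpha> $ \<gamma>) * P h J (\<alpha> # \<gamma> # \<mu>s))"

text \<open>Invariance, for every gauge field on every spacetime, under the action
  \<open>\<D>\<^sup>j F \<mapsto> U (\<D>\<^sup>j F) U\<^sup>-\<^sup>1\<close> of gauge transformations.\<close>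

definition gauge_invariant ::
  "(complex^'N::finite^'N) set \<Rightarrow> ('a \<Rightarrow> complex^'N^'N) \<Rightarrow> ('n::finite, 'N) concomitant \<Rightarrow> bool" where
  "gauge_invariant G t P \<longleftrightarrow>
     (\<forall>S g A. open S \<longrightarrow> lorentz_metric_on g S \<longrightarrow> potential_on t A S \<longrightarrow>
       (\<forall>x\<in>S. \<forall>U\<in>G.
          P (g x) (\<lambda>j \<mu>s. U ** field_jet g A x j \<mu>s ** matrix_inv U) [] = P (g x) (field_jet g A x) []))"

text \<open>The constant term of a polynomial scalar is its value at \<open>F = 0\<close>.\<close>

definition polynomial_gauge_scalar ::
  "(complex^'N::finite^'N) set \<Rightarrow> ('a \<Rightarrow> complex^'N^'N) \<Rightarrow> nat \<Rightarrow> ('n::finite, 'N) concomitant \<Rightarrow> bool"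
  where
  "polynomial_gauge_scalar G t k P \<longleftrightarrow>
     constructible t k 0 P \<and> gauge_invariant G t P \<and> (\<forall>h. lorentzian h \<longrightarrow> P h (\<lambda>j \<mu>s. 0) [] = 0)"


section \<open>Spacetimes and fields on them\<close>

type_synonym ('m, 'n) chart = "'m set \<times> ('m \<Rightarrow> real^'n)"

definition chart_image :: "('m, 'n) chart \<Rightarrow> (real^'n) set" where
  "chart_image c = snd c ` fst c"

definition transition :: "('m, 'n) chart \<Rightarrow> ('m, 'n) chart \<Rightarrow> real^'n \<Rightarrow> real^'n" where
  "transition c c' = snd c' \<circ> inv_into (fst c) (snd c)"

definition smooth_atlas :: "('m::{t2_space, second_countable_topology}, 'n::finite) chart set \<Rightarrow> bool" where
  "smooth_atlas \<A> \<longleftrightarrow> (\<Union>c\<in>\<A>. fst c) = UNIV \<and>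
     (\<forall>c\<in>\<A>. open (fst c) \<and> open (chart_image c) \<and>
        homeomorphism (fst c) (chart_image c) (snd c) (inv_into (fst c) (snd c))) \<and>
     (\<forall>c\<in>\<A>. \<forall>c'\<in>\<A>. smooth_on (transition c c') (snd c ` (fst c \<inter> fst c')))"

definition jacobian :: "('m, 'n::finite) chart \<Rightarrow> ('m, 'n) chart \<Rightarrow> 'm \<Rightarrow> real^'n \<Rightarrow> real^'n" where
  "jacobian c c' p = frechet_derivative (transition c c') (at (snd c p))"

text \<open>Tensor fields are given by their components in each chart, subject to the transformation law
  on overlaps.\<close>

definition spacetime ::
  "('m::{t2_space, second_countable_topology}, 'n::finite) chart set \<Rightarrow>
     (('m, 'n) chart \<Rightarrow> 'n metric) \<Rightarrow> bool" where
  "spacetime \<A> g \<longleftrightarrow> smooth_atlas \<A> \<and>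
     (\<forall>c\<in>\<A>. lorentz_metric_on (g c) (chart_image c)) \<and>
     (\<forall>c\<in>\<A>. \<forall>c'\<in>\<A>. \<forall>p\<in>fst c \<inter> fst c'. \<forall>v w.
        metric_form (g c (snd c p)) v w =
        metric_form (g c' (snd c' p)) (jacobian c c' p v) (jacobian c c' p w))"

definition gauge_field ::
  "('m, 'n::finite) chart set \<Rightarrow> ('a \<Rightarrow> complex^'N::finite^'N) \<Rightarrow>
     (('m, 'n) chart \<Rightarrow> ('n, 'N) potential) \<Rightarrow> bool" where
  "gauge_field \<A> t A \<longleftrightarrow>
     (\<forall>c\<in>\<A>. potential_on t (A c) (chart_image c)) \<and>
     (\<forall>c\<in>\<A>. \<forall>c'\<in>\<A>. \<forall>p\<in>fst c \<inter> fst c'. \<forall>\<mu>.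
        A c \<mu> (snd c p) = (\<Sum>\<nu>\<in>UNIV. (jacobian c c' p (axis \<mu> 1) $ \<nu>) *\<^sub>R A c' \<nu> (snd c' p)))"

definition vector_field ::
  "('m, 'n::finite) chart set \<Rightarrow> (('m, 'n) chart \<Rightarrow> real^'n \<Rightarrow> real^'n) \<Rightarrow> bool" where
  "vector_field \<A> l \<longleftrightarrow>
     (\<forall>c\<in>\<A>. smooth_on (l c) (chart_image c)) \<and>
     (\<forall>c\<in>\<A>. \<forall>c'\<in>\<A>. \<forall>p\<in>fst c \<inter> fst c'. l c' (snd c' p) = jacobian c c' p (l c (snd c p)))"


section \<open>Null fields, VSI, and degenerate Kundt spacetimes\<close>

definition type_N_in_frame ::
  "('a \<Rightarrow> complex^'N::finite^'N) \<Rightarrow> (nat \<Rightarrow> real^'n::finite) \<Rightarrow> ('n, complex^'N^'N) tensor \<Rightarrow> bool" where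
  "type_N_in_frame t e F \<longleftrightarrow>
     (\<forall>a. \<forall>b<CARD('n). \<forall>c<CARD('n).
        frame_comp e (\<lambda>\<mu>s. gen_coeff t a (F \<mu>s)) [b, c] \<noteq> 0 \<longrightarrow> boost_weight [b, c] = -1)"

text \<open>No regularity is imposed on the frame as a function of the point. Whether the conditions below
  hold at a point does not depend on the chart in which they are expressed.\<close>

definition null_field ::
  "('m, 'n::finite) chart set \<Rightarrow> ('a \<Rightarrow> complex^'N::finite^'N) \<Rightarrow> (('m, 'n) chart \<Rightarrow> 'n metric) \<Rightarrow>
     (('m, 'n) chart \<Rightarrow> ('n, 'N) potential) \<Rightarrow> bool" where
  "null_field \<A> t g A \<longleftrightarrow>
     (\<forall>c\<in>\<A>. \<forall>x\<in>chart_image c. \<exists>e. null_frame (g c x) e \<and>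
        type_N_in_frame t e (\<lambda>\<mu>s. field_strength (g c) (A c) \<mu>s x))"

definition aligned_null_field ::
  "('m, 'n::finite) chart set \<Rightarrow> ('a \<Rightarrow> complex^'N::finite^'N) \<Rightarrow> (('m, 'n) chart \<Rightarrow> 'n metric) \<Rightarrow>
     (('m, 'n) chart \<Rightarrow> ('n, 'N) potential) \<Rightarrow> (('m, 'n) chart \<Rightarrow> real^'n \<Rightarrow> real^'n) \<Rightarrow> bool" where
  "aligned_null_field \<A> t g A l \<longleftrightarrow>
     (\<forall>c\<in>\<A>. \<forall>x\<in>chart_image c. \<exists>e. null_frame (g c x) e \<and> e 0 = l c x \<and>
        type_N_in_frame t e (\<lambda>\<mu>s. field_strength (g c) (A c) \<mu>s x))"

definition VSI_upto ::
  "nat \<Rightarrow> ('m, 'n::finite) chart set \<Rightarrow> (complex^'N::finite^'N) set \<Rightarrow> ('a \<Rightarrow> complex^'N^'N) \<Rightarrow>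
     (('m, 'n) chart \<Rightarrow> 'n metric) \<Rightarrow> (('m, 'n) chart \<Rightarrow> ('n, 'N) potential) \<Rightarrow> bool" where
  "VSI_upto k \<A> G t g A \<longleftrightarrow>
     (\<forall>P. polynomial_gauge_scalar G t k P \<longrightarrow>
       (\<forall>c\<in>\<A>. \<forall>x\<in>chart_image c. P (g c x) (field_jet (g c) (A c) x) [] = 0))"

definition VSI ::
  "('m, 'n::finite) chart set \<Rightarrow> (complex^'N::finite^'N) set \<Rightarrow> ('a \<Rightarrow> complex^'N^'N) \<Rightarrow>
     (('m, 'n) chart \<Rightarrow> 'n metric) \<Rightarrow> (('m, 'n) chart \<Rightarrow> ('n, 'N) potential) \<Rightarrow> bool" where
  "VSI \<A> G t g A \<longleftrightarrow> (\<forall>k. VSI_upto k \<A> G t g A)"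

text \<open>\<open>grad_l g l [\<nu>, \<mu>]\<close> is \<open>\<nabla>\<^sub>\<nu> \<ell>\<^sub>\<mu>\<close>.\<close>

definition grad_l :: "'n::finite metric \<Rightarrow> (real^'n \<Rightarrow> real^'n) \<Rightarrow> ('n, real) tensor_field" where
  "grad_l g l = covd g (\<lambda>\<mu>s x. (g x *v l x) $ hd \<mu>s)"

definition geodetic_at :: "'n::finite metric \<Rightarrow> (real^'n \<Rightarrow> real^'n) \<Rightarrow> real^'n \<Rightarrow> bool" where
  "geodetic_at g l x \<longleftrightarrow>
     (\<exists>\<kappa>. \<forall>\<mu>. (\<Sum>\<nu>\<in>UNIV. l x $ \<nu> * grad_l g l [\<nu>, \<mu>] x) = \<kappa> * (g x *v l x) $ \<mu>)"

text \<open>The optical matrix \<open>\<rho>\<^sub>i\<^sub>j = m\<^sub>i\<^sup>\<mu> m\<^sub>j\<^sup>\<nu> \<nabla>\<^sub>\<nu> \<ell>\<^sub>\<mu>\<close> and its irreducible parts.\<close>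

definition optical ::
  "'n::finite metric \<Rightarrow> (real^'n \<Rightarrow> real^'n) \<Rightarrow> real^'n \<Rightarrow> (nat \<Rightarrow> real^'n) \<Rightarrow> nat \<Rightarrow> nat \<Rightarrow> real" where
  "optical g l x e i j = frame_comp e (\<lambda>\<mu>s. grad_l g l \<mu>s x) [j, i]"

definition expansion ::
  "'n::finite metric \<Rightarrow> (real^'n \<Rightarrow> real^'n) \<Rightarrow> real^'n \<Rightarrow> (nat \<Rightarrow> real^'n) \<Rightarrow> real" where
  "expansion g l x e = (\<Sum>i\<in>{2..<CARD('n)}. optical g l x e i i) / (real CARD('n) - 2)"

definition shear ::
  "'n::finite metric \<Rightarrow> (real^'n \<Rightarrow> real^'n) \<Rightarrow> real^'n \<Rightarrow> (nat \<Rightarrow> real^'n) \<Rightarrow> nat \<Rightarrow> nat \<Rightarrow> real" where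
  "shear g l x e i j = (optical g l x e i j + optical g l x e j i) / 2
     - (if i = j then expansion g l x e else 0)"

definition twist ::
  "'n::finite metric \<Rightarrow> (real^'n \<Rightarrow> real^'n) \<Rightarrow> real^'n \<Rightarrow> (nat \<Rightarrow> real^'n) \<Rightarrow> nat \<Rightarrow> nat \<Rightarrow> real" where
  "twist g l x e i j = (optical g l x e i j - optical g l x e j i) / 2"

definition kundt_vector ::
  "('m, 'n::finite) chart set \<Rightarrow> (('m, 'n) chart \<Rightarrow> 'n metric) \<Rightarrow>
     (('m, 'n) chart \<Rightarrow> real^'n \<Rightarrow> real^'n) \<Rightarrow> bool" where
  "kundt_vector \<A> g l \<longleftrightarrow> vector_field \<A> l \<and>
     (\<forall>c\<in>\<A>. \<forall>x\<in>chart_image c.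
        l c x \<noteq> 0 \<and> metric_form (g c x) (l c x) (l c x) = 0 \<and> geodetic_at (g c) (l c) x \<and>
        (\<forall>e. null_frame (g c x) e \<longrightarrow> e 0 = l c x \<longrightarrow>
           expansion (g c) (l c) x e = 0 \<and>
           (\<forall>i\<in>{2..<CARD('n)}. \<forall>j\<in>{2..<CARD('n)}.
              shear (g c) (l c) x e i j = 0 \<and> twist (g c) (l c) x e i j = 0)))"

text \<open>Degenerate Kundt spacetime with Kundt vector \<open>l\<close>: all derivatives \<open>\<nabla>\<^sup>k\<close> of the Riemann tensor
  have only components of boost weight \<open>\<le> 0\<close> in frames with \<open>e 0 = l\<close>.\<close>

definition degenerate_kundt ::
  "('m, 'n::finite) chart set \<Rightarrow> (('m, 'n) chart \<Rightarrow> 'n metric) \<Rightarrow>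
     (('m, 'n) chart \<Rightarrow> real^'n \<Rightarrow> real^'n) \<Rightarrow> bool" where
  "degenerate_kundt \<A> g l \<longleftrightarrow> kundt_vector \<A> g l \<and>
     (\<forall>c\<in>\<A>. \<forall>x\<in>chart_image c. \<forall>e. null_frame (g c x) e \<longrightarrow> e 0 = l c x \<longrightarrow>
        (\<forall>k as. length as = k + 4 \<longrightarrow> set as \<subseteq> {..<CARD('n)} \<longrightarrow>
           frame_comp e (\<lambda>\<mu>s. (covd (g c) ^^ k) (riemann (g c)) \<mu>s x) as \<noteq> 0 \<longrightarrow>
           boost_weight as \<le> 0))"

end

theory Submission
  imports Defs
begin

text \<open>
  A null vector \<open>l\<close> filters the tangent space by \<open>span l \<subseteq> l\<^sup>\<bottom> \<subseteq> V\<close>, with weights \<open>1, 0, -1\<close>, and a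
  tensor has boost order \<open>\<le> b\<close> if it vanishes on vectors of total weight \<open>> b\<close>. The metric and the
  volume element have order \<open>\<le> 0\<close>, and orders add up under products and do not grow under
  contractions. So if the field strength and its derivatives have order \<open>\<le> -1\<close>, every polynomial
  scalar equals its constant term.

  For the derivatives \<open>D\<^sup>NF\<close> this is shown by induction on \<open>N\<close>. In a Kundt spacetime \<open>\<nabla>\<^sub>X\<close> with \<open>X\<close> of
  weight \<open>u \<le> 0\<close> shifts the filtration by \<open>u\<close>, so \<open>D\<^sup>N\<^sup>+\<^sup>1F\<close> vanishes on the relevant arguments when the
  first one has weight \<open>\<le> 0\<close>. A derivative index of weight \<open>\<le> 0\<close> further back is moved to the front:
  by the Ricci identity the commutators are derivatives of products of the curvature, of order \<open>\<le> 0\<close>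
  by degeneracy, and of lower derivatives of \<open>F\<close>, of order \<open>\<le> -1\<close> by induction. If all derivative
  indices are contracted with \<open>l\<close>, the result is zero, since \<open>\<nabla>\<^sub>l l\<close> is proportional to \<open>l\<close> and the
  Bianchi identity gives \<open>D\<^sub>l F = 0\<close>. Working with the filtration instead of parallel frames
  avoids solving differential equations along \<open>l\<close>.
\<close>

section \<open>Calculus of smooth functions\<close>

text \<open>The restriction to directions of weight at most 0 is forced. Along \<open>l\<close> the
  analogous statement would require nabla_l to raise the index of every argument field by 1: nabla_l
  of a field orthogonal to \<open>l\<close> would have to be a multiple of \<open>l\<close>, and
  nabla_l n orthogonal to \<open>l\<close>. Fields that are parallel along an affinely parametrised
  \<open>l\<close> achieve this, general extensions do not. Derivative slots filled with
  \<open>l\<close> are therefore handled by identities that can be differentiated along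
  \<open>l\<close> again: F(l, .) = 0, and then D_l F = 0. A second obstacle is that a commutator
  inside D^N F still has derivatives in front of it. A pointwise bound says nothing about these, so
  the commutator must be bounded together with its derivatives; this is the purpose of
  \<open>order_upto\<close>. With p derivatives in front and j behind, p + j = N - 2, so the Leibniz
  rule yields only derivatives of F of order below N. The bound -1 reproduces itself: F times D^j F
  has order -2, curvature times D^j F has order 0 + (-1).\<close>

lemma partial_deriv_eqI:
  assumes "(f has_derivative f') (at x)"
  shows "partial_deriv i f x = f' (axis i 1)"
  using frechet_derivative_at[OF assms] by (simp add: partial_deriv_def)

lemma differentiable_on_openD:
  assumes "f differentiable_on S" "open S" "x \<in> S"
  shows "f differentiable (at x)"
  using assms by (simp add: differentiable_on_eq_differentiable_at)

lemma partial_deriv_cong_open: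
  assumes "open S" "x \<in> S" "\<And>y. y \<in> S \<Longrightarrow> f y = g y"
  shows "partial_deriv i f x = partial_deriv i g x"
proof -
  have *: "(f has_derivative D) (at x) \<longleftrightarrow> (g has_derivative D) (at x)" for D
    using has_derivative_transform_within_open[of f D x UNIV S g]
      has_derivative_transform_within_open[of g D x UNIV S f] assms by auto
  then show ?thesis by (simp add: partial_deriv_def frechet_derivative_def)
qed

lemma frechet_derivative_partial_deriv:
  fixes f :: "real^'n::finite \<Rightarrow> 'v::real_normed_vector"
  assumes "f differentiable (at x)"
  shows "frechet_derivative f (at x) v = (\<Sum>i\<in>UNIV. v $ i *\<^sub>R partial_deriv i f x)"
proof -
  have lin: "linear (frechet_derivative f (at x))" by (rule linear_frechet_derivative[OF assms])
  have "v = (\<Sum>i\<in>UNIV. v $ i *\<^sub>R axis i 1)"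
    using basis_expansion[of v] by (simp add: scalar_mult_eq_scaleR)
  then have "frechet_derivative f (at x) v = frechet_derivative f (at x) (\<Sum>i\<in>UNIV. v $ i *\<^sub>R axis i 1)"
    by simp
  also have "\<dots> = (\<Sum>i\<in>UNIV. v $ i *\<^sub>R partial_deriv i f x)"
    by (simp add: linear_sum[OF lin] linear_scale[OF lin] partial_deriv_def)
  finally show ?thesis .
qed

lemma Ck_on_cong:
  assumes "open S" "\<And>x. x \<in> S \<Longrightarrow> f x = g x" "Ck_on k f S"
  shows "Ck_on k g S"
  using assms(2,3)
proof (induction k arbitrary: f g)
  case 0
  then show ?case using continuous_on_cong[of S S f g] by simp
next
  case (Suc k)
  have "f differentiable_on S" using Suc.prems by simp
  then have "g differentiable_on S"
    using Suc.prems(1) unfolding differentiable_on_def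
    by (metis differentiable_transform_within zero_less_one)
  moreover have "Ck_on k (partial_deriv i g) S" for i
  proof (rule Suc.IH)
    show "Ck_on k (partial_deriv i f) S" using Suc.prems by simp
    show "partial_deriv i f x = partial_deriv i g x" if "x \<in> S" for x
      using partial_deriv_cong_open[OF assms(1) that Suc.prems(1)] by simp
  qed
  ultimately show ?case by simp
qed

lemma Ck_on_Suc_imp: "Ck_on (Suc k) f S \<Longrightarrow> Ck_on k f S"
  by (induction k arbitrary: f) (auto simp: differentiable_imp_continuous_on)

lemma smooth_on_cong:
  "open S \<Longrightarrow> (\<And>x. x \<in> S \<Longrightarrow> f x = g x) \<Longrightarrow> smooth_on f S \<Longrightarrow> smooth_on g S"
  unfolding smooth_on_def using Ck_on_cong[of S f g] by simp

lemma smooth_on_partial_deriv: "smooth_on f S \<Longrightarrow> smooth_on (partial_deriv i f) S"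
  unfolding smooth_on_def by (metis Ck_on.simps(2))

lemma smooth_on_differentiable: "smooth_on f S \<Longrightarrow> open S \<Longrightarrow> x \<in> S \<Longrightarrow> f differentiable (at x)"
  unfolding smooth_on_def using differentiable_on_openD by (metis Ck_on.simps(2))

lemma smooth_on_has_derivative:
  "smooth_on f S \<Longrightarrow> open S \<Longrightarrow> x \<in> S \<Longrightarrow> (f has_derivative frechet_derivative f (at x)) (at x)"
  using smooth_on_differentiable frechet_derivative_works by blast

lemma smooth_on_continuous: "smooth_on f S \<Longrightarrow> continuous_on S f"
  unfolding smooth_on_def by (metis Ck_on.simps(1))

lemma Ck_on_const: "Ck_on k (\<lambda>x :: real^'n::finite. c) S"
proof (induction k arbitrary: c)
  case (Suc k)
  have "partial_deriv i (\<lambda>x. c) = (\<lambda>x. 0)" for i :: 'n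
    by (auto simp: partial_deriv_def)
  then show ?case using Suc by simp
qed simp

lemma smooth_on_const [intro!]: "smooth_on (\<lambda>x. c) S"
  by (simp add: smooth_on_def Ck_on_const)

section \<open>Differentiation rules and closure properties of smooth functions\<close>

lemma partial_deriv_add:
  assumes "f differentiable (at x)" "g differentiable (at x)"
  shows "partial_deriv i (\<lambda>x. f x + g x) x = partial_deriv i f x + partial_deriv i g x"
  using partial_deriv_eqI[OF has_derivative_add[OF assms[unfolded frechet_derivative_works]], of i]
  by (simp add: partial_deriv_def)

lemma partial_deriv_bounded_bilinear:
  assumes "bounded_bilinear pr" "f differentiable (at x)" "g differentiable (at x)"
  shows "partial_deriv i (\<lambda>x. pr (f x) (g x)) x = pr (f x) (partial_deriv i g x) + pr (partial_deriv i f x) (g x)"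
  using partial_deriv_eqI[OF bounded_bilinear.FDERIV[OF assms(1) assms(2,3)[unfolded frechet_derivative_works]], of i]
  by (simp add: partial_deriv_def)

lemma partial_deriv_bounded_linear:
  assumes "bounded_linear L" "f differentiable (at x)"
  shows "partial_deriv i (\<lambda>x. L (f x)) x = L (partial_deriv i f x)"
  using partial_deriv_eqI[OF bounded_linear.has_derivative[OF assms(1) assms(2)[unfolded frechet_derivative_works]], of i]
  by (simp add: partial_deriv_def)

lemma differentiable_bounded_bilinear:
  assumes "bounded_bilinear pr" "f differentiable (at x)" "g differentiable (at x)"
  shows "(\<lambda>y. pr (f y) (g y)) differentiable (at x)"
  using bounded_bilinear.FDERIV[OF assms(1) assms(2,3)[unfolded frechet_derivative_works]]
  by (rule differentiableI)

lemma frechet_derivative_eq_0: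
  assumes "open S" "x \<in> S" "\<And>y. y \<in> S \<Longrightarrow> f y = 0"
  shows "frechet_derivative f (at x) X = 0"
proof -
  have "(f has_derivative (\<lambda>X. 0)) (at x)"
    by (rule has_derivative_transform_within_open[OF has_derivative_const assms(1,2)]) (simp add: assms(3))
  then show ?thesis by (simp add: frechet_derivative_at[symmetric])
qed

lemma partial_deriv_const [simp]: "partial_deriv i (\<lambda>x. c) x = 0"
  by (simp add: partial_deriv_def)

text \<open>\<open>Ck_on\<close> is phrased with \<open>frechet_derivative\<close>, a choice. With
  this rule the induction step of a closure property needs only an explicit derivative and its
  regularity of order k.\<close>

lemma Ck_on_SucI:
  assumes "open S" "\<And>x. x \<in> S \<Longrightarrow> (f has_derivative f' x) (at x)"
    and "\<And>i. Ck_on k (\<lambda>x. f' x (axis i 1)) S"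
  shows "Ck_on (Suc k) f S"
proof -
  have "Ck_on k (partial_deriv i f) S" for i
    by (rule Ck_on_cong[OF assms(1) _ assms(3)[of i]]) (simp add: partial_deriv_eqI[OF assms(2)])
  moreover have "f differentiable_on S"
    using assms(2)[THEN has_derivative_at_withinI] by (auto simp: differentiable_on_def differentiable_def)
  ultimately show ?thesis by simp
qed

lemma Ck_on_Suc_has_derivative:
  assumes "open S" "Ck_on (Suc k) f S" "x \<in> S"
  shows "(f has_derivative frechet_derivative f (at x)) (at x)"
  using assms differentiable_on_openD[of f S x] frechet_derivative_works by auto

lemma Ck_on_add:
  assumes "open S" "Ck_on k f S" "Ck_on k g S"
  shows "Ck_on k (\<lambda>x. f x + g x) S"
  using assms(2,3)
proof (induction k arbitrary: f g)
  case 0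
  then show ?case by (simp add: continuous_on_add)
next
  case (Suc k)
  have "Ck_on k (\<lambda>x. partial_deriv i f x + partial_deriv i g x) S" for i
    by (rule Suc.IH) (use Suc.prems in auto)
  then show ?case
    by (intro Ck_on_SucI[OF assms(1) has_derivative_add[OF Ck_on_Suc_has_derivative[OF assms(1) Suc.prems(1)]
          Ck_on_Suc_has_derivative[OF assms(1) Suc.prems(2)]]])
       (simp_all add: partial_deriv_def)
qed

text \<open>Each Leibniz term pairs one factor with a partial derivative of the other, so the
  induction on k must leave f and g arbitrary. In this generality it serves scalar multiplication,
  matrix products and the bracket alike.\<close>

lemma Ck_on_bounded_bilinear:
  assumes "open S" "bounded_bilinear pr" "Ck_on k f S" "Ck_on k g S"
  shows "Ck_on k (\<lambda>x. pr (f x) (g x)) S"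
  using assms(3,4)
proof (induction k arbitrary: f g)
  case 0
  then show ?case using bounded_bilinear.continuous_on[OF assms(2)] by simp
next
  case (Suc k)
  have c: "Ck_on k f S" "Ck_on k g S" using Suc.prems Ck_on_Suc_imp by blast+
  have "Ck_on k (\<lambda>x. pr (f x) (partial_deriv i g x) + pr (partial_deriv i f x) (g x)) S" for i
    by (rule Ck_on_add[OF assms(1) Suc.IH Suc.IH]) (use c Suc.prems in auto)
  then show ?case
    by (intro Ck_on_SucI[OF assms(1) bounded_bilinear.FDERIV[OF assms(2)
          Ck_on_Suc_has_derivative[OF assms(1) Suc.prems(1)] Ck_on_Suc_has_derivative[OF assms(1) Suc.prems(2)]]])
       (simp_all add: partial_deriv_def)
qed

lemma smooth_on_bounded_bilinear:
  "open S \<Longrightarrow> bounded_bilinear pr \<Longrightarrow> smooth_on f S \<Longrightarrow> smooth_on g S \<Longrightarrow> smooth_on (\<lambda>x. pr (f x) (g x)) S"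
  by (simp add: smooth_on_def Ck_on_bounded_bilinear)

lemma smooth_on_add: "open S \<Longrightarrow> smooth_on f S \<Longrightarrow> smooth_on g S \<Longrightarrow> smooth_on (\<lambda>x. f x + g x) S"
  by (simp add: smooth_on_def Ck_on_add)

lemma smooth_on_scaleR: "open S \<Longrightarrow> smooth_on f S \<Longrightarrow> smooth_on g S \<Longrightarrow> smooth_on (\<lambda>x. f x *\<^sub>R g x) S"
  by (rule smooth_on_bounded_bilinear[OF _ bounded_bilinear_scaleR])

lemma smooth_on_mult:
  fixes f g :: "real^'n::finite \<Rightarrow> real"
  shows "open S \<Longrightarrow> smooth_on f S \<Longrightarrow> smooth_on g S \<Longrightarrow> smooth_on (\<lambda>x. f x * g x) S"
  by (rule smooth_on_bounded_bilinear[OF _ bounded_bilinear_mult])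

lemma smooth_on_bounded_linear:
  assumes "open S" "bounded_linear L" "smooth_on f S"
  shows "smooth_on (\<lambda>x. L (f x)) S"
proof -
  \<comment> \<open>A linear map is a bilinear one with the constant 1 in the first
    argument.\<close>
  have "bounded_bilinear (\<lambda>(c::real) v. c *\<^sub>R L v)"
    using bounded_bilinear.comp[OF bounded_bilinear_scaleR bounded_linear_ident assms(2)] by simp
  from smooth_on_bounded_bilinear[OF assms(1) this smooth_on_const[of 1] assms(3)]
  show ?thesis by simp
qed

lemma smooth_on_uminus: "open S \<Longrightarrow> smooth_on f S \<Longrightarrow> smooth_on (\<lambda>x. - f x) S"
  by (rule smooth_on_bounded_linear) (auto intro: bounded_linear_minus bounded_linear_ident)

lemma smooth_on_diff: "open S \<Longrightarrow> smooth_on f S \<Longrightarrow> smooth_on g S \<Longrightarrow> smooth_on (\<lambda>x. f x - g x) S"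
  using smooth_on_add[of S f "\<lambda>x. - g x"] smooth_on_uminus[of S g] by simp

lemma smooth_on_sum:
  assumes "open S" "\<And>i. i \<in> I \<Longrightarrow> smooth_on (f i) S"
  shows "smooth_on (\<lambda>x. \<Sum>i\<in>I. f i x) S"
  using assms(2) by (induction I rule: infinite_finite_induct) (auto intro: smooth_on_add[OF assms(1)])

lemma smooth_on_prod:
  fixes f :: "'i \<Rightarrow> real^'n::finite \<Rightarrow> real"
  assumes "open S" "\<And>i. i \<in> I \<Longrightarrow> smooth_on (f i) S"
  shows "smooth_on (\<lambda>x. \<Prod>i\<in>I. f i x) S"
  using assms(2) by (induction I rule: infinite_finite_induct) (auto intro: smooth_on_mult[OF assms(1)])

lemma smooth_on_vec_nth: "open S \<Longrightarrow> smooth_on f S \<Longrightarrow> smooth_on (\<lambda>x. f x $ i) S"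
  by (rule smooth_on_bounded_linear[OF _ bounded_linear_vec_nth])

text \<open>The derivative - f^(-1) f' f^(-1) contains the reciprocal itself, but its regularity of
  order k suffices for order k + 1.\<close>

lemma smooth_on_inverse:
  fixes f :: "real^'n::finite \<Rightarrow> real"
  assumes "open S" "smooth_on f S" "\<And>x. x \<in> S \<Longrightarrow> f x \<noteq> 0"
  shows "smooth_on (\<lambda>x. inverse (f x)) S"
proof -
  have "Ck_on k (\<lambda>x. inverse (f x)) S" for k
  proof (induction k)
    case 0
    then show ?case using smooth_on_continuous[OF assms(2)] assms(3) by (simp add: continuous_on_inverse)
  next
    case (Suc k)
    have hd: "((\<lambda>x. inverse (f x)) has_derivative (\<lambda>h. - (inverse (f x) * frechet_derivative f (at x) h * inverse (f x)))) (at x)"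
      if "x \<in> S" for x
      using Deriv.has_derivative_inverse[OF assms(3)[OF that] smooth_on_has_derivative[OF assms(2,1) that]] .
    have "Ck_on k (\<lambda>x. (-1) * (inverse (f x) * (partial_deriv i f x * inverse (f x)))) S" for i
      using smooth_on_partial_deriv[OF assms(2), of i]
      by (intro Ck_on_bounded_bilinear[OF assms(1) bounded_bilinear_mult] Suc Ck_on_const)
         (auto simp: smooth_on_def)
    then show ?case
      by (intro Ck_on_SucI[OF assms(1) hd]) (simp_all add: partial_deriv_def mult.assoc)
  qed
  then show ?thesis by (simp add: smooth_on_def)
qed

lemma smooth_on_det:
  fixes M :: "real^'n::finite \<Rightarrow> real^'m::finite^'m"
  assumes "open S" "\<And>i j. smooth_on (\<lambda>x. M x $ i $ j) S"
  shows "smooth_on (\<lambda>x. det (M x)) S"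
  unfolding det_def
  by (intro smooth_on_sum smooth_on_mult smooth_on_prod smooth_on_const assms)

section \<open>Smoothness of the inverse matrix\<close>

lemma matrix_inv_left: "invertible A \<Longrightarrow> matrix_inv A ** A = mat 1"
  and matrix_inv_right: "invertible A \<Longrightarrow> A ** matrix_inv A = mat 1"
  unfolding invertible_def matrix_inv_def by (metis (mono_tags, lifting) someI_ex)+

text \<open>Cramer's rule exhibits the entries as quotients of determinants, that is, of polynomials
  in the entries of \<open>A\<close>, which reduces smoothness of the inverse metric to sums,
  products and one reciprocal.\<close>

lemma matrix_inv_cramer:
  fixes A :: "real^'n::finite^'n"
  assumes "invertible A"
  shows "matrix_inv A $ k $ j = det (\<chi> p q. if q = k then (if p = j then 1 else 0) else A $ p $ q) / det A"
proof -
  have d: "det A \<noteq> 0" using assms invertible_det_nz by blast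
  have "A *v (matrix_inv A *v axis j 1) = axis j 1"
    by (simp add: matrix_vector_mul_assoc matrix_inv_right[OF assms])
  then have "matrix_inv A *v axis j 1 = (\<chi> k. det (\<chi> p q. if q = k then axis j 1 $ p else A $ p $ q) / det A)"
    using cramer[OF d] by blast
  then have "(matrix_inv A *v axis j 1) $ k = det (\<chi> p q. if q = k then axis j 1 $ p else A $ p $ q) / det A"
    by simp
  moreover have "(matrix_inv A *v axis j 1) $ k = matrix_inv A $ k $ j"
    by (simp add: matrix_vector_mult_basis column_def)
  ultimately show ?thesis by (simp add: axis_def if_distrib cong: if_cong)
qed

lemma smooth_on_matrix_inv:
  fixes M :: "real^'n::finite \<Rightarrow> real^'m::finite^'m"
  assumes "open S" "\<And>i j. smooth_on (\<lambda>x. M x $ i $ j) S" "\<And>x. x \<in> S \<Longrightarrow> invertible (M x)"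
  shows "smooth_on (\<lambda>x. matrix_inv (M x) $ k $ j) S"
proof -
  have "smooth_on (\<lambda>x. det (\<chi> p q. if q = k then (if p = j then 1 else 0) else M x $ p $ q) * inverse (det (M x))) S"
  proof (intro smooth_on_mult smooth_on_det smooth_on_inverse assms)
    fix p q
    show "smooth_on (\<lambda>x. (\<chi> p q. if q = k then (if p = j then 1 else 0) else M x $ p $ q) $ p $ q) S"
      using assms(2) smooth_on_const by (cases "q = k") auto
  qed (use assms(3) invertible_det_nz in auto)
  then show ?thesis
    by (rule smooth_on_cong[OF assms(1), rotated]) (simp add: matrix_inv_cramer[OF assms(3)] divide_inverse)
qed

section \<open>Equality of mixed partial derivatives\<close>

lemma real_mvt_difference:
  fixes f f' :: "real \<Rightarrow> real"
  assumes "0 < h" "\<And>s. 0 \<le> s \<Longrightarrow> s \<le> h \<Longrightarrow> (f has_real_derivative f' s) (at s)"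
  shows "\<exists>s. 0 < s \<and> s < h \<and> f h - f 0 = h * f' s"
  using MVT2[of 0 h f f'] assms by auto

lemma has_real_derivative_line:
  fixes f :: "real^'n::finite \<Rightarrow> real"
  assumes "f differentiable (at (p + s *\<^sub>R axis i 1))"
  shows "((\<lambda>s. f (p + s *\<^sub>R axis i 1)) has_real_derivative partial_deriv i f (p + s *\<^sub>R axis i 1)) (at s)"
proof -
  let ?y = "p + s *\<^sub>R axis i 1"
  have 1: "(f has_derivative frechet_derivative f (at ?y)) (at ?y)"
    using assms frechet_derivative_works by blast
  have 2: "((\<lambda>s. p + s *\<^sub>R axis i 1) has_derivative (\<lambda>h. h *\<^sub>R axis i 1)) (at s)"
    by (auto intro!: derivative_eq_intros)
  have "linear (frechet_derivative f (at ?y))" by (rule linear_frechet_derivative[OF assms])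
  then have "frechet_derivative f (at ?y) (h *\<^sub>R axis i 1) = partial_deriv i f ?y * h" for h
    by (simp add: linear_scale partial_deriv_def mult.commute)
  then show ?thesis
    using has_derivative_compose[OF 2 1] by (simp add: has_field_derivative_def)
qed

text \<open>Clairaut's theorem: by the mean value theorem the second difference over a square of side
  \<open>h\<close> equals \<open>h\<^sup>2\<close> times either mixed derivative, at suitable points of the square.\<close>

lemma second_difference_mvt:
  fixes f :: "real^'n::finite \<Rightarrow> real"
  assumes S: "open S" and f: "smooth_on f S" and h: "0 < h"
    and sq: "\<And>s t. 0 \<le> s \<Longrightarrow> s \<le> h \<Longrightarrow> 0 \<le> t \<Longrightarrow> t \<le> h \<Longrightarrow> x + s *\<^sub>R axis i 1 + t *\<^sub>R axis j 1 \<in> S"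
  shows "\<exists>s t. 0 < s \<and> s < h \<and> 0 < t \<and> t < h \<and>
    f (x + h *\<^sub>R axis i 1 + h *\<^sub>R axis j 1) - f (x + h *\<^sub>R axis i 1) - f (x + h *\<^sub>R axis j 1) + f x
      = h * h * partial_deriv j (partial_deriv i f) (x + s *\<^sub>R axis i 1 + t *\<^sub>R axis j 1)"
proof -
  note d = smooth_on_differentiable[OF f S]
  note d' = smooth_on_differentiable[OF smooth_on_partial_deriv[OF f, of i] S]
  have c: "p + t *\<^sub>R axis j 1 + s *\<^sub>R axis i 1 = p + s *\<^sub>R axis i 1 + t *\<^sub>R axis j (1::real)"
    for p :: "real^'n" and s t by simp
  have "((\<lambda>s. f (x + h *\<^sub>R axis j 1 + s *\<^sub>R axis i 1) - f (x + s *\<^sub>R axis i 1)) has_real_derivative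
      partial_deriv i f (x + h *\<^sub>R axis j 1 + s *\<^sub>R axis i 1) - partial_deriv i f (x + s *\<^sub>R axis i 1)) (at s)"
    if "0 \<le> s" "s \<le> h" for s
    using that h sq[of s 0] sq[of s h]
    by (intro DERIV_diff has_real_derivative_line d) (auto simp: c)
  from real_mvt_difference[OF h this]
  obtain s where s: "0 < s" "s < h" and
    e1: "f (x + h *\<^sub>R axis j 1 + h *\<^sub>R axis i 1) - f (x + h *\<^sub>R axis i 1) - (f (x + h *\<^sub>R axis j 1) - f x)
      = h * (partial_deriv i f (x + h *\<^sub>R axis j 1 + s *\<^sub>R axis i 1) - partial_deriv i f (x + s *\<^sub>R axis i 1))"
    by auto
  have "((\<lambda>t. partial_deriv i f (x + s *\<^sub>R axis i 1 + t *\<^sub>R axis j 1)) has_real_derivative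
      partial_deriv j (partial_deriv i f) (x + s *\<^sub>R axis i 1 + t *\<^sub>R axis j 1)) (at t)"
    if "0 \<le> t" "t \<le> h" for t
    using that s sq[of s t] by (intro has_real_derivative_line d') auto
  from real_mvt_difference[OF h this]
  obtain t where t: "0 < t" "t < h" and
    e2: "partial_deriv i f (x + s *\<^sub>R axis i 1 + h *\<^sub>R axis j 1) - partial_deriv i f (x + s *\<^sub>R axis i 1)
      = h * partial_deriv j (partial_deriv i f) (x + s *\<^sub>R axis i 1 + t *\<^sub>R axis j 1)"
    by auto
  show ?thesis
    using s t e1 e2 by (intro exI[of _ s] exI[of _ t]) (simp add: c)
qed

lemma partial_deriv_commute_real:
  fixes f :: "real^'n::finite \<Rightarrow> real"
  assumes S: "open S" and f: "smooth_on f S" and x: "x \<in> S"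
  shows "partial_deriv i (partial_deriv j f) x = partial_deriv j (partial_deriv i f) x"
proof (rule ccontr)
  define A where "A = partial_deriv i (partial_deriv j f)"
  define B where "B = partial_deriv j (partial_deriv i f)"
  assume "\<not> ?thesis"
  then have ne: "A x \<noteq> B x" by (simp add: A_def B_def)
  \<comment> \<open>Half of the supposed gap: numbers closer than this to \<open>A x\<close> and to
    \<open>B x\<close> respectively cannot coincide.\<close>
  define \<epsilon> where "\<epsilon> = \<bar>A x - B x\<bar> / 2"
  have e: "\<epsilon> > 0" using ne by (simp add: \<epsilon>_def)
  have "isCont A x" "isCont B x"
    using smooth_on_continuous[OF smooth_on_partial_deriv[OF smooth_on_partial_deriv[OF f]]] S x
    by (auto simp: continuous_on_eq_continuous_at A_def B_def)
  then obtain d1 d2 where d: "d1 > 0" "d2 > 0"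
    and d1: "\<And>y. dist y x < d1 \<Longrightarrow> dist (A y) (A x) < \<epsilon>"
    and d2: "\<And>y. dist y x < d2 \<Longrightarrow> dist (B y) (B x) < \<epsilon>"
    using e unfolding continuous_at_eps_delta by metis
  obtain d3 where d3: "d3 > 0" "ball x d3 \<subseteq> S" using S x open_contains_ball by metis
  \<comment> \<open>The divisor 3 works because a point of the square of side h is at distance at
    most s + t < 3 h from x.\<close>
  define h where "h = min d1 (min d2 d3) / 3"
  have h: "h > 0" using d d3 by (simp add: h_def)
  have near: "dist (x + s *\<^sub>R axis k 1 + t *\<^sub>R axis l 1) x < min d1 (min d2 d3)"
    if "0 \<le> s" "s \<le> h" "0 \<le> t" "t \<le> h" for s t and k l :: 'n
  proof -
    have "norm (s *\<^sub>R axis k (1::real) + t *\<^sub>R axis l 1) \<le> s + t"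
      using norm_triangle_ineq[of "s *\<^sub>R axis k (1::real)" "t *\<^sub>R axis l 1"] that by simp
    then have "dist (x + s *\<^sub>R axis k 1 + t *\<^sub>R axis l 1) x \<le> s + t"
      by (simp add: dist_norm add.assoc)
    also have "\<dots> < 3 * h" using that h by simp
    finally show ?thesis by (simp add: h_def)
  qed
  have sq: "x + s *\<^sub>R axis k 1 + t *\<^sub>R axis l 1 \<in> S"
    if "0 \<le> s" "s \<le> h" "0 \<le> t" "t \<le> h" for s t and k l :: 'n
    using near[OF that, of k l] d3(2) by (auto simp: dist_commute subset_iff)
  from second_difference_mvt[OF S f h sq, where i=i and j=j] obtain s t where st: "0 < s" "s < h" "0 < t" "t < h"
    and 1: "f (x + h *\<^sub>R axis i 1 + h *\<^sub>R axis j 1) - f (x + h *\<^sub>R axis i 1) - f (x + h *\<^sub>R axis j 1) + f x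
      = h * h * B (x + s *\<^sub>R axis i 1 + t *\<^sub>R axis j 1)" unfolding B_def by blast
  from second_difference_mvt[OF S f h sq, where i=j and j=i] obtain s' t' where st': "0 < s'" "s' < h" "0 < t'" "t' < h"
    and 2: "f (x + h *\<^sub>R axis j 1 + h *\<^sub>R axis i 1) - f (x + h *\<^sub>R axis j 1) - f (x + h *\<^sub>R axis i 1) + f x
      = h * h * A (x + s' *\<^sub>R axis j 1 + t' *\<^sub>R axis i 1)" unfolding A_def by blast
  have c: "x + h *\<^sub>R axis j 1 + h *\<^sub>R axis i 1 = x + h *\<^sub>R axis i 1 + h *\<^sub>R axis j (1::real)" by simp
  have "h * h * B (x + s *\<^sub>R axis i 1 + t *\<^sub>R axis j 1) = h * h * A (x + s' *\<^sub>R axis j 1 + t' *\<^sub>R axis i 1)"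
    using 1 2 unfolding c by linarith
  then have "B (x + s *\<^sub>R axis i 1 + t *\<^sub>R axis j 1) = A (x + s' *\<^sub>R axis j 1 + t' *\<^sub>R axis i 1)"
    using h by simp
  moreover have "dist (B (x + s *\<^sub>R axis i 1 + t *\<^sub>R axis j 1)) (B x) < \<epsilon>"
    using near[of s t i j] st by (intro d2) auto
  moreover have "dist (A (x + s' *\<^sub>R axis j 1 + t' *\<^sub>R axis i 1)) (A x) < \<epsilon>"
    using near[of s' t' j i] st' by (intro d1) auto
  ultimately show False
    unfolding \<epsilon>_def dist_real_def by (smt (verit) field_sum_of_halves)
qed

lemma partial_deriv_commute:
  fixes f :: "real^'n::finite \<Rightarrow> 'v::euclidean_space"
  assumes S: "open S" and f: "smooth_on f S" and x: "x \<in> S"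
  shows "partial_deriv i (partial_deriv j f) x = partial_deriv j (partial_deriv i f) x"
proof (rule euclidean_eqI)
  fix b :: 'v
  have bl: "bounded_linear (\<lambda>v::'v. v \<bullet> b)" by (rule bounded_linear_inner_left)
  have *: "partial_deriv k (partial_deriv l (\<lambda>x. f x \<bullet> b)) x = partial_deriv k (partial_deriv l f) x \<bullet> b" for k l
  proof -
    have "partial_deriv k (partial_deriv l (\<lambda>x. f x \<bullet> b)) x = partial_deriv k (\<lambda>x. partial_deriv l f x \<bullet> b) x"
      by (rule partial_deriv_cong_open[OF S x])
         (simp add: partial_deriv_bounded_linear[OF bl smooth_on_differentiable[OF f S]])
    also have "\<dots> = partial_deriv k (partial_deriv l f) x \<bullet> b"
      by (rule partial_deriv_bounded_linear[OF bl smooth_on_differentiable[OF smooth_on_partial_deriv[OF f] S x]])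
    finally show ?thesis .
  qed
  have "smooth_on (\<lambda>x. f x \<bullet> b) S" by (rule smooth_on_bounded_linear[OF S bl f])
  from partial_deriv_commute_real[OF S this x, of i j]
  show "partial_deriv i (partial_deriv j f) x \<bullet> b = partial_deriv j (partial_deriv i f) x \<bullet> b"
    by (simp add: *)
qed

section \<open>Multilinear algebra on index lists\<close>

definition slot :: "real^'n::finite \<Rightarrow> ('n list \<Rightarrow> 'v::real_vector) \<Rightarrow> 'n list \<Rightarrow> 'v" where
  "slot v T \<mu>s = (\<Sum>\<mu>\<in>UNIV. v $ \<mu> *\<^sub>R T (\<mu> # \<mu>s))"

text \<open>The multilinear form with components \<open>T\<close>. Recursion on the first slot fits
  the convention that differentiation adds its index in front, so a derivative direction is simply
  consed onto the arguments.\<close>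

primrec ev :: "(real^'n::finite) list \<Rightarrow> ('n list \<Rightarrow> 'v::real_vector) \<Rightarrow> 'v" where
  "ev [] T = T []"
| "ev (v # vs) T = ev vs (slot v T)"

lemma ev_cong: "(\<And>\<mu>s. length \<mu>s = length vs \<Longrightarrow> T \<mu>s = T' \<mu>s) \<Longrightarrow> ev vs T = ev vs T'"
proof (induction vs arbitrary: T T')
  case (Cons v vs)
  show ?case
    unfolding ev.simps by (rule Cons.IH) (simp add: slot_def Cons.prems)
qed simp

lemma slot_linear_image: "linear L \<Longrightarrow> slot v (\<lambda>\<mu>s. L (T \<mu>s)) = (\<lambda>\<mu>s. L (slot v T \<mu>s))"
  by (auto simp: slot_def fun_eq_iff linear_sum linear_scale)

lemma ev_linear_image: "linear L \<Longrightarrow> ev vs (\<lambda>\<mu>s. L (T \<mu>s)) = L (ev vs T)"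
  by (induction vs arbitrary: T) (simp_all add: slot_linear_image)

lemma ev_add: "ev vs (\<lambda>\<mu>s. T \<mu>s + T' \<mu>s) = ev vs T + ev vs T'"
proof (induction vs arbitrary: T T')
  case (Cons v vs)
  have "slot v (\<lambda>\<mu>s. T \<mu>s + T' \<mu>s) = (\<lambda>\<mu>s. slot v T \<mu>s + slot v T' \<mu>s)"
    by (simp add: slot_def fun_eq_iff scaleR_add_right sum.distrib)
  then show ?case by (simp add: Cons.IH)
qed simp

lemma ev_scaleR: "ev vs (\<lambda>\<mu>s. c *\<^sub>R T \<mu>s) = c *\<^sub>R ev vs T"
  by (rule ev_linear_image) (simp add: linear_scale_self)

lemma ev_zero [simp]: "ev vs (\<lambda>\<mu>s. 0) = 0"
  using ev_scaleR[of vs 0 "\<lambda>_. 0"] by simp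

lemma ev_uminus: "ev vs (\<lambda>\<mu>s. - T \<mu>s) = - ev vs T"
  using ev_scaleR[of vs "-1" T] by simp

lemma ev_diff: "ev vs (\<lambda>\<mu>s. T \<mu>s - T' \<mu>s) = ev vs T - ev vs T'"
  using ev_add[of vs T "\<lambda>\<mu>s. - T' \<mu>s"] by (simp add: ev_uminus)

lemma ev_sum: "ev vs (\<lambda>\<mu>s. \<Sum>i\<in>I. T i \<mu>s) = (\<Sum>i\<in>I. ev vs (T i))"
  by (induction I rule: infinite_finite_induct) (simp_all add: ev_add)

lemma slot_sum_scaleR: "slot (\<Sum>a\<in>I. c a *\<^sub>R v a) T = (\<lambda>\<mu>s. \<Sum>a\<in>I. c a *\<^sub>R slot (v a) T \<mu>s)"
proof
  fix \<mu>s
  have "slot (\<Sum>a\<in>I. c a *\<^sub>R v a) T \<mu>s = (\<Sum>\<mu>\<in>UNIV. \<Sum>a\<in>I. c a *\<^sub>R v a $ \<mu> *\<^sub>R T (\<mu> # \<mu>s))"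
    by (simp add: slot_def scaleR_sum_left)
  also have "\<dots> = (\<Sum>a\<in>I. c a *\<^sub>R slot (v a) T \<mu>s)"
    by (subst sum.swap) (simp add: slot_def scaleR_sum_right)
  finally show "slot (\<Sum>a\<in>I. c a *\<^sub>R v a) T \<mu>s = (\<Sum>a\<in>I. c a *\<^sub>R slot (v a) T \<mu>s)" .
qed

lemma ev_append: "ev (us @ vs) T = ev vs (\<lambda>\<nu>s. ev us (\<lambda>\<mu>s. T (\<mu>s @ \<nu>s)))"
proof (induction us arbitrary: T)
  case (Cons u us)
  have "slot u (\<lambda>\<mu>s. T (\<mu>s @ \<nu>s)) = (\<lambda>\<mu>s. slot u T (\<mu>s @ \<nu>s))" for \<nu>s
    by (simp add: slot_def fun_eq_iff)
  then show ?case by (simp add: Cons.IH)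
qed simp

lemma ev_tensor_product:
  assumes "bilinear pr" "length us = r"
  shows "ev (us @ vs) (\<lambda>\<mu>s. pr (S (take r \<mu>s)) (T (drop r \<mu>s))) = pr (ev us S) (ev vs T)"
proof -
  have l: "linear (\<lambda>x. pr x y)" "linear (pr x)" for x y
    using assms(1) by (auto simp: bilinear_def)
  have "ev us (\<lambda>\<mu>s. pr (S (take r (\<mu>s @ \<nu>s))) (T (drop r (\<mu>s @ \<nu>s)))) = pr (ev us S) (T \<nu>s)" for \<nu>s
  proof -
    have "ev us (\<lambda>\<mu>s. pr (S (take r (\<mu>s @ \<nu>s))) (T (drop r (\<mu>s @ \<nu>s)))) = ev us (\<lambda>\<mu>s. pr (S \<mu>s) (T \<nu>s))"
      by (rule ev_cong) (simp add: assms(2))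
    then show ?thesis by (simp add: ev_linear_image[OF l(1)])
  qed
  then show ?thesis by (simp add: ev_append ev_linear_image[OF l(2)])
qed

lemma finite_lists_length [simp]: "finite {\<mu>s :: 'n::finite list. length \<mu>s = n}"
  using finite_lists_length_eq[of "UNIV :: 'n set" n] by simp

text \<open>The bridge to \<open>frame_comp\<close>. In this form a permutation of the arguments
  also becomes a reindexing of the sum.\<close>

lemma ev_eq_sum:
  fixes vs :: "(real^'n::finite) list"
  shows "ev vs T = (\<Sum>\<mu>s | length \<mu>s = length vs. (\<Prod>i<length vs. vs ! i $ (\<mu>s ! i)) *\<^sub>R T \<mu>s)"
proof (induction vs arbitrary: T)
  case Nil
  have "{\<mu>s :: 'n list. length \<mu>s = 0} = {[]}" by auto
  then show ?case by simp
next
  case (Cons v vs)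
  have b: "bij_betw (\<lambda>(\<mu>s, \<mu>). \<mu> # \<mu>s) ({\<mu>s :: 'n list. length \<mu>s = length vs} \<times> UNIV) {\<mu>s. length \<mu>s = length (v # vs)}"
    by (rule bij_betw_byWitness[where f' = "\<lambda>\<mu>s. (tl \<mu>s, hd \<mu>s)"]) (auto simp: length_Suc_conv)
  have "ev (v # vs) T = (\<Sum>\<mu>s | length \<mu>s = length vs. \<Sum>\<mu>\<in>UNIV. (\<Prod>i<length vs. vs ! i $ (\<mu>s ! i)) *\<^sub>R v $ \<mu> *\<^sub>R T (\<mu> # \<mu>s))"
    by (simp add: Cons.IH slot_def scaleR_sum_right)
  also have "\<dots> = (\<Sum>(\<mu>s, \<mu>)\<in>{\<mu>s. length \<mu>s = length vs} \<times> UNIV. (\<Prod>i<length vs. vs ! i $ (\<mu>s ! i)) *\<^sub>R v $ \<mu> *\<^sub>R T (\<mu> # \<mu>s))"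
    by (simp add: sum.cartesian_product)
  also have "\<dots> = (\<Sum>(\<mu>s, \<mu>)\<in>{\<mu>s. length \<mu>s = length vs} \<times> UNIV.
      (\<lambda>\<mu>s. (\<Prod>i<length (v # vs). (v # vs) ! i $ (\<mu>s ! i)) *\<^sub>R T \<mu>s) (\<mu> # \<mu>s))"
    by (intro sum.cong refl) (auto simp: prod.lessThan_Suc_shift mult.commute simp del: prod.lessThan_Suc)
  also have "\<dots> = (\<Sum>\<mu>s | length \<mu>s = length (v # vs). (\<Prod>i<length (v # vs). (v # vs) ! i $ (\<mu>s ! i)) *\<^sub>R T \<mu>s)"
    using sum.reindex_bij_betw[OF b, of "\<lambda>\<mu>s. (\<Prod>i<length (v # vs). (v # vs) ! i $ (\<mu>s ! i)) *\<^sub>R T \<mu>s"]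
    by (simp add: case_prod_unfold)
  finally show ?case .
qed

lemma frame_comp_eq_ev: "frame_comp e T as = ev (map e as) T"
  by (simp add: frame_comp_def ev_eq_sum)

section \<open>Permutation of slots\<close>

definition perm_list :: "nat list \<Rightarrow> bool" where
  "perm_list \<sigma> \<longleftrightarrow> distinct \<sigma> \<and> set \<sigma> = {..<length \<sigma>}"

text \<open>Slot i of \<open>T\<close> receives the index at position \<open>\<sigma> ! i\<close>.
  Permutations are lists so that the ones needed for concrete slots can be written out.\<close>

definition rearrange :: "nat list \<Rightarrow> ('n list \<Rightarrow> 'v) \<Rightarrow> 'n list \<Rightarrow> 'v" where
  "rearrange \<sigma> T \<mu>s = T (map ((!) \<mu>s) \<sigma>)"

lemma perm_list_bij: "perm_list \<sigma> \<Longrightarrow> bij_betw ((!) \<sigma>) {..<length \<sigma>} {..<length \<sigma>}"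
  by (auto simp: perm_list_def intro: bij_betw_nth)

lemma perm_list_nth_less: "perm_list \<sigma> \<Longrightarrow> i < length \<sigma> \<Longrightarrow> \<sigma> ! i < length \<sigma>"
  unfolding perm_list_def by (metis lessThan_iff nth_mem)

lemma perm_list_map_bij:
  assumes "perm_list \<sigma>"
  shows "bij_betw (\<lambda>\<mu>s. map ((!) \<mu>s) \<sigma>) {\<mu>s :: 'n list. length \<mu>s = length \<sigma>} {\<mu>s. length \<mu>s = length \<sigma>}"
proof (rule bij_betw_byWitness[where f' = "\<lambda>\<mu>s. map (\<lambda>i. \<mu>s ! inv_into {..<length \<sigma>} ((!) \<sigma>) i) [0..<length \<sigma>]"])
  note b = perm_list_bij[OF assms]
  have inj: "inv_into {..<length \<sigma>} ((!) \<sigma>) (\<sigma> ! i) = i" if "i < length \<sigma>" for i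
    using b that by (simp add: bij_betw_def)
  have surj: "\<sigma> ! (inv_into {..<length \<sigma>} ((!) \<sigma>) i) = i" "inv_into {..<length \<sigma>} ((!) \<sigma>) i < length \<sigma>"
    if "i < length \<sigma>" for i
    using b that by (auto simp: bij_betw_def f_inv_into_f) (metis inv_into_into lessThan_iff)
  show "\<forall>\<mu>s\<in>{\<mu>s :: 'n list. length \<mu>s = length \<sigma>}.
      map (\<lambda>i. map ((!) \<mu>s) \<sigma> ! inv_into {..<length \<sigma>} ((!) \<sigma>) i) [0..<length \<sigma>] = \<mu>s"
    by (auto intro!: nth_equalityI simp: surj)
  show "\<forall>\<mu>s\<in>{\<mu>s :: 'n list. length \<mu>s = length \<sigma>}.
      map ((!) (map (\<lambda>i. \<mu>s ! inv_into {..<length \<sigma>} ((!) \<sigma>) i) [0..<length \<sigma>])) \<sigma> = \<mu>s"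
    by (auto intro!: nth_equalityI simp: inj perm_list_nth_less[OF assms])
qed auto

lemma ev_rearrange:
  fixes vs :: "(real^'n::finite) list"
  assumes "perm_list \<sigma>" "length vs = length \<sigma>"
  shows "ev vs (rearrange \<sigma> T) = ev (map ((!) vs) \<sigma>) T"
proof -
  have "ev (map ((!) vs) \<sigma>) T = (\<Sum>\<mu>s | length \<mu>s = length \<sigma>. (\<Prod>i<length \<sigma>. vs ! (\<sigma> ! i) $ (\<mu>s ! i)) *\<^sub>R T \<mu>s)"
    by (simp add: ev_eq_sum)
  also have "\<dots> = (\<Sum>\<mu>s | length \<mu>s = length \<sigma>.
      (\<Prod>i<length \<sigma>. vs ! (\<sigma> ! i) $ (map ((!) \<mu>s) \<sigma> ! i)) *\<^sub>R T (map ((!) \<mu>s) \<sigma>))"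
    using sum.reindex_bij_betw[OF perm_list_map_bij[OF assms(1)]] by (rule sym)
  also have "\<dots> = (\<Sum>\<mu>s | length \<mu>s = length \<sigma>. (\<Prod>i<length \<sigma>. vs ! i $ (\<mu>s ! i)) *\<^sub>R rearrange \<sigma> T \<mu>s)"
  proof (rule sum.cong[OF refl])
    fix \<mu>s :: "'n list"
    have "(\<Prod>i<length \<sigma>. vs ! (\<sigma> ! i) $ (map ((!) \<mu>s) \<sigma> ! i)) = (\<Prod>i<length \<sigma>. vs ! (\<sigma> ! i) $ (\<mu>s ! (\<sigma> ! i)))"
      by simp
    also have "\<dots> = (\<Prod>i<length \<sigma>. vs ! i $ (\<mu>s ! i))"
      using prod.reindex_bij_betw[OF perm_list_bij[OF assms(1)], of "\<lambda>i. vs ! i $ (\<mu>s ! i)"] by simp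
    finally show "(\<Prod>i<length \<sigma>. vs ! (\<sigma> ! i) $ (map ((!) \<mu>s) \<sigma> ! i)) *\<^sub>R T (map ((!) \<mu>s) \<sigma>)
        = (\<Prod>i<length \<sigma>. vs ! i $ (\<mu>s ! i)) *\<^sub>R rearrange \<sigma> T \<mu>s"
      by (simp add: rearrange_def)
  qed
  also have "\<dots> = ev vs (rearrange \<sigma> T)"
    by (simp add: ev_eq_sum assms(2))
  finally show ?thesis by simp
qed

section \<open>The action of matrices on tensors by derivations\<close>

text \<open>The action of a matrix on covariant tensors as a derivation. It is the common shape of
  the Christoffel terms in \<open>covd\<close> and of the curvature term in the Ricci
  identity.\<close>

definition act :: "('n::finite \<Rightarrow> 'n \<Rightarrow> real) \<Rightarrow> ('n list \<Rightarrow> 'v::real_vector) \<Rightarrow> 'n list \<Rightarrow> 'v" where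
  "act M T \<nu>s = (\<Sum>i<length \<nu>s. \<Sum>\<rho>\<in>UNIV. M \<rho> (\<nu>s ! i) *\<^sub>R T (\<nu>s[i := \<rho>]))"

lemma act_Nil [simp]: "act M T [] = 0"
  by (simp add: act_def)

lemma act_Cons: "act M T (\<mu> # \<nu>s) = (\<Sum>\<rho>\<in>UNIV. M \<rho> \<mu> *\<^sub>R T (\<rho> # \<nu>s)) + act M (\<lambda>\<tau>s. T (\<mu> # \<tau>s)) \<nu>s"
  by (simp add: act_def sum.lessThan_Suc_shift del: sum.lessThan_Suc)

lemma act_cong:
  assumes "\<And>\<tau>s. length \<tau>s = length \<nu>s \<Longrightarrow> T \<tau>s = T' \<tau>s"
  shows "act M T \<nu>s = act M T' \<nu>s"
  by (simp add: act_def assms)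

lemma act_add: "act M (\<lambda>\<nu>s. T \<nu>s + T' \<nu>s) \<nu>s = act M T \<nu>s + act M T' \<nu>s"
  by (simp add: act_def scaleR_add_right sum.distrib)

lemma act_linear_image: "linear L \<Longrightarrow> act M (\<lambda>\<nu>s. L (T \<nu>s)) \<nu>s = L (act M T \<nu>s)"
  by (simp add: act_def linear_sum linear_scale)

lemma act_scaleR: "act M (\<lambda>\<nu>s. c *\<^sub>R T \<nu>s) \<nu>s = c *\<^sub>R act M T \<nu>s"
  by (rule act_linear_image) (simp add: linear_scale_self)

lemma act_zero [simp]: "act M (\<lambda>\<nu>s. 0) \<nu>s = 0"
  by (simp add: act_def)

lemma act_diff: "act M (\<lambda>\<nu>s. T \<nu>s - T' \<nu>s) \<nu>s = act M T \<nu>s - act M T' \<nu>s"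
  by (simp add: act_def scaleR_diff_right sum_subtractf)

lemma act_sum: "act M (\<lambda>\<nu>s. \<Sum>i\<in>I. T i \<nu>s) \<nu>s = (\<Sum>i\<in>I. act M (T i) \<nu>s)"
  by (induction I rule: infinite_finite_induct) (simp_all add: act_add)

lemma act_matrix_diff: "act (\<lambda>\<rho> \<nu>. M \<rho> \<nu> - N \<rho> \<nu>) T \<nu>s = act M T \<nu>s - act N T \<nu>s"
  by (simp add: act_def scaleR_diff_left sum_subtractf)

text \<open>Terms in which the two matrices hit different slots cancel. On the right the products
  appear in reversed order because the matrices act on lower indices.\<close>

lemma act_commutator:
  "act M (act N T) \<nu>s - act N (act M T) \<nu>s
    = act (\<lambda>\<rho> \<nu>. (\<Sum>\<sigma>\<in>UNIV. N \<rho> \<sigma> * M \<sigma> \<nu>) - (\<Sum>\<sigma>\<in>UNIV. M \<rho> \<sigma> * N \<sigma> \<nu>)) T \<nu>s"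
proof (induction \<nu>s arbitrary: T)
  case (Cons \<mu> \<nu>s)
  have *: "act M (act N T) (\<mu> # \<nu>s) =
      (\<Sum>\<rho>\<in>UNIV. (\<Sum>\<sigma>\<in>UNIV. N \<rho> \<sigma> * M \<sigma> \<mu>) *\<^sub>R T (\<rho> # \<nu>s))
      + (\<Sum>\<rho>\<in>UNIV. M \<rho> \<mu> *\<^sub>R act N (\<lambda>\<tau>s. T (\<rho> # \<tau>s)) \<nu>s)
      + (\<Sum>\<rho>\<in>UNIV. N \<rho> \<mu> *\<^sub>R act M (\<lambda>\<tau>s. T (\<rho> # \<tau>s)) \<nu>s)
      + act M (act N (\<lambda>\<tau>s. T (\<mu> # \<tau>s))) \<nu>s" for M N
  proof -
    have "(\<Sum>\<sigma>\<in>UNIV. M \<sigma> \<mu> *\<^sub>R (\<Sum>\<rho>\<in>UNIV. N \<rho> \<sigma> *\<^sub>R T (\<rho> # \<nu>s)))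
        = (\<Sum>\<rho>\<in>UNIV. (\<Sum>\<sigma>\<in>UNIV. N \<rho> \<sigma> * M \<sigma> \<mu>) *\<^sub>R T (\<rho> # \<nu>s))"
      by (simp add: scaleR_sum_right scaleR_sum_left mult.commute) (rule sum.swap)
    then show ?thesis
      by (simp add: act_Cons act_add act_sum act_scaleR scaleR_add_right sum.distrib)
  qed
  show ?case
    by (subst *, subst *, subst act_Cons) (simp add: Cons.IH[symmetric] scaleR_diff_left sum_subtractf)
qed simp

lemma act_rearrange:
  assumes "perm_list \<sigma>" "length \<mu>s = length \<sigma>"
  shows "act M (rearrange \<sigma> T) \<mu>s = act M T (map ((!) \<mu>s) \<sigma>)"
proof -
  \<comment> \<open>Distinctness of \<open>\<sigma>\<close> ensures that the updated position is
    read exactly once.\<close>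
  have upd: "map ((!) (\<mu>s[\<sigma> ! j := \<rho>])) \<sigma> = (map ((!) \<mu>s) \<sigma>)[j := \<rho>]" if "j < length \<sigma>" for j \<rho>
  proof (rule nth_equalityI)
    fix k assume "k < length (map ((!) (\<mu>s[\<sigma> ! j := \<rho>])) \<sigma>)"
    then have k: "k < length \<sigma>" by simp
    have "\<sigma> ! k = \<sigma> ! j \<longleftrightarrow> k = j"
      using assms(1) k that by (simp add: perm_list_def nth_eq_iff_index_eq)
    then show "map ((!) (\<mu>s[\<sigma> ! j := \<rho>])) \<sigma> ! k = (map ((!) \<mu>s) \<sigma>)[j := \<rho>] ! k"
      using k that perm_list_nth_less[OF assms(1) that] by (cases "k = j") (auto simp: nth_list_update assms(2))
  qed simp
  have "act M (rearrange \<sigma> T) \<mu>s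
      = (\<Sum>j<length \<sigma>. \<Sum>\<rho>\<in>UNIV. M \<rho> (\<mu>s ! (\<sigma> ! j)) *\<^sub>R rearrange \<sigma> T (\<mu>s[\<sigma> ! j := \<rho>]))"
    unfolding act_def assms(2)
    using sum.reindex_bij_betw[OF perm_list_bij[OF assms(1)],
        of "\<lambda>i. \<Sum>\<rho>\<in>UNIV. M \<rho> (\<mu>s ! i) *\<^sub>R rearrange \<sigma> T (\<mu>s[i := \<rho>])"] by simp
  also have "\<dots> = act M T (map ((!) \<mu>s) \<sigma>)"
    by (simp add: act_def rearrange_def upd)
  finally show ?thesis .
qed

lemma act_tensor_product:
  assumes "bilinear pr"
  shows "act M (\<lambda>\<mu>s. pr (S (take r \<mu>s)) (T (drop r \<mu>s))) \<nu>s
    = pr (act M S (take r \<nu>s)) (T (drop r \<nu>s)) + pr (S (take r \<nu>s)) (act M T (drop r \<nu>s))"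
proof -
  have l: "linear (\<lambda>x. pr x y)" "linear (pr x)" for x y
    using assms by (auto simp: bilinear_def)
  show ?thesis
  proof (induction \<nu>s arbitrary: r S)
    case Nil
    then show ?case by (simp add: linear_0[OF l(1)] linear_0[OF l(2)])
  next
    case (Cons \<mu> \<nu>s)
    show ?case
    proof (cases r)
      case 0
      then show ?thesis by (simp add: act_linear_image[OF l(2)] linear_0[OF l(1)])
    next
      case (Suc r')
      have "(\<Sum>\<rho>\<in>UNIV. M \<rho> \<mu> *\<^sub>R pr (S (\<rho> # take r' \<nu>s)) (T (drop r' \<nu>s)))
          = pr (\<Sum>\<rho>\<in>UNIV. M \<rho> \<mu> *\<^sub>R S (\<rho> # take r' \<nu>s)) (T (drop r' \<nu>s))"
        by (simp add: linear_sum[OF l(1)] linear_scale[OF l(1)])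
      then show ?thesis
        using Cons[of "\<lambda>\<mu>s. S (\<mu> # \<mu>s)" r']
        by (simp add: Suc act_Cons linear_add[OF l(1)])
    qed
  qed
qed

definition apply_matrix :: "('n::finite \<Rightarrow> 'n \<Rightarrow> real) \<Rightarrow> real^'n \<Rightarrow> real^'n" where
  "apply_matrix M v = (\<chi> \<rho>. \<Sum>\<nu>\<in>UNIV. M \<rho> \<nu> * v $ \<nu>)"

lemma slot_act: "slot v (act M T) = (\<lambda>\<mu>s. slot (apply_matrix M v) T \<mu>s + act M (slot v T) \<mu>s)"
proof
  fix \<mu>s
  have "(\<Sum>\<mu>\<in>UNIV. v $ \<mu> *\<^sub>R (\<Sum>\<rho>\<in>UNIV. M \<rho> \<mu> *\<^sub>R T (\<rho> # \<mu>s))) = slot (apply_matrix M v) T \<mu>s"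
    unfolding slot_def apply_matrix_def
    by (simp add: scaleR_sum_right scaleR_sum_left mult.commute) (rule sum.swap)
  moreover have "(\<Sum>\<mu>\<in>UNIV. v $ \<mu> *\<^sub>R act M (\<lambda>\<tau>s. T (\<mu> # \<tau>s)) \<mu>s) = act M (slot v T) \<mu>s"
    unfolding slot_def[abs_def] by (simp add: act_sum act_scaleR)
  ultimately show "slot v (act M T) \<mu>s = slot (apply_matrix M v) T \<mu>s + act M (slot v T) \<mu>s"
    unfolding slot_def[of v "act M T"] act_Cons scaleR_add_right sum.distrib by simp
qed

text \<open>Trades a matrix acting on the indices of a tensor for the same matrix acting on its
  vector arguments; this turns the Christoffel terms of \<open>covd\<close> into those of
  \<open>nabla_vec\<close>.\<close>

lemma ev_act: "ev vs (act M T) = (\<Sum>i<length vs. ev (vs[i := apply_matrix M (vs ! i)]) T)"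
  by (induction vs arbitrary: T)
     (simp_all add: slot_act ev_add sum.lessThan_Suc_shift del: sum.lessThan_Suc)

section \<open>Null frames\<close>

text \<open>The number of the frame vector whose product with \<open>e a\<close> is 1, all others
  being orthogonal to \<open>e a\<close>: raising a frame index exchanges 0 and 1.\<close>

definition frame_dual :: "nat \<Rightarrow> nat" where
  "frame_dual a = (if a = 0 then 1 else if a = 1 then 0 else a)"

definition frame_weight :: "nat \<Rightarrow> int" where
  "frame_weight a = (if a = 0 then 1 else if a = 1 then -1 else 0)"

lemma frame_dual_dual [simp]: "frame_dual (frame_dual a) = a"
  by (simp add: frame_dual_def)

lemma frame_weight_dual: "frame_weight (frame_dual a) = - frame_weight a"
  by (simp add: frame_dual_def frame_weight_def)

lemma frame_dual_less: "2 \<le> d \<Longrightarrow> a < d \<Longrightarrow> frame_dual a < d"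
  by (simp add: frame_dual_def)

lemma boost_weight_eq_sum_list: "boost_weight as = sum_list (map frame_weight as)"
proof (induction as)
  case (Cons a as)
  have "boost_weight (a # as) = frame_weight a + boost_weight as"
    by (simp add: boost_weight_def frame_weight_def)
  with Cons show ?case by simp
qed (simp add: boost_weight_def)

lemma metric_form_sym: "transpose h = h \<Longrightarrow> metric_form h v w = metric_form h w v"
  unfolding metric_form_def by (metis dot_lmul_matrix inner_commute transpose_matrix_vector)

lemma metric_form_diff_right: "metric_form h u (v - w) = metric_form h u v - metric_form h u w"
  and metric_form_scaleR_right: "metric_form h u (c *\<^sub>R v) = c * metric_form h u v"
  and metric_form_scaleR_left: "metric_form h (c *\<^sub>R u) v = c * metric_form h u v"
  by (simp_all add: metric_form_def matrix_vector_right_distrib matrix_vector_mult_diff_distrib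
      inner_simps matrix_vector_mult_scaleR)

lemma metric_form_eq_sum: "metric_form h v w = (\<Sum>\<mu>\<in>UNIV. \<Sum>\<nu>\<in>UNIV. v $ \<mu> * (w $ \<nu> * h $ \<mu> $ \<nu>))"
  by (simp add: metric_form_def inner_vec_def matrix_vector_mult_def sum_distrib_left mult.commute mult.left_commute)

lemma ev_pair_metric: "ev [v, w] (\<lambda>\<mu>s. h $ (\<mu>s ! 0) $ (\<mu>s ! 1)) = metric_form h v w"
  by (simp add: slot_def metric_form_eq_sum sum_distrib_left mult.left_commute) (rule sum.swap)

locale null_frame_at =
  fixes h :: "real^'n::finite^'n" and e :: "nat \<Rightarrow> real^'n"
  assumes nf: "null_frame h e" and sym: "transpose h = h" and card: "CARD('n) \<ge> 2"
begin

lemma metric_frame: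
  assumes "a < CARD('n)" "b < CARD('n)"
  shows "metric_form h (e a) (e b) = (if b = frame_dual a then 1 else 0)"
proof -
  have c: "metric_form h (e 0) (e 0) = 0" "metric_form h (e 1) (e 1) = 0" "metric_form h (e 0) (e 1) = 1"
     "metric_form h (e 1) (e 0) = 1"
    using nf metric_form_sym[OF sym] by (auto simp: null_frame_def)
  have i: "metric_form h (e 0) (e i) = 0" "metric_form h (e 1) (e i) = 0"
     "metric_form h (e i) (e 0) = 0" "metric_form h (e i) (e 1) = 0" if "2 \<le> i" "i < CARD('n)" for i
    using nf metric_form_sym[OF sym, of "e i"] that by (auto simp: null_frame_def)
  have ij: "metric_form h (e i) (e j) = (if i = j then 1 else 0)" if "2 \<le> i" "i < CARD('n)" "2 \<le> j" "j < CARD('n)" for i j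
    using nf that by (auto simp: null_frame_def)
  have "a = 0 \<or> a = 1 \<or> 2 \<le> a" "b = 0 \<or> b = 1 \<or> 2 \<le> b" by linarith+
  then show ?thesis
    using assms c i ij by (elim disjE) (simp_all add: frame_dual_def)
qed

text \<open>With the frame as columns of E, the matrix J = E^T h E is that of the involution
  \<open>frame_dual\<close>. So J E^T h inverts E from the left, hence from the right, and h^(-1) =
  E J E^T, the completeness relation of the frame. The bijection \<open>\<beta>\<close> translates
  between the index type and frame numbers.\<close>

lemma invertible_metric: "invertible h"
  and matrix_inv_frame: "matrix_inv h $ \<alpha> $ \<gamma> = (\<Sum>a<CARD('n). e a $ \<alpha> * e (frame_dual a) $ \<gamma>)"
proof -
  obtain \<beta> :: "'n \<Rightarrow> nat" where "bij_betw \<beta> UNIV {0..<CARD('n)}"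
    using ex_bij_betw_finite_nat[of "UNIV :: 'n set"] by auto
  then have \<beta>: "bij_betw \<beta> UNIV {..<CARD('n)}" by (simp add: atLeast0LessThan)
  then have \<beta>l: "\<beta> i < CARD('n)" for i by (auto simp: bij_betw_def)
  define E :: "real^'n^'n" where "E = (\<chi> \<mu> i. e (\<beta> i) $ \<mu>)"
  define J :: "real^'n^'n" where "J = (\<chi> i j. if \<beta> j = frame_dual (\<beta> i) then 1 else 0)"
  have reindex: "(\<Sum>i\<in>UNIV. f (\<beta> i)) = (\<Sum>a<CARD('n). f a)" for f :: "nat \<Rightarrow> real"
    using sum.reindex_bij_betw[OF \<beta>, of f] .
  have "transpose E ** h ** E = J"
  proof -
    have "(transpose E ** h ** E) $ i $ j = metric_form h (e (\<beta> i)) (e (\<beta> j))" for i j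
      unfolding metric_form_def inner_vec_def
      by (simp add: E_def transpose_def matrix_matrix_mult_def matrix_vector_mult_def
          sum_distrib_left sum_distrib_right mult.assoc)
         (rule sum.swap)
    then show ?thesis by (simp add: vec_eq_iff J_def metric_frame \<beta>l)
  qed
  moreover have "J ** J = mat 1"
  proof -
    have "(J ** J) $ i $ j = (if i = j then 1 else 0)" for i j
    proof -
      have "(J ** J) $ i $ j = (\<Sum>k\<in>UNIV. (if \<beta> k = frame_dual (\<beta> i) then 1 else 0) * (if \<beta> j = frame_dual (\<beta> k) then 1 else (0::real)))"
        by (simp add: matrix_matrix_mult_def J_def)
      also have "\<dots> = (\<Sum>a<CARD('n). (if a = frame_dual (\<beta> i) then 1 else 0) * (if \<beta> j = frame_dual a then 1 else 0))"
        by (rule reindex)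
      also have "\<dots> = (\<Sum>a<CARD('n). if a = frame_dual (\<beta> i) then (if \<beta> j = frame_dual a then 1 else 0) else 0)"
        by (rule sum.cong) auto
      also have "\<dots> = (if \<beta> j = \<beta> i then 1 else 0)"
        using frame_dual_less[OF card \<beta>l] by simp
      also have "\<dots> = (if i = j then 1 else 0)"
        using \<beta> by (auto simp: bij_betw_def inj_def)
      finally show ?thesis .
    qed
    then show ?thesis by (simp add: vec_eq_iff mat_def)
  qed
  ultimately have "(J ** transpose E ** h) ** E = mat 1"
    by (metis matrix_mul_assoc)
  then have "E ** (J ** transpose E ** h) = mat 1"
    by (simp add: matrix_left_right_inverse)
  then have M: "(E ** J ** transpose E) ** h = mat 1"
    by (simp add: matrix_mul_assoc)
  then show inv: "invertible h"
    by (metis invertible_def matrix_left_right_inverse)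
  have "matrix_inv h = (E ** J ** transpose E) ** (h ** matrix_inv h)"
    using M by (simp add: matrix_mul_assoc)
  then have "matrix_inv h = E ** J ** transpose E"
    by (simp add: matrix_inv_right[OF inv])
  then have "matrix_inv h $ \<alpha> $ \<gamma>
      = (\<Sum>j\<in>UNIV. (\<Sum>i\<in>UNIV. e (\<beta> i) $ \<alpha> * (if \<beta> j = frame_dual (\<beta> i) then 1 else 0)) * e (\<beta> j) $ \<gamma>)"
    by (simp add: matrix_matrix_mult_def E_def J_def transpose_def)
  also have "\<dots> = (\<Sum>b<CARD('n). (\<Sum>a<CARD('n). e a $ \<alpha> * (if b = frame_dual a then 1 else 0)) * e b $ \<gamma>)"
    using reindex[of "\<lambda>b. (\<Sum>a<CARD('n). e a $ \<alpha> * (if b = frame_dual a then 1 else 0)) * e b $ \<gamma>"]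
      reindex[of "\<lambda>a. e a $ \<alpha> * (if b = frame_dual a then 1 else 0)" for b] by simp
  also have "\<dots> = (\<Sum>a<CARD('n). \<Sum>b<CARD('n). if b = frame_dual a then e a $ \<alpha> * e b $ \<gamma> else 0)"
    by (subst sum.swap) (auto simp: sum_distrib_right intro!: sum.cong)
  also have "\<dots> = (\<Sum>a<CARD('n). e a $ \<alpha> * e (frame_dual a) $ \<gamma>)"
    using frame_dual_less[OF card] by (intro sum.cong) auto
  finally show "matrix_inv h $ \<alpha> $ \<gamma> = (\<Sum>a<CARD('n). e a $ \<alpha> * e (frame_dual a) $ \<gamma>)" .
qed

lemma frame_expansion: "v = (\<Sum>a<CARD('n). metric_form h (e (frame_dual a)) v *\<^sub>R e a)"
proof -
  have "v $ \<alpha> = (\<Sum>a<CARD('n). metric_form h (e (frame_dual a)) v *\<^sub>R e a) $ \<alpha>" for \<alpha>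
  proof -
    have "v = matrix_inv h *v (h *v v)"
      by (simp add: matrix_vector_mul_assoc matrix_inv_left[OF invertible_metric])
    then have "v $ \<alpha> = (matrix_inv h *v (h *v v)) $ \<alpha>" by simp
    also have "\<dots> = (\<Sum>\<gamma>\<in>UNIV. (\<Sum>a<CARD('n). e a $ \<alpha> * e (frame_dual a) $ \<gamma>) * (h *v v) $ \<gamma>)"
      by (simp add: matrix_vector_mult_def[of "matrix_inv h"] matrix_inv_frame)
    also have "\<dots> = (\<Sum>a<CARD('n). e a $ \<alpha> * (\<Sum>\<gamma>\<in>UNIV. e (frame_dual a) $ \<gamma> * (h *v v) $ \<gamma>))"
      by (simp add: sum_distrib_right sum_distrib_left mult.assoc) (rule sum.swap)
    finally show ?thesis
      by (simp add: metric_form_def inner_vec_def mult.commute)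
  qed
  then show ?thesis by (simp add: vec_eq_iff)
qed

end

section \<open>Boost order\<close>

text \<open>\<open>in_boost_filtration h l v w\<close> says that \<open>v\<close> lies in the step of index \<open>w\<close> of the filtration
  \<open>span l \<subseteq> l\<^sup>\<bottom> \<subseteq> V\<close> with indices \<open>1, 0, -1\<close>. It depends on the null direction only, unlike a null frame,
  and it is preserved by the Levi-Civita connection of a Kundt metric.\<close>

definition in_boost_filtration :: "real^'n::finite^'n \<Rightarrow> real^'n \<Rightarrow> real^'n \<Rightarrow> int \<Rightarrow> bool" where
  "in_boost_filtration h l v w \<longleftrightarrow>
     w \<le> -1 \<or> w = 0 \<and> metric_form h l v = 0 \<or> w = 1 \<and> (\<exists>c. v = c *\<^sub>R l)"

text \<open>The steps of the filtration are nested when \<open>l\<close> is null, so a vector has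
  several admissible indices; vanishing is required as soon as some choice of them adds up to more
  than b. No vector, not even 0, has an index of 2 or more.\<close>

definition boost_order_le ::
  "real^'n::finite^'n \<Rightarrow> real^'n \<Rightarrow> int \<Rightarrow> nat \<Rightarrow> ('n list \<Rightarrow> 'v::real_vector) \<Rightarrow> bool" where
  "boost_order_le h l b r T \<longleftrightarrow>
     (\<forall>vs ws. length vs = r \<longrightarrow> list_all2 (in_boost_filtration h l) vs ws \<longrightarrow> sum_list ws > b \<longrightarrow> ev vs T = 0)"

lemma boost_order_leD:
  assumes "boost_order_le h l b r T" "length vs = r" "list_all2 (in_boost_filtration h l) vs ws" "sum_list ws > b"
  shows "ev vs T = 0"
  using assms unfolding boost_order_le_def by blast

lemma boost_order_le_mono: "boost_order_le h l b r T \<Longrightarrow> b \<le> b' \<Longrightarrow> boost_order_le h l b' r T"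
  unfolding boost_order_le_def by force

lemma boost_order_le_cong:
  assumes "\<And>\<mu>s. length \<mu>s = r \<Longrightarrow> T \<mu>s = T' \<mu>s" "boost_order_le h l b r T"
  shows "boost_order_le h l b r T'"
  using assms(2) ev_cong[of _ T T'] assms(1) unfolding boost_order_le_def by metis

lemma boost_order_le_zero: "boost_order_le h l b r (\<lambda>\<mu>s. 0)"
  by (simp add: boost_order_le_def)

lemma boost_order_le_add:
  "boost_order_le h l b r T \<Longrightarrow> boost_order_le h l b r T' \<Longrightarrow> boost_order_le h l b r (\<lambda>\<mu>s. T \<mu>s + T' \<mu>s)"
  by (simp add: boost_order_le_def ev_add)

lemma boost_order_le_linear_image:
  "linear L \<Longrightarrow> boost_order_le h l b r T \<Longrightarrow> boost_order_le h l b r (\<lambda>\<mu>s. L (T \<mu>s))"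
  by (simp add: boost_order_le_def ev_linear_image linear_0)

text \<open>If the total weight exceeds b + b', then the weight in the first r slots exceeds b or
  that in the others exceeds b'.\<close>

lemma boost_order_le_tensor_product:
  assumes "bilinear pr" "boost_order_le h l b r S" "boost_order_le h l b' s T"
  shows "boost_order_le h l (b + b') (r + s) (\<lambda>\<mu>s. pr (S (take r \<mu>s)) (T (drop r \<mu>s)))"
  unfolding boost_order_le_def
proof (intro allI impI)
  fix vs ws
  assume vs: "length vs = r + s" "list_all2 (in_boost_filtration h l) vs ws" "sum_list ws > b + b'"
  have l: "linear (\<lambda>x. pr x y)" "linear (pr x)" for x y
    using assms(1) by (auto simp: bilinear_def)
  have "ev (take r vs @ drop r vs) (\<lambda>\<mu>s. pr (S (take r \<mu>s)) (T (drop r \<mu>s))) = pr (ev (take r vs) S) (ev (drop r vs) T)"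
    by (rule ev_tensor_product[OF assms(1)]) (simp add: vs)
  moreover have "sum_list (take r ws) + sum_list (drop r ws) > b + b'"
    using vs(3) by (metis append_take_drop_id sum_list_append)
  then have "sum_list (take r ws) > b \<or> sum_list (drop r ws) > b'" by linarith
  then have "ev (take r vs) S = 0 \<or> ev (drop r vs) T = 0"
    using boost_order_leD[OF assms(2), of "take r vs" "take r ws"] boost_order_leD[OF assms(3), of "drop r vs" "drop r ws"]
      list_all2_takeI[OF vs(2)] list_all2_dropI[OF vs(2)] vs(1) by auto
  ultimately show "ev vs (\<lambda>\<mu>s. pr (S (take r \<mu>s)) (T (drop r \<mu>s))) = 0"
    using linear_0[OF l(1)] linear_0[OF l(2)] by auto
qed

lemma boost_order_le_rearrange:
  assumes "perm_list \<sigma>" "length \<sigma> = r" "boost_order_le h l b r T"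
  shows "boost_order_le h l b r (rearrange \<sigma> T)"
  unfolding boost_order_le_def
proof (intro allI impI)
  fix vs ws
  assume vs: "length vs = r" "list_all2 (in_boost_filtration h l) vs ws" "sum_list ws > b"
  have lw: "length ws = r" using vs list_all2_lengthD by fastforce
  have "list_all2 (in_boost_filtration h l) (map ((!) vs) \<sigma>) (map ((!) ws) \<sigma>)"
    using vs(1,2) assms(1,2) perm_list_nth_less[OF assms(1)] by (auto simp: list_all2_conv_all_nth)
  moreover have "sum_list (map ((!) ws) \<sigma>) = sum_list ws"
    using sum.reindex_bij_betw[OF perm_list_bij[OF assms(1)], of "(!) ws"] assms(2)
    by (simp add: sum_list_sum_nth lw atLeast0LessThan)
  ultimately have "ev (map ((!) vs) \<sigma>) T = 0"
    using boost_order_leD[OF assms(3)] vs(3) assms(2) by simp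
  then show "ev vs (rearrange \<sigma> T) = 0"
    using ev_rearrange[OF assms(1), of vs T] vs(1) assms(2) by simp
qed

definition contract_metric :: "real^'n::finite^'n \<Rightarrow> ('n list \<Rightarrow> 'v::real_vector) \<Rightarrow> 'n list \<Rightarrow> 'v" where
  "contract_metric h T \<mu>s = (\<Sum>\<alpha>\<in>UNIV. \<Sum>\<gamma>\<in>UNIV. matrix_inv h $ \<alpha> $ \<gamma> *\<^sub>R T (\<alpha> # \<gamma> # \<mu>s))"

context null_frame_at begin

lemma frame_in_filtration: "a < CARD('n) \<Longrightarrow> in_boost_filtration h (e 0) (e a) (frame_weight a)"
proof -
  assume a: "a < CARD('n)"
  have "0 < CARD('n)" using card by linarith
  then show ?thesis
    using metric_frame[of 0 a] a by (auto simp: in_boost_filtration_def frame_weight_def frame_dual_def intro: exI[of _ 1])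
qed

text \<open>The coefficient along \<open>e a\<close> is the product with the dual vector.
  Consequently a vector of index w is a combination of frame vectors of weight at least w.\<close>

lemma frame_coefficient_zero:
  assumes "in_boost_filtration h (e 0) v w" "a < CARD('n)" "frame_weight a < w"
  shows "metric_form h (e (frame_dual a)) v = 0"
proof -
  have "0 < CARD('n)" using card by linarith
  moreover have "frame_dual a < CARD('n)" using assms(2) card frame_dual_less by blast
  ultimately show ?thesis
    using assms metric_frame[of "frame_dual a" 0]
    by (auto simp: in_boost_filtration_def frame_weight_def metric_form_scaleR_right frame_dual_def split: if_splits)
qed

text \<open>Expanding every argument in the frame produces only frame vectors of at least the weight
  of that argument, so each component that survives has boost weight above b. This passes from the
  componentwise definitions to a condition that refers to \<open>l\<close> alone.\<close>

lemma boost_order_le_if_frame: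
  assumes "\<And>as. length as = r \<Longrightarrow> set as \<subseteq> {..<CARD('n)} \<Longrightarrow> boost_weight as > b \<Longrightarrow> frame_comp e T as = 0"
  shows "boost_order_le h (e 0) b r T"
proof -
  have "ev vs T = 0"
    if "list_all2 (in_boost_filtration h (e 0)) vs ws" "sum_list ws > b"
       "\<And>as. length as = length vs \<Longrightarrow> set as \<subseteq> {..<CARD('n)} \<Longrightarrow> boost_weight as > b \<Longrightarrow> ev (map e as) T = 0"
    for vs ws b T
    using that
  proof (induction vs ws arbitrary: b T rule: list_all2_induct)
    case Nil
    then show ?case by (auto simp: boost_weight_def)
  next
    case (Cons v vs w ws)
    have "ev (v # vs) T = (\<Sum>a<CARD('n). metric_form h (e (frame_dual a)) v *\<^sub>R ev vs (slot (e a) T))"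
      by (subst frame_expansion[of v]) (simp add: slot_sum_scaleR ev_sum ev_scaleR)
    also have "\<dots> = 0"
    proof (rule sum.neutral, intro ballI)
      fix a assume a: "a \<in> {..<CARD('n)}"
      show "metric_form h (e (frame_dual a)) v *\<^sub>R ev vs (slot (e a) T) = 0"
      proof (cases "frame_weight a < w")
        case True
        then show ?thesis using frame_coefficient_zero[OF Cons.hyps(1)] a by simp
      next
        case False
        have "ev vs (slot (e a) T) = 0"
        \<comment> \<open>Filling the first slot with \<open>e a\<close> uses up its weight, which
          the bound for the remaining slots has to absorb.\<close>
        proof (rule Cons.IH[where b = "b - frame_weight a"])
          show "b - frame_weight a < sum_list ws" using False Cons.prems(1) by simp
          show "ev (map e as) (slot (e a) T) = 0"
            if "length as = length vs" "set as \<subseteq> {..<CARD('n)}" "boost_weight as > b - frame_weight a" for as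
            using Cons.prems(2)[of "a # as"] that a by (simp add: boost_weight_eq_sum_list)
        qed
        then show ?thesis by simp
      qed
    qed
    finally show ?case .
  qed
  then show ?thesis
    using assms by (auto simp: boost_order_le_def frame_comp_eq_ev)
qed

lemma contract_metric_frame:
  "contract_metric h T \<mu>s = (\<Sum>a<CARD('n). slot (e (frame_dual a)) (slot (e a) T) \<mu>s)"
proof -
  have "contract_metric h T \<mu>s
      = (\<Sum>\<alpha>\<in>UNIV. \<Sum>\<gamma>\<in>UNIV. \<Sum>a<CARD('n). (e a $ \<alpha> * e (frame_dual a) $ \<gamma>) *\<^sub>R T (\<alpha> # \<gamma> # \<mu>s))"
    by (simp add: contract_metric_def matrix_inv_frame scaleR_sum_left)
  also have "\<dots> = (\<Sum>\<gamma>\<in>UNIV. \<Sum>\<alpha>\<in>UNIV. \<Sum>a<CARD('n). (e a $ \<alpha> * e (frame_dual a) $ \<gamma>) *\<^sub>R T (\<alpha> # \<gamma> # \<mu>s))"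
    by (rule sum.swap)
  also have "\<dots> = (\<Sum>\<gamma>\<in>UNIV. \<Sum>a<CARD('n). \<Sum>\<alpha>\<in>UNIV. (e a $ \<alpha> * e (frame_dual a) $ \<gamma>) *\<^sub>R T (\<alpha> # \<gamma> # \<mu>s))"
    by (intro sum.cong refl sum.swap)
  also have "\<dots> = (\<Sum>a<CARD('n). \<Sum>\<gamma>\<in>UNIV. \<Sum>\<alpha>\<in>UNIV. (e a $ \<alpha> * e (frame_dual a) $ \<gamma>) *\<^sub>R T (\<alpha> # \<gamma> # \<mu>s))"
    by (rule sum.swap)
  also have "\<dots> = (\<Sum>a<CARD('n). slot (e (frame_dual a)) (slot (e a) T) \<mu>s)"
    by (simp add: slot_def scaleR_sum_right mult.commute)
  finally show ?thesis .
qed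

text \<open>By the completeness relation the contracted pair is filled with a frame vector and its
  dual, whose weights cancel.\<close>

lemma boost_order_le_contract:
  assumes "boost_order_le h (e 0) b (r + 2) T"
  shows "boost_order_le h (e 0) b r (contract_metric h T)"
  unfolding boost_order_le_def
proof (intro allI impI)
  fix vs ws
  assume vs: "length vs = r" "list_all2 (in_boost_filtration h (e 0)) vs ws" "sum_list ws > b"
  have "ev (e a # e (frame_dual a) # vs) T = 0" if "a < CARD('n)" for a
    by (rule boost_order_leD[OF assms, where ws = "frame_weight a # frame_weight (frame_dual a) # ws"])
       (use vs that frame_in_filtration[of a] frame_in_filtration[of "frame_dual a"] frame_dual_less[OF card that]
         in \<open>auto simp: frame_weight_dual\<close>)
  then show "ev vs (contract_metric h T) = 0"
    by (simp add: contract_metric_frame[abs_def] ev_sum)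
qed

lemma boost_order_le_metric: "boost_order_le h (e 0) 0 2 (\<lambda>\<mu>s. h $ (\<mu>s ! 0) $ (\<mu>s ! 1))"
proof (rule boost_order_le_if_frame)
  fix as assume as: "length as = 2" "set as \<subseteq> {..<CARD('n)}" "boost_weight as > 0"
  then obtain a b where ab: "as = [a, b]" "a < CARD('n)" "b < CARD('n)"
    by (auto simp: numeral_2_eq_2 length_Suc_conv)
  have "b \<noteq> frame_dual a"
    using as(3) by (auto simp: ab boost_weight_eq_sum_list frame_weight_dual)
  then show "frame_comp e (\<lambda>\<mu>s. h $ (\<mu>s ! 0) $ (\<mu>s ! 1)) as = 0"
    unfolding ab(1) frame_comp_eq_ev list.map ev_pair_metric using metric_frame[of a b] ab(2,3) by simp
qed

text \<open>A component with distinct frame indices contains 0 and 1 once each and has boost weight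
  0; a component with a repeated index vanishes by antisymmetry.\<close>

lemma boost_order_le_volume_element:
  assumes \<beta>: "bij_betw \<beta> (UNIV :: 'n set) {..<CARD('n)}"
  shows "boost_order_le h (e 0) 0 CARD('n) (volume_element \<beta> h)"
proof (rule boost_order_le_if_frame)
  fix as assume as: "length as = CARD('n)" "set as \<subseteq> {..<CARD('n)}" "boost_weight as > 0"
  have "\<not> distinct as"
  proof
    assume dist: "distinct as"
    then have "set as = {..<CARD('n)}"
      using as by (intro card_subset_eq) (auto simp: distinct_card)
    then have "boost_weight as = (\<Sum>a<CARD('n). frame_weight a)"
      using dist by (simp add: boost_weight_eq_sum_list sum_list_distinct_conv_sum_set)
    also have "\<dots> = (\<Sum>a\<in>{0, 1}. frame_weight a)"
      using card by (intro sum.mono_neutral_right) (auto simp: frame_weight_def)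
    finally show False using as(3) by (simp add: frame_weight_def)
  qed
  then obtain p q where pq: "p < CARD('n)" "q < CARD('n)" "p \<noteq> q" "as ! p = as ! q"
    using as(1) by (auto simp: distinct_conv_nth)
  \<comment> \<open>Exchanging the two equal frame vectors leaves the arguments unchanged, yet it
    flips the sign of the determinant: \<open>\<pi>\<close> is the same exchange seen as one of
    rows.\<close>
  define \<sigma> where "\<sigma> = map (Transposition.transpose p q) [0..<CARD('n)]"
  have \<sigma>: "perm_list \<sigma>" "length \<sigma> = CARD('n)"
    using pq by (auto simp: \<sigma>_def perm_list_def distinct_map inj_on_def Transposition.transpose_def image_iff)
  define \<pi> where "\<pi> = Transposition.transpose (inv \<beta> p) (inv \<beta> q)"
  have inv\<beta>: "\<beta> (inv \<beta> k) = k" if "k < CARD('n)" for k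
    using \<beta> that by (auto simp: bij_betw_def intro: f_inv_into_f)
  have ne: "inv \<beta> p \<noteq> inv \<beta> q" using inv\<beta> pq by metis
  have \<beta>l: "\<beta> i < CARD('n)" for i using \<beta> by (auto simp: bij_betw_def)
  have \<beta>\<pi>: "\<beta> (\<pi> i) = Transposition.transpose p q (\<beta> i)" for i
  proof -
    have "\<beta> i = p \<longleftrightarrow> i = inv \<beta> p" "\<beta> i = q \<longleftrightarrow> i = inv \<beta> q"
      using \<beta> inv\<beta> pq by (metis bij_betw_def inv_f_f)+
    then show ?thesis using inv\<beta> pq by (auto simp: \<pi>_def Transposition.transpose_def)
  qed
  have \<pi>: "\<pi> permutes UNIV" "sign \<pi> = -1"
    using ne by (auto simp: \<pi>_def permutes_swap_id sign_swap_id)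
  have anti: "rearrange \<sigma> (volume_element \<beta> h) \<mu>s = - volume_element \<beta> h \<mu>s" for \<mu>s
  proof -
    have "map ((!) \<mu>s) \<sigma> ! \<beta> i = \<mu>s ! \<beta> (\<pi> i)" for i
      using \<beta>l[of i] by (simp add: \<sigma>_def \<beta>\<pi>)
    then have "rearrange \<sigma> (volume_element \<beta> h) \<mu>s
        = sqrt \<bar>det h\<bar> * det (\<chi> i. (\<chi> i. axis (\<mu>s ! \<beta> i) (1::real)) $ \<pi> i)"
      by (simp add: rearrange_def volume_element_def)
    also have "\<dots> = - volume_element \<beta> h \<mu>s"
      by (subst det_permute_rows[OF \<pi>(1)]) (simp add: \<pi>(2) volume_element_def)
    finally show ?thesis .
  qed
  have "map ((!) (map e as)) \<sigma> = map e as"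
    using as(1) pq by (auto intro!: nth_equalityI simp: \<sigma>_def Transposition.transpose_def)
  then have "ev (map e as) (volume_element \<beta> h) = ev (map e as) (rearrange \<sigma> (volume_element \<beta> h))"
    using ev_rearrange[OF \<sigma>(1), of "map e as" "volume_element \<beta> h"] as(1) \<sigma>(2) by simp
  also have "\<dots> = - ev (map e as) (volume_element \<beta> h)"
    by (simp add: anti[abs_def] ev_uminus)
  finally show "frame_comp e (volume_element \<beta> h) as = 0"
    by (simp add: frame_comp_eq_ev)
qed

end

section \<open>Scalar invariants of jets of negative boost order\<close>

lemma boost_order_le_of_real:
  fixes T :: "'n::finite list \<Rightarrow> real"
  assumes "boost_order_le h l b r T"
  shows "boost_order_le h l b r (\<lambda>\<mu>s. complex_of_real (T \<mu>s))"
  using boost_order_le_linear_image[OF _ assms, of complex_of_real]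
    bounded_linear.linear[OF bounded_linear_of_real] by blast

lemma boost_order_le_cmult:
  "boost_order_le h l b r T \<Longrightarrow> boost_order_le h l b r (\<lambda>\<mu>s. (c::complex) * T \<mu>s)"
  by (rule boost_order_le_linear_image) (auto intro: bounded_linear.linear bounded_linear_mult_right)

lemma bilinear_mult: "bilinear ((*) :: complex \<Rightarrow> complex \<Rightarrow> complex)"
  using bilinear_conv_bounded_bilinear bounded_bilinear_mult by blast

lemma perm_list_permutes:
  assumes "\<pi> permutes {..<r}"
  shows "perm_list (map \<pi> [0..<r])"
  using assms permutes_inj_on[OF assms] permutes_image[OF assms]
  by (auto simp: perm_list_def distinct_map atLeast0LessThan inj_on_subset)

text \<open>The three bounds have to be carried together: for a product, PQ(J) - PQ(0) = (P(J) -
  P(0)) Q(J) + P(0) (Q(J) - Q(0)), and each term combines order -1 with order 0. The difference from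
  the value at the zero jet is what separates a constant term, made of metric and volume element,
  from the rest.\<close>

lemma (in null_frame_at) constructible_boost_order:
  fixes P :: "('n, 'N::finite) concomitant" and J :: "('n, 'N) jet"
  assumes "constructible t k r P" "independent (range t)"
    and J: "\<And>j a. j \<le> k \<Longrightarrow> boost_order_le h (e 0) (-1) (j + 2) (\<lambda>\<mu>s. gen_coeff t a (J j \<mu>s))"
  shows "boost_order_le h (e 0) 0 r (P h J) \<and> boost_order_le h (e 0) 0 r (P h (\<lambda>j \<mu>s. 0))
    \<and> boost_order_le h (e 0) (-1) r (\<lambda>\<mu>s. P h J \<mu>s - P h (\<lambda>j \<mu>s. 0) \<mu>s)"
  using assms(1)
proof (induction rule: constructible.induct)
  case (field j a)
  have "gen_coeff t a 0 = 0" by (simp add: gen_coeff_def representation_zero)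
  moreover note f = boost_order_le_of_real[OF J[OF field, of a]]
  ultimately show ?case
    using boost_order_le_mono[OF f, of 0] f by (simp add: boost_order_le_zero)
next
  case metric
  show ?case
    using boost_order_le_of_real[OF boost_order_le_metric] by (simp add: boost_order_le_zero)
next
  case (volume \<beta>)
  show ?case
    using boost_order_le_of_real[OF boost_order_le_volume_element[OF volume]] by (simp add: boost_order_le_zero)
next
  case (add r P Q)
  have "(\<lambda>\<mu>s. P h J \<mu>s + Q h J \<mu>s - (P h (\<lambda>j \<mu>s. 0) \<mu>s + Q h (\<lambda>j \<mu>s. 0) \<mu>s))
      = (\<lambda>\<mu>s. (P h J \<mu>s - P h (\<lambda>j \<mu>s. 0) \<mu>s) + (Q h J \<mu>s - Q h (\<lambda>j \<mu>s. 0) \<mu>s))" by auto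
  then show ?case using add.IH by (auto intro!: boost_order_le_add)
next
  case (scale r P c)
  then show ?case
    using boost_order_le_cmult[of h "e 0" "-1" r "\<lambda>\<mu>s. P h J \<mu>s - P h (\<lambda>j \<mu>s. 0) \<mu>s" c]
    by (auto intro!: boost_order_le_cmult simp: right_diff_distrib)
next
  case (prod r P s Q)
  let ?Z = "\<lambda>j \<mu>s. 0 :: complex^'N^'N"
  note tp = boost_order_le_tensor_product[OF bilinear_mult]
  have "(\<lambda>\<mu>s. P h J (take r \<mu>s) * Q h J (drop r \<mu>s) - P h ?Z (take r \<mu>s) * Q h ?Z (drop r \<mu>s))
      = (\<lambda>\<mu>s. (P h J (take r \<mu>s) - P h ?Z (take r \<mu>s)) * Q h J (drop r \<mu>s)
          + P h ?Z (take r \<mu>s) * (Q h J (drop r \<mu>s) - Q h ?Z (drop r \<mu>s)))"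
    by (auto simp: algebra_simps)
  moreover have "boost_order_le h (e 0) (-1 + 0) (r + s)
      (\<lambda>\<mu>s. (P h J (take r \<mu>s) - P h ?Z (take r \<mu>s)) * Q h J (drop r \<mu>s))"
    using tp[of h "e 0" "-1" r "\<lambda>\<mu>s. P h J \<mu>s - P h ?Z \<mu>s" 0 s "Q h J"] prod.IH by blast
  moreover have "boost_order_le h (e 0) (0 + -1) (r + s)
      (\<lambda>\<mu>s. P h ?Z (take r \<mu>s) * (Q h J (drop r \<mu>s) - Q h ?Z (drop r \<mu>s)))"
    using tp[of h "e 0" 0 r "P h ?Z" "-1" s "\<lambda>\<mu>s. Q h J \<mu>s - Q h ?Z \<mu>s"] prod.IH by blast
  ultimately have "boost_order_le h (e 0) (-1) (r + s)
      (\<lambda>\<mu>s. P h J (take r \<mu>s) * Q h J (drop r \<mu>s) - P h ?Z (take r \<mu>s) * Q h ?Z (drop r \<mu>s))"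
    using boost_order_le_add by force
  then show ?case
    using tp[of h "e 0" 0 r "P h J" 0 s "Q h J"] tp[of h "e 0" 0 r "P h ?Z" 0 s "Q h ?Z"] prod.IH by simp
next
  case (perm r P \<pi>)
  have R: "boost_order_le h (e 0) b r (\<lambda>\<mu>s. T (map (\<lambda>i. \<mu>s ! \<pi> i) [0..<r]))"
    if "boost_order_le h (e 0) b r T" for b and T :: "'n list \<Rightarrow> complex"
    using boost_order_le_rearrange[OF perm_list_permutes[OF perm.hyps(2)] _ that]
    by (simp add: rearrange_def[abs_def] comp_def)
  show ?case
    using perm.IH R[of 0 "P h J"] R[of 0 "P h (\<lambda>j \<mu>s. 0)"]
      R[of "-1" "\<lambda>\<mu>s. P h J \<mu>s - P h (\<lambda>j \<mu>s. 0) \<mu>s"] by blast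
next
  case (contract r P)
  have c: "(\<Sum>\<alpha>\<in>UNIV. \<Sum>\<gamma>\<in>UNIV. of_real (matrix_inv h $ \<alpha> $ \<gamma>) * T (\<alpha> # \<gamma> # \<mu>s)) = contract_metric h T \<mu>s"
    for T :: "'n list \<Rightarrow> complex" and \<mu>s
    by (simp add: contract_metric_def scaleR_conv_of_real)
  have "(\<lambda>\<mu>s. contract_metric h (P h J) \<mu>s - contract_metric h (P h (\<lambda>j \<mu>s. 0)) \<mu>s)
      = contract_metric h (\<lambda>\<mu>s. P h J \<mu>s - P h (\<lambda>j \<mu>s. 0) \<mu>s)"
    by (simp add: fun_eq_iff contract_metric_def scaleR_diff_right sum_subtractf)
  then show ?case
    unfolding c using contract.IH boost_order_le_contract by auto
qed

lemma (in null_frame_at) polynomial_gauge_scalar_vanishes: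
  assumes "polynomial_gauge_scalar G t k P" "lorentzian h" "independent (range t)"
    and "\<And>j a. j \<le> k \<Longrightarrow> boost_order_le h (e 0) (-1) (j + 2) (\<lambda>\<mu>s. gen_coeff t a (J j \<mu>s))"
  shows "P h J [] = 0"
proof -
  have c: "constructible t k 0 P" "P h (\<lambda>j \<mu>s. 0) [] = 0"
    using assms(1,2) by (auto simp: polynomial_gauge_scalar_def)
  have "boost_order_le h (e 0) (-1) 0 (\<lambda>\<mu>s. P h J \<mu>s - P h (\<lambda>j \<mu>s. 0) \<mu>s)"
    using constructible_boost_order[OF c(1) assms(3,4)] by blast
  \<comment> \<open>A scalar has no slots, and the empty sum of weights, 0, already exceeds
    -1.\<close>
  from boost_order_leD[OF this, where vs = "[]" and ws = "[]"] show ?thesis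
    by (simp add: c(2))
qed

section \<open>The Levi-Civita derivative in a chart\<close>

definition smooth_tensor :: "(real^'n::finite) set \<Rightarrow> ('n, 'v::real_normed_vector) tensor_field \<Rightarrow> bool" where
  "smooth_tensor S T \<longleftrightarrow> (\<forall>\<mu>s. smooth_on (T \<mu>s) S)"

text \<open>The Christoffel symbols in the argument order that makes
  \<open>connection g x \<kappa>\<close> a matrix for \<open>act\<close>.\<close>

definition connection :: "'n::finite metric \<Rightarrow> real^'n \<Rightarrow> 'n \<Rightarrow> 'n \<Rightarrow> 'n \<Rightarrow> real" where
  "connection g x \<kappa> \<rho> \<nu> = christoffel g x \<rho> \<kappa> \<nu>"

text \<open>The Levi-Civita derivative of a vector field, whose upper index \<open>covd\<close> does
  not cover. The direction \<open>X\<close> is a vector at the point only.\<close>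

definition nabla_vec :: "'n::finite metric \<Rightarrow> real^'n \<Rightarrow> (real^'n \<Rightarrow> real^'n) \<Rightarrow> real^'n \<Rightarrow> real^'n" where
  "nabla_vec g X Y x = frechet_derivative Y (at x) X
     + apply_matrix (\<lambda>\<rho> \<nu>. \<Sum>\<kappa>\<in>UNIV. X $ \<kappa> * christoffel g x \<rho> \<kappa> \<nu>) (Y x)"

lemma matrix_mult_add_left: "(A + B) ** (C :: real^'n^'m) = A ** C + B ** C"
  by (simp add: matrix_matrix_mult_def vec_eq_iff distrib_right sum.distrib)

lemma covd_Cons:
  "covd g T (\<kappa> # \<nu>s) x = partial_deriv \<kappa> (T \<nu>s) x - act (connection g x \<kappa>) (\<lambda>\<nu>s. T \<nu>s x) \<nu>s"
  by (simp add: act_def connection_def)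

lemma ev_list_update_add:
  "i < length vs \<Longrightarrow> ev (vs[i := u + w]) T = ev (vs[i := u]) T + ev (vs[i := w]) T"
proof (induction vs arbitrary: i T)
  case (Cons v vs)
  have "slot (u + w) T = (\<lambda>\<mu>s. slot u T \<mu>s + slot w T \<mu>s)"
    by (simp add: slot_def fun_eq_iff scaleR_add_left sum.distrib)
  with Cons show ?case by (cases i) (simp_all add: ev_add)
qed simp

lemma has_derivative_ev:
  fixes T :: "('n::finite, 'v::real_normed_vector) tensor_field"
  assumes "\<And>\<mu>s. (T \<mu>s has_derivative T' \<mu>s) (at x)" "\<forall>Y\<in>set Ys. Y differentiable (at x)"
  shows "((\<lambda>y. ev (map (\<lambda>Y. Y y) Ys) (\<lambda>\<mu>s. T \<mu>s y)) has_derivative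
    (\<lambda>X. ev (map (\<lambda>Y. Y x) Ys) (\<lambda>\<mu>s. T' \<mu>s X)
      + (\<Sum>i<length Ys. ev ((map (\<lambda>Y. Y x) Ys)[i := frechet_derivative (Ys ! i) (at x) X]) (\<lambda>\<mu>s. T \<mu>s x)))) (at x)"
  using assms
proof (induction Ys arbitrary: T T')
  case (Cons Y Ys)
  have Y: "(Y has_derivative frechet_derivative Y (at x)) (at x)"
    using Cons.prems(2) frechet_derivative_works by auto
  have "((\<lambda>y. slot (Y y) (\<lambda>\<mu>s. T \<mu>s y) \<mu>s) has_derivative
      (\<lambda>X. slot (frechet_derivative Y (at x) X) (\<lambda>\<mu>s. T \<mu>s x) \<mu>s + slot (Y x) (\<lambda>\<mu>s. T' \<mu>s X) \<mu>s)) (at x)" for \<mu>s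
    unfolding slot_def
    by (auto intro!: derivative_eq_intros Cons.prems(1) bounded_linear.has_derivative[OF bounded_linear_vec_nth Y]
        simp: sum.distrib add.commute)
  from Cons.IH[OF this] Cons.prems(2)
  have "((\<lambda>y. ev (map (\<lambda>Y. Y y) Ys) (\<lambda>\<mu>s. slot (Y y) (\<lambda>\<mu>s. T \<mu>s y) \<mu>s)) has_derivative
     (\<lambda>X. ev (map (\<lambda>Y. Y x) Ys) (\<lambda>\<mu>s. slot (frechet_derivative Y (at x) X) (\<lambda>\<mu>s. T \<mu>s x) \<mu>s + slot (Y x) (\<lambda>\<mu>s. T' \<mu>s X) \<mu>s)
       + (\<Sum>i<length Ys. ev ((map (\<lambda>Y. Y x) Ys)[i := frechet_derivative (Ys ! i) (at x) X])
           (\<lambda>\<mu>s. slot (Y x) (\<lambda>\<mu>s. T \<mu>s x) \<mu>s)))) (at x)"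
    by simp
  then show ?case
    unfolding list.map ev.simps
    by (rule has_derivative_eq_rhs)
       (simp add: fun_eq_iff ev_add sum.lessThan_Suc_shift add.commute add.left_commute del: sum.lessThan_Suc)
qed (use assms in simp)

locale lorentz_chart =
  fixes g :: "'n::finite metric" and S :: "(real^'n) set"
  assumes open_S: "open S" and metric: "lorentz_metric_on g S"
begin

lemma metric_sym: "x \<in> S \<Longrightarrow> transpose (g x) = g x"
  using metric by (auto simp: lorentz_metric_on_def lorentzian_def)

lemma metric_sym_nth: "x \<in> S \<Longrightarrow> g x $ \<mu> $ \<nu> = g x $ \<nu> $ \<mu>"
  using arg_cong[OF metric_sym, of x "\<lambda>h. h $ \<nu> $ \<mu>"] by (simp add: transpose_def)

lemma metric_invertible:
  assumes "x \<in> S"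
  shows "invertible (g x)"
proof -
  obtain P :: "real^'n^'n" and i0 where
    P: "transpose P ** g x ** P = (\<chi> i j. if i = j then (if i = i0 then -1 else 1) else 0)" (is "_ = ?D")
    using metric assms by (auto simp: lorentz_metric_on_def lorentzian_def)
  have "det ?D = (\<Prod>i\<in>UNIV. ?D $ i $ i)"
    by (rule det_diagonal) auto
  also have "\<dots> \<noteq> 0" by auto
  finally have "det (transpose P ** g x ** P) \<noteq> 0" by (simp add: P)
  then show ?thesis by (simp add: det_mul invertible_det_nz)
qed

lemma smooth_metric: "smooth_on (\<lambda>x. g x $ \<mu> $ \<nu>) S"
  using metric unfolding lorentz_metric_on_def
  by (intro smooth_on_vec_nth open_S) auto

lemma smooth_metric_inv: "smooth_on (\<lambda>x. matrix_inv (g x) $ \<mu> $ \<nu>) S"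
  by (rule smooth_on_matrix_inv[OF open_S smooth_metric metric_invertible])

lemma smooth_christoffel: "smooth_on (\<lambda>x. christoffel g x \<rho> \<mu> \<nu>) S"
  unfolding christoffel_def
  by (intro smooth_on_mult smooth_on_sum smooth_on_add smooth_on_diff smooth_on_partial_deriv
      smooth_on_const smooth_metric smooth_metric_inv open_S)

lemma christoffel_sym:
  assumes "x \<in> S"
  shows "christoffel g x \<rho> \<mu> \<nu> = christoffel g x \<rho> \<nu> \<mu>"
proof -
  have "partial_deriv \<sigma> (\<lambda>y. g y $ \<mu> $ \<nu>) x = partial_deriv \<sigma> (\<lambda>y. g y $ \<nu> $ \<mu>) x" for \<sigma>
    by (rule partial_deriv_cong_open[OF open_S assms]) (rule metric_sym_nth)
  then have "(partial_deriv \<mu> (\<lambda>y. g y $ \<sigma> $ \<nu>) x + partial_deriv \<nu> (\<lambda>y. g y $ \<sigma> $ \<mu>) x - partial_deriv \<sigma> (\<lambda>y. g y $ \<mu> $ \<nu>) x)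
      = (partial_deriv \<nu> (\<lambda>y. g y $ \<sigma> $ \<mu>) x + partial_deriv \<mu> (\<lambda>y. g y $ \<sigma> $ \<nu>) x - partial_deriv \<sigma> (\<lambda>y. g y $ \<nu> $ \<mu>) x)" for \<sigma>
    by (metis add.commute)
  then show ?thesis
    unfolding christoffel_def by (intro arg_cong2[of _ _ _ _ "(*)"] sum.cong refl)
qed

lemma christoffel_lower:
  assumes x: "x \<in> S"
  shows "(\<Sum>\<rho>\<in>UNIV. g x $ \<alpha> $ \<rho> * christoffel g x \<rho> \<mu> \<nu>) =
    1/2 * (partial_deriv \<mu> (\<lambda>y. g y $ \<alpha> $ \<nu>) x + partial_deriv \<nu> (\<lambda>y. g y $ \<alpha> $ \<mu>) x
       - partial_deriv \<alpha> (\<lambda>y. g y $ \<mu> $ \<nu>) x)"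
proof -
  define C where "C = (\<chi> \<sigma>. 1/2 * (partial_deriv \<mu> (\<lambda>y. g y $ \<sigma> $ \<nu>) x + partial_deriv \<nu> (\<lambda>y. g y $ \<sigma> $ \<mu>) x
       - partial_deriv \<sigma> (\<lambda>y. g y $ \<mu> $ \<nu>) x))"
  have "christoffel g x \<rho> \<mu> \<nu> = (matrix_inv (g x) *v C) $ \<rho>" for \<rho>
    by (simp add: christoffel_def C_def matrix_vector_mult_def sum_distrib_left)
  then have "(\<Sum>\<rho>\<in>UNIV. g x $ \<alpha> $ \<rho> * christoffel g x \<rho> \<mu> \<nu>) = (g x *v (matrix_inv (g x) *v C)) $ \<alpha>"
    by (simp add: matrix_vector_mult_def[of "g x"])
  also have "\<dots> = C $ \<alpha>"
    by (simp add: matrix_vector_mul_assoc matrix_inv_right[OF metric_invertible[OF x]])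
  finally show ?thesis by (simp add: C_def)
qed

lemma metric_compatible:
  assumes x: "x \<in> S"
  shows "partial_deriv \<kappa> (\<lambda>y. g y $ \<alpha> $ \<gamma>) x =
    (\<Sum>\<rho>\<in>UNIV. christoffel g x \<rho> \<kappa> \<alpha> * g x $ \<rho> $ \<gamma>) + (\<Sum>\<rho>\<in>UNIV. christoffel g x \<rho> \<kappa> \<gamma> * g x $ \<alpha> $ \<rho>)"
proof -
  have s: "partial_deriv \<mu> (\<lambda>y. g y $ \<alpha> $ \<beta>) x = partial_deriv \<mu> (\<lambda>y. g y $ \<beta> $ \<alpha>) x" for \<mu> \<alpha> \<beta>
    by (rule partial_deriv_cong_open[OF open_S x]) (rule metric_sym_nth)
  have c: "(\<Sum>\<rho>\<in>UNIV. christoffel g x \<rho> \<kappa> \<alpha> * g x $ \<rho> $ \<gamma>) = (\<Sum>\<rho>\<in>UNIV. g x $ \<gamma> $ \<rho> * christoffel g x \<rho> \<kappa> \<alpha>)"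
    "(\<Sum>\<rho>\<in>UNIV. christoffel g x \<rho> \<kappa> \<gamma> * g x $ \<alpha> $ \<rho>) = (\<Sum>\<rho>\<in>UNIV. g x $ \<alpha> $ \<rho> * christoffel g x \<rho> \<kappa> \<gamma>)"
    by (simp_all add: mult.commute metric_sym_nth[OF x, of \<gamma>])
  show ?thesis
    unfolding c christoffel_lower[OF x]
    unfolding s[of \<kappa> \<gamma> \<alpha>] s[of \<alpha> \<gamma> \<kappa>] s[of \<gamma> \<kappa> \<alpha>] by (simp add: field_simps)
qed

text \<open>Obtained by differentiating g^(-1) g = 1 and inserting metric compatibility for the
  derivative of g.\<close>

lemma metric_inv_compatible:
  assumes x: "x \<in> S"
  shows "partial_deriv \<kappa> (\<lambda>y. matrix_inv (g y) $ \<alpha> $ \<gamma>) x =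
    - (\<Sum>\<rho>\<in>UNIV. christoffel g x \<alpha> \<kappa> \<rho> * matrix_inv (g x) $ \<rho> $ \<gamma>)
    - (\<Sum>\<rho>\<in>UNIV. christoffel g x \<gamma> \<kappa> \<rho> * matrix_inv (g x) $ \<alpha> $ \<rho>)"
proof -
  define C :: "real^'n^'n" where "C = (\<chi> \<rho> \<nu>. christoffel g x \<rho> \<kappa> \<nu>)"
  define dg :: "real^'n^'n" where "dg = (\<chi> \<alpha> \<gamma>. partial_deriv \<kappa> (\<lambda>y. g y $ \<alpha> $ \<gamma>) x)"
  define di :: "real^'n^'n" where "di = (\<chi> \<alpha> \<gamma>. partial_deriv \<kappa> (\<lambda>y. matrix_inv (g y) $ \<alpha> $ \<gamma>) x)"
  let ?i = "matrix_inv (g x)"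
  note gi = matrix_inv_right[OF metric_invertible[OF x]] matrix_inv_left[OF metric_invertible[OF x]]
  have dg: "dg = transpose C ** g x + g x ** C"
    by (simp add: vec_eq_iff dg_def C_def metric_compatible[OF x] matrix_matrix_mult_def transpose_def mult.commute)
  have "(di ** g x + ?i ** dg) $ \<alpha> $ \<gamma> = 0" for \<alpha> \<gamma>
  proof -
    have "partial_deriv \<kappa> (\<lambda>y. \<Sum>\<beta>\<in>UNIV. matrix_inv (g y) $ \<alpha> $ \<beta> * g y $ \<beta> $ \<gamma>) x = (\<Sum>\<beta>\<in>UNIV. di $ \<alpha> $ \<beta> * g x $ \<beta> $ \<gamma> + ?i $ \<alpha> $ \<beta> * dg $ \<beta> $ \<gamma>)"
      by (subst partial_deriv_eqI[OF has_derivative_sum[OF has_derivative_mult[OF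
            smooth_on_has_derivative[OF smooth_metric_inv open_S x] smooth_on_has_derivative[OF smooth_metric open_S x]]]])
         (simp add: di_def dg_def partial_deriv_def add.commute)
    also have "partial_deriv \<kappa> (\<lambda>y. \<Sum>\<beta>\<in>UNIV. matrix_inv (g y) $ \<alpha> $ \<beta> * g y $ \<beta> $ \<gamma>) x = partial_deriv \<kappa> (\<lambda>y. (mat 1 :: real^'n^'n) $ \<alpha> $ \<gamma>) x"
    proof (rule partial_deriv_cong_open[OF open_S x])
      fix y assume "y \<in> S"
      then show "(\<Sum>\<beta>\<in>UNIV. matrix_inv (g y) $ \<alpha> $ \<beta> * g y $ \<beta> $ \<gamma>) = (mat 1 :: real^'n^'n) $ \<alpha> $ \<gamma>"
        using arg_cong[OF matrix_inv_left[OF metric_invertible], of y "\<lambda>M. M $ \<alpha> $ \<gamma>"] by (simp add: matrix_matrix_mult_def)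
    qed
    finally show ?thesis by (simp add: matrix_matrix_mult_def sum.distrib)
  qed
  then have "di ** g x + ?i ** dg = 0" by (simp add: vec_eq_iff)
  then have "(di ** g x + ?i ** (transpose C ** g x + g x ** C)) ** ?i = 0"
    by (simp add: dg)
  then have "di + ?i ** transpose C + C ** ?i = 0"
    by (simp add: matrix_add_ldistrib matrix_mult_add_left matrix_mul_assoc gi(2))
       (simp add: matrix_mul_assoc[symmetric] gi(1) add.assoc)
  then have "(di + ?i ** transpose C + C ** ?i) $ \<alpha> $ \<gamma> = 0" by simp
  then show ?thesis
    by (simp add: di_def C_def matrix_matrix_mult_def transpose_def mult.commute)
qed

lemma smooth_tensor_covd:
  assumes "smooth_tensor S T"
  shows "smooth_tensor S (covd g T)"
  unfolding smooth_tensor_def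
proof
  fix \<mu>s
  show "smooth_on (covd g T \<mu>s) S"
  proof (cases \<mu>s)
    case Nil
    have "covd g T [] = (\<lambda>x. 0)" by (simp add: fun_eq_iff)
    with Nil show ?thesis by auto
  next
    case (Cons \<kappa> \<nu>s)
    have "covd g T (\<kappa> # \<nu>s) = (\<lambda>x. partial_deriv \<kappa> (T \<nu>s) x
     - (\<Sum>i<length \<nu>s. \<Sum>\<rho>\<in>UNIV. christoffel g x \<rho> \<kappa> (\<nu>s ! i) *\<^sub>R T (\<nu>s[i := \<rho>]) x))"
      by (simp add: fun_eq_iff)
    then show ?thesis
      using assms unfolding Cons smooth_tensor_def
      by (auto intro!: smooth_on_diff smooth_on_partial_deriv smooth_on_sum smooth_on_scaleR smooth_christoffel open_S)
  qed
qed

text \<open>The Leibniz rule X(T(Y, ...)) = (nabla_X T)(Y, ...) + T(nabla_X Y, ...) + ...: by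
  \<open>ev_act\<close> the Christoffel terms on the indices of \<open>T\<close> and on the
  arguments cancel. It lets boost orders be differentiated without choosing a frame field.\<close>

lemma frechet_derivative_ev:
  assumes x: "x \<in> S" and T: "smooth_tensor S T" and Ys: "\<forall>Y\<in>set Ys. Y differentiable (at x)"
  shows "frechet_derivative (\<lambda>y. ev (map (\<lambda>Y. Y y) Ys) (\<lambda>\<mu>s. T \<mu>s y)) (at x) X
    = ev (X # map (\<lambda>Y. Y x) Ys) (\<lambda>\<mu>s. covd g T \<mu>s x)
      + (\<Sum>i<length Ys. ev ((map (\<lambda>Y. Y x) Ys)[i := nabla_vec g X (Ys ! i) x]) (\<lambda>\<mu>s. T \<mu>s x))"
proof -
  let ?Y = "map (\<lambda>Y. Y x) Ys"
  let ?C = "\<lambda>\<rho> \<nu>. \<Sum>\<kappa>\<in>UNIV. X $ \<kappa> * christoffel g x \<rho> \<kappa> \<nu>"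
  note dT = smooth_on_has_derivative[OF T[unfolded smooth_tensor_def, rule_format] open_S x]
  note dT' = smooth_on_differentiable[OF T[unfolded smooth_tensor_def, rule_format] open_S x]
  have "slot X (\<lambda>\<mu>s. covd g T \<mu>s x) \<nu>s
      = frechet_derivative (T \<nu>s) (at x) X - act ?C (\<lambda>\<mu>s. T \<mu>s x) \<nu>s" for \<nu>s
  proof -
    have "(\<Sum>\<kappa>\<in>UNIV. X $ \<kappa> *\<^sub>R act (connection g x \<kappa>) (\<lambda>\<mu>s. T \<mu>s x) \<nu>s) = act ?C (\<lambda>\<mu>s. T \<mu>s x) \<nu>s"
    proof -
      have "(\<Sum>\<kappa>\<in>UNIV. X $ \<kappa> *\<^sub>R act (connection g x \<kappa>) (\<lambda>\<mu>s. T \<mu>s x) \<nu>s)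
        = (\<Sum>\<kappa>\<in>UNIV. \<Sum>i<length \<nu>s. \<Sum>\<rho>\<in>UNIV. (X $ \<kappa> * christoffel g x \<rho> \<kappa> (\<nu>s ! i)) *\<^sub>R T (\<nu>s[i := \<rho>]) x)"
        by (simp add: act_def connection_def scaleR_sum_right)
      also have "\<dots> = (\<Sum>i<length \<nu>s. \<Sum>\<kappa>\<in>UNIV. \<Sum>\<rho>\<in>UNIV. (X $ \<kappa> * christoffel g x \<rho> \<kappa> (\<nu>s ! i)) *\<^sub>R T (\<nu>s[i := \<rho>]) x)"
        by (rule sum.swap)
      also have "\<dots> = (\<Sum>i<length \<nu>s. \<Sum>\<rho>\<in>UNIV. \<Sum>\<kappa>\<in>UNIV. (X $ \<kappa> * christoffel g x \<rho> \<kappa> (\<nu>s ! i)) *\<^sub>R T (\<nu>s[i := \<rho>]) x)"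
        by (intro sum.cong refl sum.swap)
      finally show ?thesis by (simp add: act_def scaleR_sum_left)
    qed
    then show ?thesis
      by (simp add: slot_def covd_Cons frechet_derivative_partial_deriv[OF dT'] scaleR_diff_right sum_subtractf
          del: covd.simps)
  qed
  then have "slot X (\<lambda>\<mu>s. covd g T \<mu>s x) = (\<lambda>\<nu>s. frechet_derivative (T \<nu>s) (at x) X - act ?C (\<lambda>\<mu>s. T \<mu>s x) \<nu>s)"
    by (rule ext)
  then have "ev (X # ?Y) (\<lambda>\<mu>s. covd g T \<mu>s x)
      = ev ?Y (\<lambda>\<mu>s. frechet_derivative (T \<mu>s) (at x) X)
        - (\<Sum>i<length Ys. ev (?Y[i := apply_matrix ?C (?Y ! i)]) (\<lambda>\<mu>s. T \<mu>s x))"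
    by (simp add: ev_diff ev_act)
  moreover have "ev (?Y[i := nabla_vec g X (Ys ! i) x]) (\<lambda>\<mu>s. T \<mu>s x)
      = ev (?Y[i := frechet_derivative (Ys ! i) (at x) X]) (\<lambda>\<mu>s. T \<mu>s x)
        + ev (?Y[i := apply_matrix ?C (?Y ! i)]) (\<lambda>\<mu>s. T \<mu>s x)" if "i < length Ys" for i
    using that by (simp add: nabla_vec_def ev_list_update_add)
  ultimately show ?thesis
    using frechet_derivative_at[OF has_derivative_ev[OF dT Ys], symmetric]
    by (simp add: sum.distrib)
qed

lemma covd_metric: "x \<in> S \<Longrightarrow> covd g (\<lambda>\<mu>s x. g x $ (\<mu>s ! 0) $ (\<mu>s ! 1)) [\<kappa>, \<alpha>, \<gamma>] x = 0"
  by (simp add: covd_Cons act_Cons connection_def metric_compatible del: covd.simps)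

lemma frechet_derivative_metric_form:
  assumes x: "x \<in> S" and Y: "Y differentiable (at x)" "Z differentiable (at x)"
  shows "frechet_derivative (\<lambda>y. metric_form (g y) (Y y) (Z y)) (at x) X
    = metric_form (g x) (nabla_vec g X Y x) (Z x) + metric_form (g x) (Y x) (nabla_vec g X Z x)"
proof -
  let ?g = "\<lambda>\<mu>s x. g x $ (\<mu>s ! 0) $ (\<mu>s ! 1)"
  have "smooth_tensor S ?g" by (simp add: smooth_tensor_def smooth_metric)
  from frechet_derivative_ev[OF x this, of "[Y, Z]" X] Y
  have "frechet_derivative (\<lambda>y. ev [Y y, Z y] (\<lambda>\<mu>s. ?g \<mu>s y)) (at x) X
    = ev [X, Y x, Z x] (\<lambda>\<mu>s. covd g ?g \<mu>s x)
      + (ev [nabla_vec g X Y x, Z x] (\<lambda>\<mu>s. ?g \<mu>s x) + ev [Y x, nabla_vec g X Z x] (\<lambda>\<mu>s. ?g \<mu>s x))"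
    by (simp add: sum.lessThan_Suc numeral_2_eq_2 del: ev.simps covd.simps)
  moreover have "ev [X, Y x, Z x] (\<lambda>\<mu>s. covd g ?g \<mu>s x) = ev [X, Y x, Z x] (\<lambda>\<mu>s. 0)"
    by (rule ev_cong) (use covd_metric[OF x] in \<open>auto simp: length_Suc_conv simp del: covd.simps\<close>)
  ultimately show ?thesis unfolding ev_pair_metric by (simp del: ev.simps)
qed

lemma nabla_null_orthogonal:
  assumes x: "x \<in> S" and l: "smooth_on l S" "\<And>y. y \<in> S \<Longrightarrow> metric_form (g y) (l y) (l y) = 0"
  shows "metric_form (g x) (l x) (nabla_vec g X l x) = 0"
proof -
  note d = smooth_on_differentiable[OF l(1) open_S x]
  show ?thesis
    using frechet_derivative_metric_form[OF x d d, of X]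
      frechet_derivative_eq_0[OF open_S x, of "\<lambda>y. metric_form (g y) (l y) (l y)" X] l(2)
      metric_form_sym[OF metric_sym[OF x], of "l x" "nabla_vec g X l x"] by simp
qed

end

section \<open>The gauge covariant derivative in a chart\<close>

text \<open>With the factor -i absorbed, the gauge covariant derivative is nabla +
  \<open>bracket A\<close>, and the structure constants become real coefficients, so the real span
  of the generators is closed.\<close>

definition bracket :: "complex^'N::finite^'N \<Rightarrow> complex^'N^'N \<Rightarrow> complex^'N^'N" where
  "bracket X Y = - cscale \<i> (commutator X Y)"

lemma bilinear_matrix_mult: "bilinear ((**) :: complex^'N::finite^'N \<Rightarrow> complex^'N^'N \<Rightarrow> complex^'N^'N)"
  by (auto simp: bilinear_def matrix_matrix_mult_def vec_eq_iff distrib_left distrib_right sum.distrib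
      scaleR_sum_right intro!: linearI)

lemma bounded_bilinear_matrix_mult:
  "bounded_bilinear ((**) :: complex^'N::finite^'N \<Rightarrow> complex^'N^'N \<Rightarrow> complex^'N^'N)"
  using bilinear_matrix_mult bilinear_conv_bounded_bilinear by blast

lemmas matrix_mult_simps = bilinear_ladd[OF bilinear_matrix_mult] bilinear_radd[OF bilinear_matrix_mult]
  bilinear_lsub[OF bilinear_matrix_mult] bilinear_rsub[OF bilinear_matrix_mult]
  bilinear_lmul[OF bilinear_matrix_mult] bilinear_rmul[OF bilinear_matrix_mult]
  bilinear_lneg[OF bilinear_matrix_mult] bilinear_rneg[OF bilinear_matrix_mult]

lemma linear_cscale: "linear (cscale c :: complex^'N::finite^'N \<Rightarrow> _)"
  by (auto simp: cscale_def vec_eq_iff distrib_left intro!: linearI)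

lemma cscale_mult_left: "cscale c X ** Y = cscale c (X ** Y)"
  and cscale_mult_right: "X ** cscale c Y = cscale c (X ** Y)"
  for X Y :: "complex^'N::finite^'N"
  by (simp_all add: cscale_def matrix_matrix_mult_def vec_eq_iff sum_distrib_left mult.assoc mult.left_commute)

lemma bracket_eq: "bracket X Y = cscale \<i> (Y ** X) - cscale \<i> (X ** Y)"
  by (simp add: bracket_def commutator_def linear_diff[OF linear_cscale])

lemma bilinear_bracket: "bilinear bracket"
  unfolding bilinear_def bracket_eq
  by (auto simp: matrix_mult_simps linear_add[OF linear_cscale] linear_scale[OF linear_cscale] algebra_simps
      intro!: linearI)

lemma bounded_bilinear_bracket: "bounded_bilinear bracket"
  using bilinear_bracket bilinear_conv_bounded_bilinear by blast

lemma linear_bracket: "linear (bracket X)" "linear (\<lambda>X. bracket X Y)"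
  using bilinear_bracket by (auto simp: bilinear_def)

lemma bracket_antisym: "bracket X Y = - bracket Y X"
  by (simp add: bracket_eq)

lemma bracket_derivation: "bracket X (Y ** Z) = bracket X Y ** Z + Y ** bracket X Z"
  by (simp add: bracket_eq matrix_mult_simps cscale_mult_left cscale_mult_right matrix_mul_assoc)

lemma bracket_jacobi: "bracket X (bracket Y Z) - bracket Y (bracket X Z) = bracket (bracket X Y) Z"
  by (simp add: bracket_eq matrix_mult_simps cscale_mult_left cscale_mult_right matrix_mul_assoc
      linear_diff[OF linear_cscale] algebra_simps)

lemma bracket_scalar: "bracket X (c *\<^sub>R mat 1) = 0"
  by (simp add: bracket_eq matrix_mult_simps)

lemmas bracket_simps = bilinear_ladd[OF bilinear_bracket] bilinear_radd[OF bilinear_bracket]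
  bilinear_lsub[OF bilinear_bracket] bilinear_rsub[OF bilinear_bracket]
  bilinear_rmul[OF bilinear_bracket] bilinear_rneg[OF bilinear_bracket]

definition tensor_product ::
  "nat \<Rightarrow> ('n::finite, complex^'N::finite^'N) tensor_field \<Rightarrow> ('n, complex^'N^'N) tensor_field
    \<Rightarrow> ('n, complex^'N^'N) tensor_field" where
  "tensor_product r P Q \<mu>s x = P (take r \<mu>s) x ** Q (drop r \<mu>s) x"

definition contract_field ::
  "'n::finite metric \<Rightarrow> ('n, 'v::real_normed_vector) tensor_field \<Rightarrow> ('n, 'v) tensor_field" where
  "contract_field g T \<mu>s x = contract_metric (g x) (\<lambda>\<mu>s. T \<mu>s x) \<mu>s"

lemma gauge_covd_Cons:
  "gauge_covd g A T (\<kappa> # \<nu>s) x = partial_deriv \<kappa> (T \<nu>s) x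
    - act (connection g x \<kappa>) (\<lambda>\<nu>s. T \<nu>s x) \<nu>s + bracket (A \<kappa> x) (T \<nu>s x)"
  unfolding gauge_covd_def covd_Cons by (simp add: bracket_def)

lemma perm_list_Cons_Suc:
  assumes "perm_list \<sigma>"
  shows "perm_list (0 # map Suc \<sigma>)"
proof -
  have "set (0 # map Suc \<sigma>) = insert 0 (Suc ` {..<length \<sigma>})"
    using assms by (simp add: perm_list_def)
  also have "\<dots> = {..<length (0 # map Suc \<sigma>)}"
    by (simp add: lessThan_Suc_eq_insert_0)
  finally show ?thesis
    using assms by (simp add: perm_list_def distinct_map)
qed

lemma rearrange_Cons_Suc:
  "rearrange (0 # map Suc \<sigma>) T (\<kappa> # \<nu>s) = T (\<kappa> # map ((!) \<nu>s) \<sigma>)"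
  by (simp add: rearrange_def comp_def)

locale gauge_chart = lorentz_chart g S for g :: "'n::finite metric" and S +
  fixes A :: "('n, 'N::finite) potential"
  assumes smooth_A: "smooth_on (A \<mu>) S"
begin

abbreviation D :: "('n, complex^'N^'N) tensor_field \<Rightarrow> ('n, complex^'N^'N) tensor_field" where
  "D \<equiv> gauge_covd g A"

abbreviation F :: "('n, complex^'N^'N) tensor_field" where
  "F \<equiv> field_strength g A"

lemma smooth_tensor_gauge_covd:
  assumes "smooth_tensor S T"
  shows "smooth_tensor S (D T)"
proof -
  have b: "smooth_on (\<lambda>x. bracket (A (hd \<mu>s) x) (T (tl \<mu>s) x)) S" for \<mu>s
    using assms by (intro smooth_on_bounded_bilinear[OF open_S bounded_bilinear_bracket] smooth_A) (simp add: smooth_tensor_def)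
  have "D T \<mu>s = (\<lambda>x. covd g T \<mu>s x + bracket (A (hd \<mu>s) x) (T (tl \<mu>s) x))" for \<mu>s
    by (simp add: fun_eq_iff gauge_covd_def bracket_def)
  then show ?thesis
    using b smooth_tensor_covd[OF assms] by (auto simp: smooth_tensor_def intro!: smooth_on_add open_S)
qed

lemma smooth_tensor_gauge_covd_pow: "smooth_tensor S T \<Longrightarrow> smooth_tensor S ((D ^^ j) T)"
  by (induction j) (simp_all add: smooth_tensor_gauge_covd)

lemma smooth_tensorD: "smooth_tensor S T \<Longrightarrow> smooth_on (T \<mu>s) S"
  by (simp add: smooth_tensor_def)

lemma smooth_tensor_differentiable: "smooth_tensor S T \<Longrightarrow> x \<in> S \<Longrightarrow> T \<mu>s differentiable (at x)"
  using smooth_on_differentiable open_S smooth_tensorD by blast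

text \<open>Component functions carry arbitrary values on lists of the wrong length and outside
  \<open>S\<close>. Differentiation respects agreement on the meaningful arguments because
  \<open>S\<close> is open and \<open>act\<close> preserves the length.\<close>

lemma gauge_covd_cong:
  assumes "\<And>\<mu>s x. length \<mu>s = r \<Longrightarrow> x \<in> S \<Longrightarrow> T \<mu>s x = T' \<mu>s x" "length \<mu>s = Suc r" "x \<in> S"
  shows "D T \<mu>s x = D T' \<mu>s x"
proof -
  obtain \<kappa> \<nu>s where \<mu>s: "\<mu>s = \<kappa> # \<nu>s" "length \<nu>s = r" using assms(2) by (auto simp: length_Suc_conv)
  have "partial_deriv \<kappa> (T \<nu>s) x = partial_deriv \<kappa> (T' \<nu>s) x"
    by (rule partial_deriv_cong_open[OF open_S assms(3)]) (simp add: assms(1) \<mu>s)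
  moreover have "act (connection g x \<kappa>) (\<lambda>\<nu>s. T \<nu>s x) \<nu>s = act (connection g x \<kappa>) (\<lambda>\<nu>s. T' \<nu>s x) \<nu>s"
    by (rule act_cong) (simp add: assms \<mu>s)
  ultimately show ?thesis by (simp add: \<mu>s gauge_covd_Cons assms)
qed

lemma gauge_covd_pow_cong:
  assumes "\<And>\<mu>s x. length \<mu>s = r \<Longrightarrow> x \<in> S \<Longrightarrow> T \<mu>s x = T' \<mu>s x" "length \<mu>s = r + j" "x \<in> S"
  shows "(D ^^ j) T \<mu>s x = (D ^^ j) T' \<mu>s x"
  using assms(2,3)
proof (induction j arbitrary: \<mu>s x)
  case (Suc j)
  show ?case
    unfolding funpow.simps comp_def by (rule gauge_covd_cong[OF Suc.IH]) (use Suc.prems in auto)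
qed (simp add: assms(1))

lemma gauge_covd_add:
  assumes "smooth_tensor S T" "smooth_tensor S T'" "x \<in> S" "\<mu>s \<noteq> []"
  shows "D (\<lambda>\<mu>s x. T \<mu>s x + T' \<mu>s x) \<mu>s x = D T \<mu>s x + D T' \<mu>s x"
  using assms(4) partial_deriv_add[OF smooth_tensor_differentiable[OF assms(1,3)] smooth_tensor_differentiable[OF assms(2,3)]]
  by (cases \<mu>s) (simp_all add: gauge_covd_Cons act_add bracket_simps)

text \<open>The new derivative index stays at position 0, so the permutation is shifted by one and
  fixes 0.\<close>

lemma gauge_covd_rearrange:
  assumes "perm_list \<sigma>" "length \<nu>s = length \<sigma>"
  shows "D (rearrange \<sigma> T) (\<kappa> # \<nu>s) x = rearrange (0 # map Suc \<sigma>) (D T) (\<kappa> # \<nu>s) x"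
proof -
  have "(\<lambda>\<nu>s. rearrange \<sigma> T \<nu>s x) = rearrange \<sigma> (\<lambda>\<nu>s. T \<nu>s x)"
    by (simp add: rearrange_def fun_eq_iff)
  then have "act M (\<lambda>\<nu>s. rearrange \<sigma> T \<nu>s x) \<nu>s = act M (\<lambda>\<nu>s. T \<nu>s x) (map ((!) \<nu>s) \<sigma>)" for M
    using act_rearrange[OF assms] by simp
  then show ?thesis
    unfolding rearrange_Cons_Suc gauge_covd_Cons by (simp add: rearrange_def)
qed

lemma smooth_tensor_product:
  assumes "smooth_tensor S P" "smooth_tensor S Q"
  shows "smooth_tensor S (tensor_product r P Q)"
  using assms unfolding smooth_tensor_def tensor_product_def[abs_def]
  by (auto intro!: smooth_on_bounded_bilinear[OF open_S bounded_bilinear_matrix_mult])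

lemma gauge_covd_tensor_product:
  assumes "smooth_tensor S P" "smooth_tensor S Q" "x \<in> S"
  shows "D (tensor_product r P Q) (\<kappa> # \<nu>s) x
    = D P (\<kappa> # take r \<nu>s) x ** Q (drop r \<nu>s) x + P (take r \<nu>s) x ** D Q (\<kappa> # drop r \<nu>s) x"
proof -
  have "partial_deriv \<kappa> (tensor_product r P Q \<nu>s) x
    = P (take r \<nu>s) x ** partial_deriv \<kappa> (Q (drop r \<nu>s)) x + partial_deriv \<kappa> (P (take r \<nu>s)) x ** Q (drop r \<nu>s) x"
    unfolding tensor_product_def[abs_def]
    by (intro partial_deriv_bounded_bilinear bounded_bilinear_matrix_mult smooth_tensor_differentiable assms)
  moreover have "act M (\<lambda>\<nu>s. tensor_product r P Q \<nu>s x) \<nu>s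
      = act M (\<lambda>\<nu>s. P \<nu>s x) (take r \<nu>s) ** Q (drop r \<nu>s) x + P (take r \<nu>s) x ** act M (\<lambda>\<nu>s. Q \<nu>s x) (drop r \<nu>s)" for M
    unfolding tensor_product_def using act_tensor_product[OF bilinear_matrix_mult, of M "\<lambda>\<nu>s. P \<nu>s x"] .
  ultimately show ?thesis
    by (simp add: gauge_covd_Cons matrix_mult_simps tensor_product_def bracket_derivation algebra_simps)
qed

lemma smooth_tensor_contract:
  assumes "smooth_tensor S T"
  shows "smooth_tensor S (contract_field g T)"
  using assms unfolding smooth_tensor_def contract_field_def[abs_def] contract_metric_def
  by (auto intro!: smooth_on_sum smooth_on_scaleR smooth_metric_inv open_S)

text \<open>The derivative of the inverse metric supplies exactly the Christoffel terms for the two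
  contracted slots, which are missing on the left.\<close>

lemma gauge_covd_contract:
  assumes T: "smooth_tensor S T" and x: "x \<in> S"
  shows "D (contract_field g T) (\<kappa> # \<nu>s) x
    = (\<Sum>\<alpha>\<in>UNIV. \<Sum>\<gamma>\<in>UNIV. matrix_inv (g x) $ \<alpha> $ \<gamma> *\<^sub>R D T (\<kappa> # \<alpha> # \<gamma> # \<nu>s) x)"
proof -
  let ?i = "matrix_inv (g x)"
  let ?C = "connection g x \<kappa>"
  have "partial_deriv \<kappa> (contract_field g T \<nu>s) x
      = (\<Sum>\<alpha>\<in>UNIV. \<Sum>\<gamma>\<in>UNIV. ?i $ \<alpha> $ \<gamma> *\<^sub>R partial_deriv \<kappa> (T (\<alpha> # \<gamma> # \<nu>s)) x
          + partial_deriv \<kappa> (\<lambda>y. matrix_inv (g y) $ \<alpha> $ \<gamma>) x *\<^sub>R T (\<alpha> # \<gamma> # \<nu>s) x)"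
    unfolding contract_field_def[abs_def] contract_metric_def
    by (subst partial_deriv_eqI[OF has_derivative_sum[OF has_derivative_sum[OF has_derivative_scaleR[OF
          smooth_on_has_derivative[OF smooth_metric_inv open_S x]
          smooth_on_has_derivative[OF smooth_tensorD[OF T] open_S x]]]]])
       (simp add: partial_deriv_def)
  moreover have "(\<Sum>\<alpha>\<in>UNIV. \<Sum>\<gamma>\<in>UNIV. partial_deriv \<kappa> (\<lambda>y. matrix_inv (g y) $ \<alpha> $ \<gamma>) x *\<^sub>R T (\<alpha> # \<gamma> # \<nu>s) x)
    = - (\<Sum>\<alpha>\<in>UNIV. \<Sum>\<gamma>\<in>UNIV. ?i $ \<alpha> $ \<gamma> *\<^sub>R (\<Sum>\<rho>\<in>UNIV. ?C \<rho> \<alpha> *\<^sub>R T (\<rho> # \<gamma> # \<nu>s) x))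
      - (\<Sum>\<alpha>\<in>UNIV. \<Sum>\<gamma>\<in>UNIV. ?i $ \<alpha> $ \<gamma> *\<^sub>R (\<Sum>\<rho>\<in>UNIV. ?C \<rho> \<gamma> *\<^sub>R T (\<alpha> # \<rho> # \<nu>s) x))"
  proof -
    have "(\<Sum>\<alpha>\<in>UNIV. \<Sum>\<gamma>\<in>UNIV. (\<Sum>\<rho>\<in>UNIV. ?C \<alpha> \<rho> * ?i $ \<rho> $ \<gamma>) *\<^sub>R T (\<alpha> # \<gamma> # \<nu>s) x)
        = (\<Sum>\<alpha>\<in>UNIV. \<Sum>\<gamma>\<in>UNIV. ?i $ \<alpha> $ \<gamma> *\<^sub>R (\<Sum>\<rho>\<in>UNIV. ?C \<rho> \<alpha> *\<^sub>R T (\<rho> # \<gamma> # \<nu>s) x))" (is "?L = ?R")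
    proof -
      have "?L = (\<Sum>\<alpha>\<in>UNIV. \<Sum>\<gamma>\<in>UNIV. \<Sum>\<rho>\<in>UNIV. (?C \<alpha> \<rho> * ?i $ \<rho> $ \<gamma>) *\<^sub>R T (\<alpha> # \<gamma> # \<nu>s) x)"
        by (simp add: scaleR_sum_left)
      also have "\<dots> = (\<Sum>\<alpha>\<in>UNIV. \<Sum>\<rho>\<in>UNIV. \<Sum>\<gamma>\<in>UNIV. (?C \<alpha> \<rho> * ?i $ \<rho> $ \<gamma>) *\<^sub>R T (\<alpha> # \<gamma> # \<nu>s) x)"
        by (intro sum.cong refl sum.swap)
      also have "\<dots> = (\<Sum>\<rho>\<in>UNIV. \<Sum>\<alpha>\<in>UNIV. \<Sum>\<gamma>\<in>UNIV. (?C \<alpha> \<rho> * ?i $ \<rho> $ \<gamma>) *\<^sub>R T (\<alpha> # \<gamma> # \<nu>s) x)"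
        by (rule sum.swap)
      also have "\<dots> = (\<Sum>\<rho>\<in>UNIV. \<Sum>\<gamma>\<in>UNIV. \<Sum>\<alpha>\<in>UNIV. (?C \<alpha> \<rho> * ?i $ \<rho> $ \<gamma>) *\<^sub>R T (\<alpha> # \<gamma> # \<nu>s) x)"
        by (intro sum.cong refl sum.swap)
      finally show ?thesis by (simp add: scaleR_sum_right mult.commute)
    qed
    moreover have "(\<Sum>\<alpha>\<in>UNIV. \<Sum>\<gamma>\<in>UNIV. (\<Sum>\<rho>\<in>UNIV. ?C \<gamma> \<rho> * ?i $ \<alpha> $ \<rho>) *\<^sub>R T (\<alpha> # \<gamma> # \<nu>s) x)
        = (\<Sum>\<alpha>\<in>UNIV. \<Sum>\<gamma>\<in>UNIV. ?i $ \<alpha> $ \<gamma> *\<^sub>R (\<Sum>\<rho>\<in>UNIV. ?C \<rho> \<gamma> *\<^sub>R T (\<alpha> # \<rho> # \<nu>s) x))" (is "?L = ?R")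
    proof -
      have "?L = (\<Sum>\<alpha>\<in>UNIV. \<Sum>\<gamma>\<in>UNIV. \<Sum>\<rho>\<in>UNIV. (?C \<gamma> \<rho> * ?i $ \<alpha> $ \<rho>) *\<^sub>R T (\<alpha> # \<gamma> # \<nu>s) x)"
        by (simp add: scaleR_sum_left)
      also have "\<dots> = (\<Sum>\<alpha>\<in>UNIV. \<Sum>\<rho>\<in>UNIV. \<Sum>\<gamma>\<in>UNIV. (?C \<gamma> \<rho> * ?i $ \<alpha> $ \<rho>) *\<^sub>R T (\<alpha> # \<gamma> # \<nu>s) x)"
        by (intro sum.cong refl sum.swap)
      finally show ?thesis by (simp add: scaleR_sum_right mult.commute)
    qed
    ultimately show ?thesis
      by (simp add: metric_inv_compatible[OF x] connection_def scaleR_diff_left sum_subtractf sum_negf)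
  qed
  moreover have "act ?C (\<lambda>\<nu>s. contract_field g T \<nu>s x) \<nu>s
      = (\<Sum>\<alpha>\<in>UNIV. \<Sum>\<gamma>\<in>UNIV. ?i $ \<alpha> $ \<gamma> *\<^sub>R act ?C (\<lambda>\<nu>s. T (\<alpha> # \<gamma> # \<nu>s) x) \<nu>s)"
    by (simp add: contract_field_def contract_metric_def act_sum act_scaleR)
  moreover have "bracket (A \<kappa> x) (contract_field g T \<nu>s x)
      = (\<Sum>\<alpha>\<in>UNIV. \<Sum>\<gamma>\<in>UNIV. ?i $ \<alpha> $ \<gamma> *\<^sub>R bracket (A \<kappa> x) (T (\<alpha> # \<gamma> # \<nu>s) x))"
    by (simp add: contract_field_def contract_metric_def linear_sum[OF linear_bracket(1)] bracket_simps)
  ultimately show ?thesis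
    by (simp add: gauge_covd_Cons act_Cons scaleR_add_right scaleR_diff_right sum.distrib sum_subtractf)
qed

text \<open>By the Leibniz rule for the evaluation of \<open>T\<close> on vector fields.\<close>

lemma ev_gauge_covd_eq_0:
  assumes x: "x \<in> S" and T: "smooth_tensor S T" and Ys: "\<forall>Y\<in>set Ys. Y differentiable (at x)"
    and 0: "\<And>y. y \<in> S \<Longrightarrow> ev (map (\<lambda>Y. Y y) Ys) (\<lambda>\<mu>s. T \<mu>s y) = 0"
    and nabla: "\<And>i. i < length Ys \<Longrightarrow> ev ((map (\<lambda>Y. Y x) Ys)[i := nabla_vec g X (Ys ! i) x]) (\<lambda>\<mu>s. T \<mu>s x) = 0"
  shows "ev (X # map (\<lambda>Y. Y x) Ys) (\<lambda>\<mu>s. D T \<mu>s x) = 0"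
proof -
  let ?E = "\<lambda>y. ev (map (\<lambda>Y. Y y) Ys) (\<lambda>\<mu>s. T \<mu>s y)"
  let ?AX = "\<Sum>\<kappa>\<in>UNIV. X $ \<kappa> *\<^sub>R A \<kappa> x"
  have "(?E has_derivative (\<lambda>X. 0)) (at x)"
    by (rule has_derivative_transform_within_open[OF has_derivative_const open_S x]) (simp add: 0)
  then have "frechet_derivative ?E (at x) X = 0"
    by (simp add: frechet_derivative_at[symmetric])
  with frechet_derivative_ev[OF x T Ys, of X] nabla
  have "ev (X # map (\<lambda>Y. Y x) Ys) (\<lambda>\<mu>s. covd g T \<mu>s x) = 0" by simp
  moreover have "slot X (\<lambda>\<mu>s. D T \<mu>s x) \<nu>s = slot X (\<lambda>\<mu>s. covd g T \<mu>s x) \<nu>s + bracket ?AX (T \<nu>s x)" for \<nu>s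
    by (simp add: slot_def gauge_covd_def bracket_def[symmetric] scaleR_diff_right sum_subtractf
        linear_sum[OF linear_bracket(2)] linear_scale[OF linear_bracket(2)] del: covd.simps)
       (simp add: bracket_def sum_negf)
  then have "slot X (\<lambda>\<mu>s. D T \<mu>s x) = (\<lambda>\<nu>s. slot X (\<lambda>\<mu>s. covd g T \<mu>s x) \<nu>s + bracket ?AX (T \<nu>s x))"
    by (rule ext)
  ultimately show ?thesis
    by (simp add: ev_add ev_linear_image[OF linear_bracket(1)] 0[OF x] linear_0[OF linear_bracket(1)])
qed

section \<open>The Ricci and Bianchi identities for gauge fields\<close>

lemma partial_deriv_act:
  assumes "\<And>\<rho> \<nu>. M \<rho> \<nu> differentiable (at x)" "\<And>\<mu>s. T \<mu>s differentiable (at x)"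
  shows "partial_deriv \<kappa> (\<lambda>y. act (\<lambda>\<rho> \<nu>. M \<rho> \<nu> y) (\<lambda>\<mu>s. T \<mu>s y) \<nu>s) x
    = act (\<lambda>\<rho> \<nu>. partial_deriv \<kappa> (M \<rho> \<nu>) x) (\<lambda>\<mu>s. T \<mu>s x) \<nu>s
      + act (\<lambda>\<rho> \<nu>. M \<rho> \<nu> x) (\<lambda>\<mu>s. partial_deriv \<kappa> (T \<mu>s) x) \<nu>s"
  unfolding act_def
  by (subst partial_deriv_eqI[OF has_derivative_sum[OF has_derivative_sum[OF has_derivative_scaleR[OF
        assms(1)[unfolded frechet_derivative_works] assms(2)[unfolded frechet_derivative_works]]]]])
     (simp add: partial_deriv_def sum.distrib)

text \<open>The Christoffel symbols are symmetric and drop out of the antisymmetrised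
  derivative.\<close>

lemma field_strength_eq:
  assumes "x \<in> S"
  shows "F [\<kappa>, \<eta>] x = partial_deriv \<kappa> (A \<eta>) x - partial_deriv \<eta> (A \<kappa>) x + bracket (A \<kappa> x) (A \<eta> x)"
  by (simp add: field_strength_def Let_def covd_Cons act_Cons connection_def christoffel_sym[OF assms, of _ \<kappa> \<eta>]
      bracket_def del: covd.simps)

lemma field_strength_antisym: "F [\<kappa>, \<eta>] x = - F [\<eta>, \<kappa>] x"
  by (simp add: field_strength_def Let_def commutator_def linear_diff[OF linear_cscale] del: covd.simps)

lemma smooth_field_strength: "smooth_tensor S F"
proof -
  have "smooth_tensor S (\<lambda>\<nu>s. A (hd \<nu>s))" by (simp add: smooth_tensor_def smooth_A)
  note * = smooth_tensorD[OF smooth_tensor_covd[OF this]]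
  have "F \<mu>s = (\<lambda>x. covd g (\<lambda>\<nu>s. A (hd \<nu>s)) [\<mu>s ! 0, \<mu>s ! 1] x - covd g (\<lambda>\<nu>s. A (hd \<nu>s)) [\<mu>s ! 1, \<mu>s ! 0] x
       + bracket (A (\<mu>s ! 0) x) (A (\<mu>s ! 1) x))" for \<mu>s
    by (simp add: fun_eq_iff field_strength_def Let_def bracket_def del: covd.simps)
  then show ?thesis
    unfolding smooth_tensor_def
    by (auto intro!: smooth_on_add smooth_on_diff open_S * smooth_A smooth_on_bounded_bilinear[OF _ bounded_bilinear_bracket]
        simp del: covd.simps)
qed

text \<open>In the difference the second derivatives of \<open>T\<close> cancel by Clairaut's
  theorem, the terms with one derivative of \<open>T\<close> by their symmetry in \<kappa> and
  \<eta>, and the connection on the new index by absence of torsion. What remains is dA + [A, A]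
  acting by the bracket and d\<Gamma> + [\<Gamma>, \<Gamma>] acting on lower indices, hence the
  minus sign.\<close>

lemma ricci_identity:
  assumes T: "smooth_tensor S T" and x: "x \<in> S"
  shows "D (D T) (\<kappa> # \<eta> # \<nu>s) x - D (D T) (\<eta> # \<kappa> # \<nu>s) x
    = bracket (F [\<kappa>, \<eta>] x) (T \<nu>s x) - act (\<lambda>\<rho> \<sigma>. riemann_up g x \<rho> \<sigma> \<kappa> \<eta>) (\<lambda>\<mu>s. T \<mu>s x) \<nu>s"
proof -
  let ?C = "connection g x"
  let ?T = "\<lambda>\<mu>s. T \<mu>s x"
  let ?dC = "\<lambda>\<kappa> \<eta> \<rho> \<nu>. partial_deriv \<kappa> (\<lambda>y. christoffel g y \<rho> \<eta> \<nu>) x"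
  have diff: "T \<mu>s differentiable (at x)" "partial_deriv \<eta> (T \<mu>s) differentiable (at x)" for \<mu>s \<eta>
    using T smooth_on_differentiable[OF _ open_S x] smooth_on_partial_deriv smooth_tensorD by blast+
  have diffA: "A \<mu> differentiable (at x)" for \<mu>
    using smooth_on_differentiable[OF smooth_A open_S x] .
  have diffC: "(\<lambda>y. christoffel g y \<rho> \<mu> \<nu>) differentiable (at x)" for \<rho> \<mu> \<nu>
    using smooth_on_differentiable[OF smooth_christoffel open_S x] .
  \<comment> \<open>For arbitrary \<kappa> and \<eta>, so that the same expansion serves both orders
    of differentiation.\<close>
  have expand: "D (D T) (\<kappa> # \<eta> # \<nu>s) x =
      partial_deriv \<kappa> (partial_deriv \<eta> (T \<nu>s)) x - act (?dC \<kappa> \<eta>) ?T \<nu>s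
      - act (?C \<eta>) (\<lambda>\<mu>s. partial_deriv \<kappa> (T \<mu>s) x) \<nu>s
      + bracket (partial_deriv \<kappa> (A \<eta>) x) (T \<nu>s x) + bracket (A \<eta> x) (partial_deriv \<kappa> (T \<nu>s) x)
      - (\<Sum>\<rho>\<in>UNIV. christoffel g x \<rho> \<kappa> \<eta> *\<^sub>R D T (\<rho> # \<nu>s) x)
      - act (?C \<kappa>) (\<lambda>\<mu>s. partial_deriv \<eta> (T \<mu>s) x) \<nu>s + act (?C \<kappa>) (act (?C \<eta>) ?T) \<nu>s
      - bracket (A \<eta> x) (act (?C \<kappa>) ?T \<nu>s)
      + bracket (A \<kappa> x) (partial_deriv \<eta> (T \<nu>s) x) - bracket (A \<kappa> x) (act (?C \<eta>) ?T \<nu>s)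
      + bracket (A \<kappa> x) (bracket (A \<eta> x) (T \<nu>s x))" for \<kappa> \<eta>
  proof -
    have DT: "D T (\<eta> # \<mu>s) = (\<lambda>y. partial_deriv \<eta> (T \<mu>s) y
        - act (\<lambda>\<rho> \<nu>. christoffel g y \<rho> \<eta> \<nu>) (\<lambda>\<mu>s. T \<mu>s y) \<mu>s + bracket (A \<eta> y) (T \<mu>s y))" for \<mu>s
      by (simp add: fun_eq_iff gauge_covd_Cons connection_def[abs_def])
    have d_act: "(\<lambda>y. act (\<lambda>\<rho> \<nu>. christoffel g y \<rho> \<eta> \<nu>) (\<lambda>\<mu>s. T \<mu>s y) \<nu>s) differentiable (at x)"
      unfolding act_def by (intro differentiable_sum differentiable_scaleR ballI diff diffC finite) auto
    have d_br: "(\<lambda>y. bracket (A \<eta> y) (T \<nu>s y)) differentiable (at x)"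
      by (rule differentiable_bounded_bilinear[OF bounded_bilinear_bracket diffA diff(1)])
    have "partial_deriv \<kappa> (D T (\<eta> # \<nu>s)) x = partial_deriv \<kappa> (partial_deriv \<eta> (T \<nu>s)) x
        - partial_deriv \<kappa> (\<lambda>y. act (\<lambda>\<rho> \<nu>. christoffel g y \<rho> \<eta> \<nu>) (\<lambda>\<mu>s. T \<mu>s y) \<nu>s) x
        + partial_deriv \<kappa> (\<lambda>y. bracket (A \<eta> y) (T \<nu>s y)) x"
      unfolding DT
      by (subst partial_deriv_eqI[OF has_derivative_add[OF has_derivative_diff[OF
            diff(2)[unfolded frechet_derivative_works] d_act[unfolded frechet_derivative_works]] d_br[unfolded frechet_derivative_works]]])
         (simp add: partial_deriv_def)
    also have "\<dots> = partial_deriv \<kappa> (partial_deriv \<eta> (T \<nu>s)) x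
        - (act (?dC \<kappa> \<eta>) ?T \<nu>s + act (?C \<eta>) (\<lambda>\<mu>s. partial_deriv \<kappa> (T \<mu>s) x) \<nu>s)
        + (bracket (A \<eta> x) (partial_deriv \<kappa> (T \<nu>s) x) + bracket (partial_deriv \<kappa> (A \<eta>) x) (T \<nu>s x))"
      by (subst partial_deriv_act[OF diffC diff(1)], subst partial_deriv_bounded_bilinear[OF bounded_bilinear_bracket diffA diff(1)])
         (simp add: connection_def[abs_def])
    finally have 1: "partial_deriv \<kappa> (D T (\<eta> # \<nu>s)) x = \<dots>" .
    have 2: "act (?C \<kappa>) (\<lambda>\<mu>s. D T \<mu>s x) (\<eta> # \<nu>s) =
        (\<Sum>\<rho>\<in>UNIV. christoffel g x \<rho> \<kappa> \<eta> *\<^sub>R D T (\<rho> # \<nu>s) x)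
        + (act (?C \<kappa>) (\<lambda>\<mu>s. partial_deriv \<eta> (T \<mu>s) x) \<nu>s - act (?C \<kappa>) (act (?C \<eta>) ?T) \<nu>s
        + bracket (A \<eta> x) (act (?C \<kappa>) ?T \<nu>s))"
      unfolding act_Cons by (simp add: gauge_covd_Cons[of g A T \<eta>] act_add act_diff act_linear_image[OF linear_bracket(1)] connection_def)
    show ?thesis
      unfolding gauge_covd_Cons[of g A "D T"] 1 2 gauge_covd_Cons[of g A T \<eta>] bracket_simps by simp
  qed
  \<comment> \<open>The order reversal in \<open>act_commutator\<close> gives the quadratic terms
    the sign they have in \<open>riemann_up\<close>.\<close>
  have riem: "act (?dC \<kappa> \<eta>) ?T \<nu>s - act (?dC \<eta> \<kappa>) ?T \<nu>s - (act (?C \<kappa>) (act (?C \<eta>) ?T) \<nu>s - act (?C \<eta>) (act (?C \<kappa>) ?T) \<nu>s)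
      = act (\<lambda>\<rho> \<sigma>. riemann_up g x \<rho> \<sigma> \<kappa> \<eta>) ?T \<nu>s"
    unfolding act_commutator act_matrix_diff[symmetric]
    by (simp add: riemann_up_def connection_def[abs_def] sum_subtractf algebra_simps)
  have "F [\<kappa>, \<eta>] x = partial_deriv \<kappa> (A \<eta>) x - partial_deriv \<eta> (A \<kappa>) x + bracket (A \<kappa> x) (A \<eta> x)"
    by (rule field_strength_eq[OF x])
  then have br: "bracket (F [\<kappa>, \<eta>] x) (T \<nu>s x) = bracket (partial_deriv \<kappa> (A \<eta>) x) (T \<nu>s x) - bracket (partial_deriv \<eta> (A \<kappa>) x) (T \<nu>s x)
     + (bracket (A \<kappa> x) (bracket (A \<eta> x) (T \<nu>s x)) - bracket (A \<eta> x) (bracket (A \<kappa> x) (T \<nu>s x)))"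
    by (simp add: bracket_simps bracket_jacobi)
  show ?thesis
    unfolding expand br riem[symmetric]
    using partial_deriv_commute[OF open_S smooth_tensorD[OF T] x, of \<kappa> \<eta> \<nu>s] christoffel_sym[OF x, of _ \<kappa> \<eta>]
    by simp
qed

text \<open>In the cyclic sum the second derivatives of A cancel by Clairaut's theorem, the
  Christoffel terms by their symmetry against the antisymmetry of F, the terms with one derivative
  of A by antisymmetry of the bracket, and the cubic terms by the Jacobi identity.\<close>

lemma bianchi_identity:
  assumes x: "x \<in> S"
  shows "D F [\<kappa>, \<eta>, \<mu>] x + D F [\<eta>, \<mu>, \<kappa>] x + D F [\<mu>, \<kappa>, \<eta>] x = 0"
proof -
  let ?G = "christoffel g x"
  let ?d = "\<lambda>\<kappa> \<eta>. partial_deriv \<kappa> (A \<eta>) x"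
  have diffA: "A \<mu> differentiable (at x)" "partial_deriv \<nu> (A \<mu>) differentiable (at x)" for \<mu> \<nu>
    using smooth_on_differentiable[OF _ open_S x] smooth_A smooth_on_partial_deriv by blast+
  have d_br: "(\<lambda>y. bracket (A \<eta> y) (A \<mu> y)) differentiable (at x)" for \<eta> \<mu>
    by (rule differentiable_bounded_bilinear[OF bounded_bilinear_bracket diffA(1) diffA(1)])
  have expand: "D F [\<kappa>, \<eta>, \<mu>] x = partial_deriv \<kappa> (partial_deriv \<eta> (A \<mu>)) x - partial_deriv \<kappa> (partial_deriv \<mu> (A \<eta>)) x
      + bracket (A \<eta> x) (?d \<kappa> \<mu>) + bracket (?d \<kappa> \<eta>) (A \<mu> x)
      - (\<Sum>\<rho>\<in>UNIV. ?G \<rho> \<kappa> \<eta> *\<^sub>R F [\<rho>, \<mu>] x) - (\<Sum>\<rho>\<in>UNIV. ?G \<rho> \<kappa> \<mu> *\<^sub>R F [\<eta>, \<rho>] x)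
      + (bracket (A \<kappa> x) (?d \<eta> \<mu>) - bracket (A \<kappa> x) (?d \<mu> \<eta>) + bracket (A \<kappa> x) (bracket (A \<eta> x) (A \<mu> x)))" for \<kappa> \<eta> \<mu>
  proof -
    have "partial_deriv \<kappa> (F [\<eta>, \<mu>]) x
        = partial_deriv \<kappa> (\<lambda>y. partial_deriv \<eta> (A \<mu>) y - partial_deriv \<mu> (A \<eta>) y + bracket (A \<eta> y) (A \<mu> y)) x"
      by (rule partial_deriv_cong_open[OF open_S x field_strength_eq])
    also have "\<dots> = partial_deriv \<kappa> (partial_deriv \<eta> (A \<mu>)) x - partial_deriv \<kappa> (partial_deriv \<mu> (A \<eta>)) x
        + partial_deriv \<kappa> (\<lambda>y. bracket (A \<eta> y) (A \<mu> y)) x"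
      by (subst partial_deriv_eqI[OF has_derivative_add[OF has_derivative_diff[OF
            diffA(2)[unfolded frechet_derivative_works] diffA(2)[unfolded frechet_derivative_works]] d_br[unfolded frechet_derivative_works]]])
         (simp add: partial_deriv_def)
    finally have "partial_deriv \<kappa> (F [\<eta>, \<mu>]) x = \<dots>" .
    then show ?thesis
      by (simp add: gauge_covd_Cons act_Cons connection_def field_strength_eq[OF x, of \<eta> \<mu>] bracket_simps
          partial_deriv_bounded_bilinear[OF bounded_bilinear_bracket diffA(1) diffA(1)])
  qed
  have sec: "partial_deriv \<kappa> (partial_deriv \<eta> (A \<mu>)) x = partial_deriv \<eta> (partial_deriv \<kappa> (A \<mu>)) x" for \<kappa> \<eta> \<mu>
    by (rule partial_deriv_commute[OF open_S smooth_A x])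
  have G: "(\<Sum>\<rho>\<in>UNIV. ?G \<rho> \<kappa> \<eta> *\<^sub>R F [\<mu>, \<rho>] x) = - (\<Sum>\<rho>\<in>UNIV. ?G \<rho> \<eta> \<kappa> *\<^sub>R F [\<rho>, \<mu>] x)" for \<kappa> \<eta> \<mu>
    by (simp add: field_strength_antisym[of \<mu>] sum_negf christoffel_sym[OF x, of _ \<kappa> \<eta>])
  have jac: "bracket (A \<kappa> x) (bracket (A \<eta> x) (A \<mu> x)) + bracket (A \<eta> x) (bracket (A \<mu> x) (A \<kappa> x))
      + bracket (A \<mu> x) (bracket (A \<kappa> x) (A \<eta> x)) = 0"
    using bracket_jacobi[of "A \<kappa> x" "A \<eta> x" "A \<mu> x"] bracket_antisym[of "A \<mu> x" "bracket (A \<kappa> x) (A \<eta> x)"]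
      bracket_antisym[of "A \<mu> x" "A \<kappa> x"] by (simp add: bracket_simps)
  show ?thesis
    unfolding expand G[of \<kappa> \<mu> \<eta>] G[of \<eta> \<kappa> \<mu>] G[of \<mu> \<eta> \<kappa>] sec[of \<kappa> \<eta> \<mu>] sec[of \<eta> \<mu> \<kappa>] sec[of \<mu> \<kappa> \<eta>]
    using jac bracket_antisym[of "?d \<kappa> \<eta>"] bracket_antisym[of "?d \<eta> \<mu>"] bracket_antisym[of "?d \<mu> \<kappa>"]
    by (simp add: algebra_simps)
qed

end

section \<open>Boost order of derivatives\<close>

lemma bracket_cscale:
  fixes X :: "complex^'N::finite^'N"
  shows "bracket X (cscale c Y) = cscale c (bracket X Y)"
proof -
  have "cscale \<i> (cscale c Z) = cscale c (cscale \<i> Z)" for Z :: "complex^'N^'N"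
    by (simp add: cscale_def vec_eq_iff mult.left_commute)
  then show ?thesis
    by (simp add: bracket_eq cscale_mult_left cscale_mult_right linear_diff[OF linear_cscale])
qed

lemma nabla_vec_scaleR:
  assumes "Y differentiable (at x)"
  shows "nabla_vec g X (\<lambda>y. c *\<^sub>R Y y) x = c *\<^sub>R nabla_vec g X Y x"
proof -
  have "frechet_derivative (\<lambda>y. c *\<^sub>R Y y) (at x) X = c *\<^sub>R frechet_derivative Y (at x) X"
    using frechet_derivative_at[OF has_derivative_scaleR_right[OF assms[unfolded frechet_derivative_works], of c]]
    by metis
  then show ?thesis
    by (simp add: nabla_vec_def apply_matrix_def vec_eq_iff scaleR_add_right sum_distrib_left mult.left_commute)
qed

lemma sum_list_update_int:
  fixes ws :: "int list"
  shows "i < length ws \<Longrightarrow> sum_list (ws[i := k]) = sum_list ws + k - ws ! i"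
proof (induction ws arbitrary: i)
  case (Cons w ws)
  then show ?case by (cases i) auto
qed simp

lemma nth_map_shift: "length us = p \<Longrightarrow> map ((!) (us @ vs)) ([0..<p] @ map ((+) p) \<sigma>) = us @ map ((!) vs) \<sigma>"
  by (auto intro!: nth_equalityI simp: nth_append)

lemma map_nth_upt_drop:
  "length us = m \<Longrightarrow> length us + length vs = n \<Longrightarrow> map ((!) (us @ vs)) [m..<n] = vs"
  by (auto intro!: nth_equalityI simp: nth_append)

lemma perm_listI:
  assumes "set \<sigma> = {..<length \<sigma>}"
  shows "perm_list \<sigma>"
  using assms card_distinct[of \<sigma>] by (simp add: perm_list_def)

text \<open>\<open>nabla_l\<close> is what geodesy and the vanishing of expansion, shear and twist amount to.\<close>

locale kundt_chart = gauge_chart g S A for g :: "'n::finite metric" and S and A :: "('n, 'N::finite) potential" +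
  fixes l :: "real^'n \<Rightarrow> real^'n"
  assumes card2: "CARD('n) \<ge> 2"
    and smooth_l: "smooth_on l S"
    and null_l: "x \<in> S \<Longrightarrow> metric_form (g x) (l x) (l x) = 0"
    and nabla_l: "x \<in> S \<Longrightarrow> metric_form (g x) (l x) X = 0 \<Longrightarrow> \<exists>c. nabla_vec g X l x = c *\<^sub>R l x"
    and frame: "x \<in> S \<Longrightarrow> \<exists>e. null_frame (g x) e \<and> e 0 = l x"
    and order_field_strength: "x \<in> S \<Longrightarrow> boost_order_le (g x) (l x) (-1) 2 (\<lambda>\<mu>s. field_strength g A \<mu>s x)"
    and order_riemann: "x \<in> S \<Longrightarrow> boost_order_le (g x) (l x) 0 (k + 4) (\<lambda>\<mu>s. (covd g ^^ k) (riemann g) \<mu>s x)"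
begin

abbreviation "filt x \<equiv> in_boost_filtration (g x) (l x)"

lemma null_frame_atI: "x \<in> S \<Longrightarrow> null_frame (g x) e \<Longrightarrow> null_frame_at (g x) e"
  by (simp add: null_frame_at_def metric_sym card2)

lemma differentiable_l: "x \<in> S \<Longrightarrow> l differentiable (at x)"
  by (rule smooth_on_differentiable[OF smooth_l open_S])

lemma smooth_metric_form:
  assumes "smooth_on Y S" "smooth_on Z S"
  shows "smooth_on (\<lambda>y. metric_form (g y) (Y y) (Z y)) S"
  unfolding metric_form_eq_sum
  by (intro smooth_on_sum smooth_on_mult smooth_on_vec_nth smooth_metric open_S assms)

lemma metric_form_l_nabla:
  assumes "x \<in> S" "Y differentiable (at x)" "\<And>y. y \<in> S \<Longrightarrow> metric_form (g y) (l y) (Y y) = 0"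
  shows "metric_form (g x) (l x) (nabla_vec g X Y x) = - metric_form (g x) (nabla_vec g X l x) (Y x)"
  using frechet_derivative_metric_form[OF assms(1) differentiable_l[OF assms(1)] assms(2), of X]
    frechet_derivative_eq_0[OF open_S assms(1), of "\<lambda>y. metric_form (g y) (l y) (Y y)"] assms(3) by simp

text \<open>A constant field serves for weight -1, where nothing is demanded. A field orthogonal to
  \<open>l\<close> everywhere has g(l, nabla_X Y) = - g(nabla_X l, Y), which is 0 by
  \<open>nabla_l\<close> if \<open>X\<close> is orthogonal to \<open>l\<close>. For a constant
  multiple of \<open>l\<close>, \<open>nabla_l\<close> keeps nabla_X l in the span if u = 0, and
  nullness of \<open>l\<close> makes it orthogonal to \<open>l\<close> if u = -1.\<close>

lemma adapted_extension:
  assumes x: "x \<in> S" and v: "filt x v w"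
  shows "\<exists>Y. Y differentiable (at x) \<and> Y x = v \<and> (\<forall>y\<in>S. filt y (Y y) w) \<and>
    (\<forall>u X. u \<le> 0 \<longrightarrow> filt x X u \<longrightarrow> filt x (nabla_vec g X Y x) (w + u))"
proof -
  consider "w \<le> -1" | "w = 0" "metric_form (g x) (l x) v = 0" | c where "w = 1" "v = c *\<^sub>R l x"
    using v by (auto simp: in_boost_filtration_def)
  then show ?thesis
  proof cases
    case 1
    then show ?thesis
      by (intro exI[of _ "\<lambda>y. v"]) (auto simp: in_boost_filtration_def)
  next
    case 2
    obtain e where "null_frame (g x) e" "e 0 = l x" using frame[OF x] by blast
    then have n: "metric_form (g x) (l x) (e 1) = 1" by (simp add: null_frame_def)
    \<comment> \<open>The vector \<open>e 1\<close> is constant and satisfies g(l, e 1) = 1 at x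
      only. Multiplying by g(l, e 1) rather than dividing by it makes \<open>Y\<close> orthogonal to
      \<open>l\<close> on all of \<open>S\<close>, even where this product vanishes.\<close>
    define Y where "Y y = metric_form (g y) (l y) (e 1) *\<^sub>R v - metric_form (g y) (l y) v *\<^sub>R e 1" for y
    have "smooth_on Y S"
      unfolding Y_def
      by (intro smooth_on_diff smooth_on_scaleR smooth_metric_form smooth_l smooth_on_const open_S)
    then have d: "Y differentiable (at x)" by (rule smooth_on_differentiable[OF _ open_S x])
    have l: "metric_form (g y) (l y) (Y y) = 0" for y
      by (simp add: Y_def metric_form_diff_right metric_form_scaleR_right)
    have Yx: "Y x = v" using n 2 by (simp add: Y_def)
    have "filt x (nabla_vec g X Y x) (w + u)" if "u \<le> 0" "filt x X u" for u X
    proof (cases "u = 0")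
      case True
      then have "metric_form (g x) (l x) X = 0" using that by (auto simp: in_boost_filtration_def)
      from nabla_l[OF x this] obtain c where "nabla_vec g X l x = c *\<^sub>R l x" by blast
      then have "metric_form (g x) (l x) (nabla_vec g X Y x) = 0"
        using metric_form_l_nabla[OF x d l] by (simp add: metric_form_scaleR_left l)
      then show ?thesis using True 2 by (simp add: in_boost_filtration_def)
    next
      case False
      then show ?thesis using that 2 by (simp add: in_boost_filtration_def)
    qed
    then show ?thesis
      using d l Yx 2 by (intro exI[of _ Y]) (auto simp: in_boost_filtration_def)
  next
    case 3
    have "filt x (nabla_vec g X (\<lambda>y. c *\<^sub>R l y) x) (w + u)" if u: "u \<le> 0" "filt x X u" for u X
    proof -
      note n = nabla_vec_scaleR[OF differentiable_l[OF x], of g X c]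
      consider "u = 0" "metric_form (g x) (l x) X = 0" | "u = -1" | "u \<le> -2"
        using u by (auto simp: in_boost_filtration_def) linarith
      then show ?thesis
      proof cases
        case 1
        then obtain c' where "nabla_vec g X l x = c' *\<^sub>R l x" using nabla_l[OF x] by blast
        then show ?thesis using 1 3 by (auto simp: in_boost_filtration_def n)
      next
        case 2
        then show ?thesis
          using 3 nabla_null_orthogonal[OF x smooth_l null_l] by (simp add: in_boost_filtration_def n metric_form_scaleR_right)
      next
        case low: 3
        then show ?thesis using 3 by (simp add: in_boost_filtration_def)
      qed
    qed
    then show ?thesis
      using 3 differentiable_l[OF x]
      by (intro exI[of _ "\<lambda>y. c *\<^sub>R l y"]) (auto simp: in_boost_filtration_def)
  qed
qed

lemma adapted_extensions:
  assumes x: "x \<in> S" and "list_all2 (filt x) vs ws"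
  shows "\<exists>Ys. map (\<lambda>Y. Y x) Ys = vs \<and> (\<forall>Y\<in>set Ys. Y differentiable (at x)) \<and>
    (\<forall>y\<in>S. list_all2 (\<lambda>Y. filt y (Y y)) Ys ws) \<and>
    list_all2 (\<lambda>Y w. \<forall>u X. u \<le> 0 \<longrightarrow> filt x X u \<longrightarrow> filt x (nabla_vec g X Y x) (w + u)) Ys ws"
  using assms(2)
proof (induction vs ws rule: list_all2_induct)
  case (Cons v vs w ws)
  from adapted_extension[OF x Cons.hyps(1)] obtain Y where Y: "Y differentiable (at x)" "Y x = v" "\<forall>y\<in>S. filt y (Y y) w"
    "\<forall>u X. u \<le> 0 \<longrightarrow> filt x X u \<longrightarrow> filt x (nabla_vec g X Y x) (w + u)" by blast
  from Cons.IH obtain Ys where "map (\<lambda>Y. Y x) Ys = vs" "\<forall>Y\<in>set Ys. Y differentiable (at x)"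
    "\<forall>y\<in>S. list_all2 (\<lambda>Y. filt y (Y y)) Ys ws"
    "list_all2 (\<lambda>Y w. \<forall>u X. u \<le> 0 \<longrightarrow> filt x X u \<longrightarrow> filt x (nabla_vec g X Y x) (w + u)) Ys ws" by blast
  then show ?case
    using Y by (intro exI[of _ "Y # Ys"]) auto
qed simp

text \<open>On fields extending the arguments with constant weights, \<open>T\<close> vanishes
  throughout \<open>S\<close>, since u \<le> 0 gives \<open>sum_list ws > b\<close>. Replacing one
  field by its derivative along \<open>X\<close> changes the total weight by u, and
  \<open>u + sum_list ws\<close> still exceeds b. The Leibniz rule then leaves nothing but the
  derivative of \<open>T\<close>.\<close>

lemma ev_gauge_covd_nonpositive:
  assumes T: "smooth_tensor S T" "\<And>y. y \<in> S \<Longrightarrow> boost_order_le (g y) (l y) b r (\<lambda>\<mu>s. T \<mu>s y)"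
    and x: "x \<in> S" and X: "filt x X u" "u \<le> 0"
    and vs: "length vs = r" "list_all2 (filt x) vs ws" "u + sum_list ws > b"
  shows "ev (X # vs) (\<lambda>\<mu>s. D T \<mu>s x) = 0"
proof -
  obtain Ys where Ys: "map (\<lambda>Y. Y x) Ys = vs" "\<forall>Y\<in>set Ys. Y differentiable (at x)"
    and filt: "\<And>y. y \<in> S \<Longrightarrow> list_all2 (\<lambda>Y. filt y (Y y)) Ys ws"
    and nab: "list_all2 (\<lambda>Y w. \<forall>u X. u \<le> 0 \<longrightarrow> filt x X u \<longrightarrow> filt x (nabla_vec g X Y x) (w + u)) Ys ws"
    using adapted_extensions[OF x vs(2)] by blast
  have len: "length Ys = r" using Ys(1) vs(1) by auto
  have lenw: "length ws = r" using vs(1,2) list_all2_lengthD by fastforce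
  have "ev (X # map (\<lambda>Y. Y x) Ys) (\<lambda>\<mu>s. D T \<mu>s x) = 0"
  proof (rule ev_gauge_covd_eq_0[OF x T(1) Ys(2)])
    fix y assume y: "y \<in> S"
    show "ev (map (\<lambda>Y. Y y) Ys) (\<lambda>\<mu>s. T \<mu>s y) = 0"
      by (rule boost_order_leD[OF T(2)[OF y], where ws = ws])
         (use filt[OF y] vs(3) X(2) len in \<open>simp_all add: list.rel_map\<close>)
  next
    fix i assume i: "i < length Ys"
    have "list_all2 (filt x) (vs[i := nabla_vec g X (Ys ! i) x]) (ws[i := ws ! i + u])"
      using list_all2_nthD[OF nab i] X by (intro list_all2_update_cong vs(2)) auto
    then have "ev (vs[i := nabla_vec g X (Ys ! i) x]) (\<lambda>\<mu>s. T \<mu>s x) = 0"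
      by (rule boost_order_leD[OF T(2)[OF x], rotated])
         (use vs i len lenw in \<open>simp_all add: sum_list_update_int\<close>)
    then show "ev ((map (\<lambda>Y. Y x) Ys)[i := nabla_vec g X (Ys ! i) x]) (\<lambda>\<mu>s. T \<mu>s x) = 0"
      by (simp add: Ys(1))
  qed
  then show ?thesis by (simp add: Ys(1))
qed

section \<open>Tensor fields whose derivatives have bounded boost order\<close>

text \<open>The bound is the same for all derivatives up to the i-th. Such bounds survive products
  and contractions by the Leibniz rule, whereas a bound on \<open>T\<close> alone does not pass to
  \<open>D T\<close> in the direction of \<open>l\<close>.\<close>

definition order_upto :: "nat \<Rightarrow> int \<Rightarrow> nat \<Rightarrow> ('n, complex^'N^'N) tensor_field \<Rightarrow> bool" where
  "order_upto i b r T \<longleftrightarrow> (\<forall>a\<le>i. \<forall>x\<in>S. boost_order_le (g x) (l x) b (r + a) (\<lambda>\<mu>s. (D ^^ a) T \<mu>s x))"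

lemma order_upto_0: "order_upto 0 b r T \<longleftrightarrow> (\<forall>x\<in>S. boost_order_le (g x) (l x) b r (\<lambda>\<mu>s. T \<mu>s x))"
  by (simp add: order_upto_def)

text \<open>The recursion strips the innermost derivative. As \<open>D\<close> of a sum,
  rearrangement, product or contraction is again built in the same way from \<open>T\<close> and
  \<open>D T\<close>, each closure property follows by induction on i with \<open>T\<close>
  arbitrary.\<close>

lemma order_upto_Suc:
  "order_upto (Suc i) b r T \<longleftrightarrow>
    (\<forall>x\<in>S. boost_order_le (g x) (l x) b r (\<lambda>\<mu>s. T \<mu>s x)) \<and> order_upto i b (Suc r) (D T)" (is "?L \<longleftrightarrow> ?R")
proof
  assume L: ?L
  have "boost_order_le (g x) (l x) b (Suc r + a) (\<lambda>\<mu>s. (D ^^ a) (D T) \<mu>s x)" if "a \<le> i" "x \<in> S" for a x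
    using L[unfolded order_upto_def, rule_format, of "Suc a" x] that by (simp add: funpow_swap1)
  moreover have "boost_order_le (g x) (l x) b r (\<lambda>\<mu>s. T \<mu>s x)" if "x \<in> S" for x
    using L[unfolded order_upto_def, rule_format, of 0 x] that by simp
  ultimately show ?R by (simp add: order_upto_def)
next
  assume R: ?R
  show ?L unfolding order_upto_def
  proof (intro allI impI ballI)
    fix a x assume "a \<le> Suc i" "x \<in> S"
    then show "boost_order_le (g x) (l x) b (r + a) (\<lambda>\<mu>s. (D ^^ a) T \<mu>s x)"
      using R by (cases a) (auto simp: order_upto_def funpow_swap1)
  qed
qed

lemma order_upto_mono: "order_upto i b r T \<Longrightarrow> b \<le> b' \<Longrightarrow> order_upto i b' r T"
  unfolding order_upto_def using boost_order_le_mono by blast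

lemma order_upto_cong:
  assumes "\<And>\<mu>s x. length \<mu>s = r \<Longrightarrow> x \<in> S \<Longrightarrow> T \<mu>s x = T' \<mu>s x" "order_upto i b r T"
  shows "order_upto i b r T'"
  unfolding order_upto_def
proof (intro allI impI ballI)
  fix a x assume a: "a \<le> i" "x \<in> S"
  show "boost_order_le (g x) (l x) b (r + a) (\<lambda>\<mu>s. (D ^^ a) T' \<mu>s x)"
    by (rule boost_order_le_cong[OF gauge_covd_pow_cong[OF assms(1)]]) (use a assms(2) in \<open>auto simp: order_upto_def\<close>)
qed

lemma order_upto_add:
  assumes "smooth_tensor S T" "smooth_tensor S T'" "order_upto i b r T" "order_upto i b r T'"
  shows "order_upto i b r (\<lambda>\<mu>s x. T \<mu>s x + T' \<mu>s x)"
  using assms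
proof (induction i arbitrary: r T T')
  case 0
  then show ?case by (simp add: order_upto_0 boost_order_le_add)
next
  case (Suc i)
  have "order_upto i b (Suc r) (\<lambda>\<mu>s x. D T \<mu>s x + D T' \<mu>s x)"
    using Suc.prems by (intro Suc.IH smooth_tensor_gauge_covd) (auto simp: order_upto_Suc)
  then have "order_upto i b (Suc r) (D (\<lambda>\<mu>s x. T \<mu>s x + T' \<mu>s x))"
    by (rule order_upto_cong[rotated]) (subst gauge_covd_add[OF Suc.prems(1,2)], auto)
  then show ?case using Suc.prems by (auto simp: order_upto_Suc boost_order_le_add)
qed

lemma smooth_tensor_add: "smooth_tensor S T \<Longrightarrow> smooth_tensor S T' \<Longrightarrow> smooth_tensor S (\<lambda>\<mu>s x. T \<mu>s x + T' \<mu>s x)"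
  unfolding smooth_tensor_def by (auto intro: smooth_on_add open_S)

lemma bounded_linear_cscale: "bounded_linear (cscale c :: complex^'N^'N \<Rightarrow> complex^'N^'N)"
  using linear_cscale linear_conv_bounded_linear by blast

lemma smooth_tensor_cscale: "smooth_tensor S T \<Longrightarrow> smooth_tensor S (\<lambda>\<mu>s x. cscale c (T \<mu>s x :: complex^'N^'N))"
  unfolding smooth_tensor_def by (auto intro: smooth_on_bounded_linear open_S bounded_linear_cscale)

lemma gauge_covd_cscale:
  assumes "smooth_tensor S T" "x \<in> S" "\<mu>s \<noteq> []"
  shows "D (\<lambda>\<mu>s x. cscale c (T \<mu>s x)) \<mu>s x = cscale c (D T \<mu>s x)"
  using assms(3) partial_deriv_bounded_linear[OF bounded_linear_cscale smooth_tensor_differentiable[OF assms(1,2)]]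
  by (cases \<mu>s) (simp_all add: gauge_covd_Cons act_linear_image[OF linear_cscale] bracket_cscale
      linear_add[OF linear_cscale] linear_diff[OF linear_cscale])

lemma order_upto_cscale:
  assumes "smooth_tensor S T" "order_upto i b r T"
  shows "order_upto i b r (\<lambda>\<mu>s x. cscale c (T \<mu>s x))"
  using assms
proof (induction i arbitrary: r T)
  case 0
  then show ?case by (simp add: order_upto_0 boost_order_le_linear_image[OF linear_cscale])
next
  case (Suc i)
  have "order_upto i b (Suc r) (\<lambda>\<mu>s x. cscale c (D T \<mu>s x))"
    using Suc.prems by (intro Suc.IH smooth_tensor_gauge_covd) (auto simp: order_upto_Suc)
  then have "order_upto i b (Suc r) (D (\<lambda>\<mu>s x. cscale c (T \<mu>s x)))"
    by (rule order_upto_cong[rotated]) (subst gauge_covd_cscale[OF Suc.prems(1)], auto)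
  then show ?case using Suc.prems by (auto simp: order_upto_Suc boost_order_le_linear_image[OF linear_cscale])
qed

lemma uminus_eq_cscale: "- X = cscale (-1) X"
  by (simp add: cscale_def vec_eq_iff)

lemma order_upto_diff:
  assumes "smooth_tensor S T" "smooth_tensor S T'" "order_upto i b r T" "order_upto i b r T'"
  shows "order_upto i b r (\<lambda>\<mu>s x. T \<mu>s x - T' \<mu>s x)"
  using order_upto_add[OF assms(1) smooth_tensor_cscale[OF assms(2), of "-1"] assms(3) order_upto_cscale[OF assms(2,4), of "-1"]]
  by (simp flip: uminus_eq_cscale)

lemma smooth_tensor_zero: "smooth_tensor S (\<lambda>\<mu>s x. 0)"
  unfolding smooth_tensor_def by auto

lemma order_upto_zero: "order_upto i b r (\<lambda>\<mu>s x. 0)"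
proof (induction i arbitrary: r)
  case (Suc i)
  have "D (\<lambda>\<mu>s x. 0) = (\<lambda>\<mu>s x. 0)"
  proof (intro ext)
    fix \<mu>s x show "D (\<lambda>\<mu>s x. 0) \<mu>s x = 0"
      by (cases \<mu>s) (simp_all add: gauge_covd_def commutator_def cscale_def vec_eq_iff matrix_matrix_mult_def)
  qed
  with Suc show ?case by (simp add: order_upto_Suc boost_order_le_zero)
qed (simp add: order_upto_0 boost_order_le_zero)

lemma order_upto_sum:
  assumes "finite I" "\<And>i. i \<in> I \<Longrightarrow> smooth_tensor S (T i)" "\<And>i. i \<in> I \<Longrightarrow> order_upto n b r (T i)"
  shows "order_upto n b r (\<lambda>\<mu>s x. \<Sum>i\<in>I. T i \<mu>s x) \<and> smooth_tensor S (\<lambda>\<mu>s x. \<Sum>i\<in>I. T i \<mu>s x)"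
  using assms
  by (induction I rule: finite_induct) (auto simp: order_upto_zero smooth_tensor_zero intro!: order_upto_add smooth_tensor_add)

lemma smooth_tensor_rearrange: "smooth_tensor S T \<Longrightarrow> smooth_tensor S (rearrange \<sigma> T)"
  by (simp add: smooth_tensor_def rearrange_def)

lemma boost_order_le_rearrange_field:
  assumes "perm_list \<sigma>" "length \<sigma> = r" "boost_order_le h l' b r (\<lambda>\<mu>s. T \<mu>s x)"
  shows "boost_order_le h l' b r (\<lambda>\<mu>s. rearrange \<sigma> T \<mu>s x)"
  using boost_order_le_rearrange[OF assms] by (simp add: rearrange_def[abs_def])

lemma order_upto_rearrange:
  assumes "perm_list \<sigma>" "length \<sigma> = r" "order_upto i b r T"
  shows "order_upto i b r (rearrange \<sigma> T)"
  using assms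
proof (induction i arbitrary: r \<sigma> T)
  case 0
  then show ?case by (auto simp: order_upto_0 intro: boost_order_le_rearrange_field)
next
  case (Suc i)
  have "order_upto i b (Suc r) (rearrange (0 # map Suc \<sigma>) (D T))"
    using Suc.prems by (intro Suc.IH perm_list_Cons_Suc) (auto simp: order_upto_Suc)
  then have "order_upto i b (Suc r) (D (rearrange \<sigma> T))"
    by (rule order_upto_cong[rotated])
       (use gauge_covd_rearrange[OF Suc.prems(1)] Suc.prems(2) in \<open>auto simp: length_Suc_conv\<close>)
  then show ?case using Suc.prems by (auto simp: order_upto_Suc intro: boost_order_le_rearrange_field)
qed

lemma order_upto_tensor_product:
  assumes "smooth_tensor S P" "smooth_tensor S Q" "order_upto i b r P" "order_upto i b' s Q"
  shows "order_upto i (b + b') (r + s) (tensor_product r P Q)"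
  using assms
proof (induction i arbitrary: r s P Q)
  case 0
  then show ?case
    by (auto simp: order_upto_0 tensor_product_def intro!: boost_order_le_tensor_product[OF bilinear_matrix_mult])
next
  case (Suc i)
  \<comment> \<open>When the derivative falls on \<open>Q\<close>, its index has to be moved from
    the front to behind the r indices of \<open>P\<close>.\<close>
  let ?\<sigma> = "[1..<Suc r] @ 0 # [Suc r..<Suc (r + s)]"
  note DP = smooth_tensor_gauge_covd[OF Suc.prems(1)] and DQ = smooth_tensor_gauge_covd[OF Suc.prems(2)]
  have \<sigma>: "perm_list ?\<sigma>" "length ?\<sigma> = Suc (r + s)"
    by (auto intro!: perm_listI)
  have "order_upto i b r P" "order_upto i b' s Q"
    using Suc.prems(3,4) by (simp_all add: order_upto_def)
  then have o: "order_upto i b r P" "order_upto i b' s Q" "order_upto i b (Suc r) (D P)" "order_upto i b' (Suc s) (D Q)"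
    using Suc.prems(3,4) by (simp_all add: order_upto_Suc)
  have "order_upto i (b + b') (Suc (r + s)) (tensor_product (Suc r) (D P) Q)"
    using Suc.IH[OF DP Suc.prems(2) o(3,2)] by simp
  moreover have "order_upto i (b + b') (Suc (r + s)) (rearrange ?\<sigma> (tensor_product r P (D Q)))"
    using Suc.IH[OF Suc.prems(1) DQ o(1,4)] by (intro order_upto_rearrange \<sigma>) simp
  ultimately have "order_upto i (b + b') (Suc (r + s))
      (\<lambda>\<mu>s x. tensor_product (Suc r) (D P) Q \<mu>s x + rearrange ?\<sigma> (tensor_product r P (D Q)) \<mu>s x)"
    by (intro order_upto_add smooth_tensor_rearrange smooth_tensor_product DP DQ Suc.prems)
  moreover have "tensor_product (Suc r) (D P) Q \<mu>s x + rearrange ?\<sigma> (tensor_product r P (D Q)) \<mu>s x = D (tensor_product r P Q) \<mu>s x"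
    if "length \<mu>s = Suc (r + s)" "x \<in> S" for \<mu>s x
  proof -
    obtain \<kappa> \<nu>s where \<mu>s: "\<mu>s = \<kappa> # \<nu>s" "length \<nu>s = r + s" using \<open>length \<mu>s = _\<close> by (auto simp: length_Suc_conv)
    have "map ((!) (\<kappa> # \<nu>s)) ?\<sigma> = take r \<nu>s @ \<kappa> # drop r \<nu>s"
      using \<mu>s(2) by (auto intro!: nth_equalityI simp: nth_append nth_Cons' simp del: upt_Suc)
    then show ?thesis
      using \<mu>s gauge_covd_tensor_product[OF Suc.prems(1,2) \<open>x \<in> S\<close>]
      by (simp add: tensor_product_def rearrange_def del: upt_Suc)
  qed
  ultimately have "order_upto i (b + b') (Suc (r + s)) (D (tensor_product r P Q))"
    by (rule order_upto_cong[rotated])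
  moreover have "boost_order_le (g x) (l x) (b + b') (r + s) (\<lambda>\<mu>s. tensor_product r P Q \<mu>s x)" if "x \<in> S" for x
    unfolding tensor_product_def
    by (rule boost_order_le_tensor_product[OF bilinear_matrix_mult])
       (use Suc.prems(3,4) that in \<open>simp_all add: order_upto_Suc\<close>)
  ultimately show ?case by (simp add: order_upto_Suc)
qed

lemma order_upto_contract:
  assumes "smooth_tensor S T" "order_upto i b (r + 2) T"
  shows "order_upto i b r (contract_field g T)"
  using assms
proof (induction i arbitrary: r T)
  case 0
  have "boost_order_le (g x) (l x) b r (contract_metric (g x) (\<lambda>\<mu>s. T \<mu>s x))"
    if "x \<in> S" "boost_order_le (g x) (l x) b (r + 2) (\<lambda>\<mu>s. T \<mu>s x)" for x
    using frame[OF that(1)] null_frame_at.boost_order_le_contract[OF null_frame_atI] that by metis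
  then show ?case using 0 by (auto simp: order_upto_0 contract_field_def)
next
  case (Suc i)
  have order: "boost_order_le (g x) (l x) b r (contract_metric (g x) (\<lambda>\<mu>s. T \<mu>s x))" if "x \<in> S" for x
    using frame[OF that] null_frame_at.boost_order_le_contract[OF null_frame_atI] that Suc.prems(2)
    unfolding order_upto_Suc by metis
  \<comment> \<open>The contracted pair stands in front of the derivative index, but in
    \<open>D T\<close> the derivative index comes first.\<close>
  let ?\<sigma> = "[2, 0, 1] @ [3..<r + 3]"
  have \<sigma>: "perm_list ?\<sigma>" "length ?\<sigma> = Suc r + 2"
    by (auto intro!: perm_listI)
  have "order_upto i b (Suc r) (contract_field g (rearrange ?\<sigma> (D T)))"
    using Suc.prems
    by (intro Suc.IH smooth_tensor_rearrange smooth_tensor_gauge_covd order_upto_rearrange \<sigma>) (simp_all add: order_upto_Suc)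
  moreover have "contract_field g (rearrange ?\<sigma> (D T)) \<mu>s x = D (contract_field g T) \<mu>s x"
    if "length \<mu>s = Suc r" "x \<in> S" for \<mu>s x
  proof -
    obtain \<kappa> \<nu>s where \<mu>s: "\<mu>s = \<kappa> # \<nu>s" "length \<nu>s = r" using \<open>length \<mu>s = _\<close> by (auto simp: length_Suc_conv)
    have "map ((!) (\<alpha> # \<gamma> # \<kappa> # \<nu>s)) [3..<r + 3] = \<nu>s" for \<alpha> \<gamma>
      using map_nth_upt_drop[of "[\<alpha>, \<gamma>, \<kappa>]" 3 \<nu>s "r + 3"] \<mu>s(2) by (simp del: upt_Suc)
    then show ?thesis
      using gauge_covd_contract[OF Suc.prems(1) \<open>x \<in> S\<close>, of \<kappa> \<nu>s]
      by (simp add: \<mu>s contract_field_def contract_metric_def rearrange_def del: upt_Suc)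
  qed
  ultimately have "order_upto i b (Suc r) (D (contract_field g T))"
    by (rule order_upto_cong[rotated])
  moreover have "boost_order_le (g x) (l x) b r (\<lambda>\<mu>s. contract_field g T \<mu>s x)" if "x \<in> S" for x
    using order[OF that] by (simp add: contract_field_def)
  ultimately show ?case by (simp add: order_upto_Suc)
qed

section \<open>The curvature terms\<close>

text \<open>The Riemann tensor enters as a multiple of the unit matrix, so that one product suffices.\<close>

abbreviation R :: "('n, complex^'N^'N) tensor_field" where
  "R \<equiv> \<lambda>\<mu>s x. riemann g \<mu>s x *\<^sub>R mat 1"

lemma smooth_riemann: "smooth_tensor S (riemann g)"
  unfolding smooth_tensor_def riemann_def[abs_def] riemann_up_def
  by (intro allI smooth_on_sum smooth_on_mult smooth_on_add smooth_on_diff smooth_on_partial_deriv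
      smooth_metric smooth_christoffel open_S)

lemma smooth_R: "smooth_tensor S R"
  using smooth_riemann unfolding smooth_tensor_def by (auto intro!: smooth_on_scaleR open_S)

lemma gauge_covd_scalar:
  fixes P :: "('n, real) tensor_field"
  assumes "smooth_tensor S P" "x \<in> S" "\<mu>s \<noteq> []"
  shows "D (\<lambda>\<mu>s x. P \<mu>s x *\<^sub>R mat 1) \<mu>s x = covd g P \<mu>s x *\<^sub>R mat 1"
proof -
  obtain \<kappa> \<nu>s where \<mu>s: "\<mu>s = \<kappa> # \<nu>s" using assms(3) by (cases \<mu>s) auto
  have "partial_deriv \<kappa> (\<lambda>x. P \<nu>s x *\<^sub>R (mat 1 :: complex^'N^'N)) x = partial_deriv \<kappa> (P \<nu>s) x *\<^sub>R mat 1"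
    using smooth_on_differentiable[OF _ open_S assms(2)] assms(1)
    by (intro partial_deriv_bounded_linear[OF bounded_linear_scaleR_left]) (auto simp: smooth_tensor_def)
  then show ?thesis
    unfolding \<mu>s gauge_covd_Cons covd_Cons
    by (simp add: bracket_scalar act_linear_image[OF bounded_linear.linear[OF bounded_linear_scaleR_left]] scaleR_diff_left)
qed

lemma gauge_covd_pow_R:
  "x \<in> S \<Longrightarrow> length \<mu>s = k + 4 \<Longrightarrow> (D ^^ k) R \<mu>s x = (covd g ^^ k) (riemann g) \<mu>s x *\<^sub>R mat 1"
proof (induction k arbitrary: \<mu>s x)
  case (Suc k)
  have s: "smooth_tensor S ((covd g ^^ k) (riemann g))" for k
    by (induction k) (simp_all add: smooth_riemann smooth_tensor_covd)
  have "D ((D ^^ k) R) \<mu>s x = D (\<lambda>\<mu>s x. (covd g ^^ k) (riemann g) \<mu>s x *\<^sub>R mat 1) \<mu>s x"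
    by (rule gauge_covd_cong[OF Suc.IH]) (use Suc.prems in auto)
  then show ?case
    using gauge_covd_scalar[OF s Suc.prems(1), of \<mu>s k] Suc.prems(2) by fastforce
qed simp

text \<open>Degeneracy bounds all derivatives of the curvature, as is needed when a curvature term
  is differentiated further.\<close>

lemma order_upto_R: "order_upto i 0 4 R"
  unfolding order_upto_def
proof (intro allI impI ballI)
  fix a x assume x: "x \<in> S"
  have "boost_order_le (g x) (l x) 0 (a + 4) (\<lambda>\<mu>s. (covd g ^^ a) (riemann g) \<mu>s x *\<^sub>R (mat 1 :: complex^'N^'N))"
    by (rule boost_order_le_linear_image[OF bounded_linear.linear[OF bounded_linear_scaleR_left] order_riemann[OF x]])
  then have "boost_order_le (g x) (l x) 0 (a + 4) (\<lambda>\<mu>s. (D ^^ a) R \<mu>s x)"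
    by (rule boost_order_le_cong[rotated]) (simp add: gauge_covd_pow_R[OF x])
  then show "boost_order_le (g x) (l x) 0 (4 + a) (\<lambda>\<mu>s. (D ^^ a) R \<mu>s x)" by (simp add: add.commute)
qed

lemma riemann_up_eq:
  assumes "x \<in> S"
  shows "riemann_up g x \<rho> \<sigma> \<kappa> \<eta> = (\<Sum>\<gamma>\<in>UNIV. matrix_inv (g x) $ \<rho> $ \<gamma> * riemann g [\<gamma>, \<sigma>, \<kappa>, \<eta>] x)"
proof -
  define v where "v = (\<chi> \<alpha>. riemann_up g x \<alpha> \<sigma> \<kappa> \<eta>)"
  have "riemann g [\<gamma>, \<sigma>, \<kappa>, \<eta>] x = (g x *v v) $ \<gamma>" for \<gamma>
    by (simp add: riemann_def v_def matrix_vector_mult_def)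
  then have "(\<Sum>\<gamma>\<in>UNIV. matrix_inv (g x) $ \<rho> $ \<gamma> * riemann g [\<gamma>, \<sigma>, \<kappa>, \<eta>] x) = (matrix_inv (g x) *v (g x *v v)) $ \<rho>"
    by (simp add: matrix_vector_mult_def[of "matrix_inv (g x)"])
  also have "\<dots> = v $ \<rho>"
    by (simp add: matrix_vector_mul_assoc matrix_inv_left[OF metric_invertible[OF assms]])
  finally show ?thesis by (simp add: v_def)
qed

text \<open>On index lists headed by a contracted pair, this puts the pair into the first slot of the
  Riemann tensor and the \<open>i\<close>-th slot of the other factor.\<close>

definition curvature_slots :: "nat \<Rightarrow> nat \<Rightarrow> nat list" where
  "curvature_slots r i = [1, 4 + i, 2, 3] @ [4..<r + 4][i := 0]"

lemma perm_list_curvature_slots: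
  assumes "i < r"
  shows "perm_list (curvature_slots r i)" "length (curvature_slots r i) = r + 4"
proof -
  show len: "length (curvature_slots r i) = r + 4" by (simp add: curvature_slots_def)
  have "j \<in> set (curvature_slots r i)" if "j < r + 4" for j
  proof -
    consider "j = 0" | "j \<in> {1, 2, 3, 4 + i}" | "4 \<le> j" "j \<noteq> 4 + i" using that by force
    then show ?thesis
    proof cases
      case 1
      have "[4..<r + 4][i := 0] ! i \<in> set ([4..<r + 4][i := 0])" by (rule nth_mem) (use assms in simp)
      then show ?thesis using 1 assms by (simp add: curvature_slots_def)
    next
      case 3
      have "[4..<r + 4][i := 0] ! (j - 4) \<in> set ([4..<r + 4][i := 0])" by (rule nth_mem) (use that 3 in simp)
      then show ?thesis using 3 that by (auto simp: curvature_slots_def)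
    qed (auto simp: curvature_slots_def)
  qed
  then have "{..<r + 4} \<subseteq> set (curvature_slots r i)" by auto
  moreover have "set (curvature_slots r i) \<subseteq> {..<r + 4}"
    using assms set_update_subset_insert[of "[4..<r + 4]" i 0] by (auto simp: curvature_slots_def)
  ultimately show "perm_list (curvature_slots r i)"
    by (intro perm_listI) (simp add: len)
qed

text \<open>Writes the curvature term of the Ricci identity through products, rearrangements and
  contractions only, the operations under which \<open>order_upto\<close> is closed.\<close>

lemma act_riemann:
  assumes x: "x \<in> S" and r: "length \<nu>s = r"
  shows "act (\<lambda>\<rho> \<sigma>. riemann_up g x \<rho> \<sigma> \<kappa> \<eta>) (\<lambda>\<mu>s. T \<mu>s x) \<nu>s
    = (\<Sum>i<r. contract_field g (rearrange (curvature_slots r i) (tensor_product 4 R T)) (\<kappa> # \<eta> # \<nu>s) x)"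
  unfolding act_def r
proof (rule sum.cong[OF refl])
  fix i assume "i \<in> {..<r}"
  then have i: "i < r" by simp
  have m: "map ((!) (\<alpha> # \<gamma> # \<kappa> # \<eta> # \<nu>s)) (curvature_slots r i) = [\<gamma>, \<nu>s ! i, \<kappa>, \<eta>] @ \<nu>s[i := \<alpha>]" for \<alpha> \<gamma>
  proof -
    have "map ((!) (\<alpha> # \<gamma> # \<kappa> # \<eta> # \<nu>s)) [4..<r + 4] = \<nu>s"
      using map_nth_upt_drop[of "[\<alpha>, \<gamma>, \<kappa>, \<eta>]" 4 \<nu>s "r + 4"] r by (simp del: upt_Suc)
    then show ?thesis by (simp add: curvature_slots_def map_update)
  qed
  have "(\<Sum>\<rho>\<in>UNIV. riemann_up g x \<rho> (\<nu>s ! i) \<kappa> \<eta> *\<^sub>R T (\<nu>s[i := \<rho>]) x)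
      = (\<Sum>\<rho>\<in>UNIV. \<Sum>\<gamma>\<in>UNIV. matrix_inv (g x) $ \<rho> $ \<gamma> *\<^sub>R (R [\<gamma>, \<nu>s ! i, \<kappa>, \<eta>] x ** T (\<nu>s[i := \<rho>]) x))"
    by (simp add: riemann_up_eq[OF x] scaleR_sum_left matrix_mult_simps)
  then show "(\<Sum>\<rho>\<in>UNIV. riemann_up g x \<rho> (\<nu>s ! i) \<kappa> \<eta> *\<^sub>R T (\<nu>s[i := \<rho>]) x)
      = contract_field g (rearrange (curvature_slots r i) (tensor_product 4 R T)) (\<kappa> # \<eta> # \<nu>s) x"
    by (simp add: contract_field_def contract_metric_def rearrange_def m tensor_product_def del: map_append)
qed

abbreviation swap_slots :: "nat \<Rightarrow> nat list" where
  "swap_slots r \<equiv> [1, 0] @ [2..<r + 2]"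

lemma perm_list_swap_slots: "perm_list (swap_slots r)" "length (swap_slots r) = r + 2"
  by (auto intro!: perm_listI)

text \<open>By the Ricci identity the commutator consists of products of F with \<open>T\<close>, of
  order -2, and contracted products of the curvature with \<open>T\<close>, of order 0 + (-1). All
  of this persists under i further derivatives.\<close>

lemma order_upto_commutator:
  assumes T: "smooth_tensor S T" "order_upto i (-1) r T" and F: "order_upto i (-1) 2 F"
  shows "order_upto i (-1) (r + 2) (\<lambda>\<mu>s x. D (D T) \<mu>s x - rearrange (swap_slots r) (D (D T)) \<mu>s x)"
proof -
  \<comment> \<open>In the summand T F of the bracket the two derivative indices belong to F, which
    comes second, so they are sent to the end.\<close>
  let ?\<tau> = "[2..<r + 2] @ [0, 1]"
  let ?C = "\<lambda>i. contract_field g (rearrange (curvature_slots r i) (tensor_product 4 R T))"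
  have \<tau>: "perm_list ?\<tau>" "length ?\<tau> = r + 2" by (auto intro!: perm_listI)
  have FT: "order_upto i (-1) (r + 2) (tensor_product 2 F T)" "smooth_tensor S (tensor_product 2 F T)"
    using order_upto_mono[OF order_upto_tensor_product[OF smooth_field_strength T(1) F T(2)], of "-1"]
    by (simp_all add: add.commute smooth_tensor_product smooth_field_strength T)
  have TF: "order_upto i (-1) (r + 2) (rearrange ?\<tau> (tensor_product r T F))" "smooth_tensor S (rearrange ?\<tau> (tensor_product r T F))"
  proof -
    have "order_upto i (-1) (r + 2) (tensor_product r T F)"
      using order_upto_mono[OF order_upto_tensor_product[OF T(1) smooth_field_strength T(2) F], of "-1"] by simp
    then show "order_upto i (-1) (r + 2) (rearrange ?\<tau> (tensor_product r T F))"
      by (rule order_upto_rearrange[OF \<tau>])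
  qed (intro smooth_tensor_rearrange smooth_tensor_product smooth_field_strength T)
  have "order_upto i (-1) (r + 2) (?C j)" "smooth_tensor S (?C j)" if "j < r" for j
  proof -
    have "order_upto i (-1) (r + 4) (tensor_product 4 R T)" "smooth_tensor S (tensor_product 4 R T)"
      using order_upto_tensor_product[OF smooth_R T(1) order_upto_R T(2)]
      by (simp_all add: add.commute smooth_tensor_product smooth_R T)
    then have "order_upto i (-1) (r + 4) (rearrange (curvature_slots r j) (tensor_product 4 R T))"
      "smooth_tensor S (rearrange (curvature_slots r j) (tensor_product 4 R T))"
      by (simp_all add: order_upto_rearrange perm_list_curvature_slots[OF that] smooth_tensor_rearrange)
    moreover have "r + 4 = r + 2 + 2" by simp
    ultimately show "order_upto i (-1) (r + 2) (?C j)" "smooth_tensor S (?C j)"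
      by (auto intro!: order_upto_contract smooth_tensor_contract simp del: One_nat_def add_2_eq_Suc')
  qed
  then have C: "order_upto i (-1) (r + 2) (\<lambda>\<mu>s x. \<Sum>j<r. ?C j \<mu>s x)" "smooth_tensor S (\<lambda>\<mu>s x. \<Sum>j<r. ?C j \<mu>s x)"
    using order_upto_sum[of "{..<r}" ?C i "-1" "r + 2"] by auto
  let ?B = "\<lambda>\<mu>s x. cscale \<i> (rearrange ?\<tau> (tensor_product r T F) \<mu>s x) + cscale (-\<i>) (tensor_product 2 F T \<mu>s x)"
  have "order_upto i (-1) (r + 2) ?B" "smooth_tensor S ?B"
    by (intro order_upto_add smooth_tensor_add smooth_tensor_cscale order_upto_cscale TF FT)+
  then have "order_upto i (-1) (r + 2) (\<lambda>\<mu>s x. ?B \<mu>s x - (\<Sum>j<r. ?C j \<mu>s x))"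
    using C by (intro order_upto_diff)
  then show ?thesis
  proof (rule order_upto_cong[rotated])
    fix \<mu>s :: "'n list" and x assume \<mu>s: "length \<mu>s = r + 2" and x: "x \<in> S"
    then obtain \<kappa> \<eta> \<nu>s where \<nu>s: "\<mu>s = \<kappa> # \<eta> # \<nu>s" "length \<nu>s = r"
      by (auto simp: numeral_2_eq_2 length_Suc_conv)
    have m: "map ((!) (\<kappa> # \<eta> # \<nu>s)) [2..<r + 2] = \<nu>s"
      using map_nth_upt_drop[of "[\<kappa>, \<eta>]" 2 \<nu>s "r + 2"] \<nu>s(2) by (simp del: upt_Suc)
    then have m': "map ((!) (\<kappa> # \<eta> # \<nu>s)) [2..<Suc (Suc r)] = \<nu>s" by (simp del: upt_Suc)
    have c: "cscale (-\<i>) X = - cscale \<i> X" for X :: "complex^'N^'N"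
      by (simp add: cscale_def vec_eq_iff)
    have "?B \<mu>s x = bracket (F [\<kappa>, \<eta>] x) (T \<nu>s x)"
      by (simp add: \<nu>s m' c bracket_eq rearrange_def tensor_product_def del: upt_Suc)
    moreover have "rearrange (swap_slots r) (D (D T)) \<mu>s x = D (D T) (\<eta> # \<kappa> # \<nu>s) x"
      by (simp add: \<nu>s m' rearrange_def del: upt_Suc)
    moreover note act_riemann[OF x \<nu>s(2), of \<kappa> \<eta> T] ricci_identity[OF T(1) x, of \<kappa> \<eta> \<nu>s]
    ultimately show "?B \<mu>s x - (\<Sum>j<r. ?C j \<mu>s x) = D (D T) \<mu>s x - rearrange (swap_slots r) (D (D T)) \<mu>s x"
      by (simp add: \<nu>s(1))
  qed
qed

end

context kundt_chart begin

section \<open>Derivatives of the field strength\<close>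

lemma perm_list_shift:
  assumes "perm_list \<sigma>"
  shows "perm_list ([0..<p] @ map ((+) p) \<sigma>)"
proof (rule perm_listI)
  have "set ([0..<p] @ map ((+) p) \<sigma>) = {0..<p} \<union> (+) p ` {0..<length \<sigma>}"
    using assms by (simp add: perm_list_def atLeast0LessThan)
  also have "\<dots> = {..<length ([0..<p] @ map ((+) p) \<sigma>)}"
    by (simp add: image_add_atLeastLessThan) auto
  finally show "set ([0..<p] @ map ((+) p) \<sigma>) = {..<length ([0..<p] @ map ((+) p) \<sigma>)}" .
qed

lemma gauge_covd_pow_rearrange:
  assumes "perm_list \<sigma>" "length \<mu>s = length \<sigma> + p" "x \<in> S"
  shows "(D ^^ p) (rearrange \<sigma> T) \<mu>s x = rearrange ([0..<p] @ map ((+) p) \<sigma>) ((D ^^ p) T) \<mu>s x"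
  using assms(2,3)
proof (induction p arbitrary: \<mu>s x)
  case 0
  have "map ((+) 0) \<sigma> = \<sigma>" by (simp add: map_idI)
  then show ?case by simp
next
  case (Suc p)
  let ?\<sigma> = "[0..<p] @ map ((+) p) \<sigma>"
  have s: "[0..<Suc p] @ map ((+) (Suc p)) \<sigma> = 0 # map Suc ?\<sigma>"
    by (simp add: map_Suc_upt upt_conv_Cons del: upt_Suc)
  obtain \<kappa> \<nu>s where \<mu>s: "\<mu>s = \<kappa> # \<nu>s" "length \<nu>s = length ?\<sigma>"
    using Suc.prems(1) by (auto simp: length_Suc_conv)
  have "(D ^^ Suc p) (rearrange \<sigma> T) \<mu>s x = D (rearrange ?\<sigma> ((D ^^ p) T)) \<mu>s x"
    unfolding funpow.simps comp_def
    by (rule gauge_covd_cong[OF Suc.IH]) (use Suc.prems in auto)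
  also have "\<dots> = rearrange (0 # map Suc ?\<sigma>) ((D ^^ Suc p) T) \<mu>s x"
    using gauge_covd_rearrange[OF perm_list_shift[OF assms(1)] \<mu>s(2)] by (simp add: \<mu>s(1))
  finally show ?case unfolding s .
qed

lemma gauge_covd_pow_diff:
  assumes "smooth_tensor S T" "smooth_tensor S T'" "x \<in> S" "length \<mu>s \<ge> p"
  shows "(D ^^ p) (\<lambda>\<mu>s x. T \<mu>s x - T' \<mu>s x) \<mu>s x = (D ^^ p) T \<mu>s x - (D ^^ p) T' \<mu>s x"
  using assms(3,4)
proof (induction p arbitrary: \<mu>s x)
  case (Suc p)
  note sm = smooth_tensor_gauge_covd_pow[OF assms(1), of p] smooth_tensor_gauge_covd_pow[OF assms(2), of p]
  have "(D ^^ Suc p) (\<lambda>\<mu>s x. T \<mu>s x - T' \<mu>s x) \<mu>s x = D (\<lambda>\<mu>s x. (D ^^ p) T \<mu>s x + cscale (-1) ((D ^^ p) T' \<mu>s x)) \<mu>s x"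
    unfolding funpow.simps comp_def
    by (rule gauge_covd_cong[where r = "length \<mu>s - 1"]) (use Suc in \<open>auto simp flip: uminus_eq_cscale\<close>)
  also have "\<dots> = D ((D ^^ p) T) \<mu>s x + cscale (-1) (D ((D ^^ p) T') \<mu>s x)"
    using Suc.prems
    by (subst gauge_covd_add[OF sm(1) smooth_tensor_cscale[OF sm(2)]], simp, force)
       (subst gauge_covd_cscale[OF sm(2)], auto)
  finally show ?case by (simp flip: uminus_eq_cscale)
qed simp

section \<open>Derivatives of the field strength along the Kundt vector\<close>

lemma field_strength_l: "y \<in> S \<Longrightarrow> ev [l y, v] (\<lambda>\<mu>s. F \<mu>s y) = 0"
  and field_strength_l': "y \<in> S \<Longrightarrow> ev [v, l y] (\<lambda>\<mu>s. F \<mu>s y) = 0"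
proof -
  assume y: "y \<in> S"
  \<comment> \<open>Every vector has index -1, so together with \<open>l\<close> the total weight is
    0 > -1.\<close>
  have f: "filt y (l y) 1" "filt y v (-1)"
    by (auto simp: in_boost_filtration_def intro: exI[of _ 1])
  show "ev [l y, v] (\<lambda>\<mu>s. F \<mu>s y) = 0"
    by (rule boost_order_leD[OF order_field_strength[OF y], where ws = "[1, -1]"]) (use f in simp_all)
  show "ev [v, l y] (\<lambda>\<mu>s. F \<mu>s y) = 0"
    by (rule boost_order_leD[OF order_field_strength[OF y], where ws = "[-1, 1]"]) (use f in simp_all)
qed

lemma ev_list_update_scaleR:
  "i < length vs \<Longrightarrow> ev (vs[i := c *\<^sub>R u]) T = c *\<^sub>R ev (vs[i := u]) T"
proof (induction vs arbitrary: i T)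
  case (Cons v vs)
  have "slot (c *\<^sub>R u) T = (\<lambda>\<mu>s. c *\<^sub>R slot u T \<mu>s)"
    by (simp add: slot_def fun_eq_iff scaleR_sum_right)
  with Cons show ?case by (cases i) (simp_all add: ev_scaleR)
qed simp

lemma nabla_l_l: "x \<in> S \<Longrightarrow> \<exists>c. nabla_vec g (l x) l x = c *\<^sub>R l x"
  using nabla_l null_l by blast

lemma ev_slot_head_scaleR: "ev (c *\<^sub>R u # vs) T = c *\<^sub>R ev (u # vs) T"
  using ev_list_update_scaleR[of 0 "u # vs" c u T] by simp

text \<open>F(l, z) vanishes identically; differentiate it along \<open>l\<close>. The correction
  terms are F(nabla_l l, z), with nabla_l l proportional to \<open>l\<close>, and F(l, nabla_l z),
  both zero.\<close>

lemma gauge_covd_field_strength_l_l: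
  assumes x: "x \<in> S"
  shows "ev [l x, l x, z] (\<lambda>\<mu>s. D F \<mu>s x) = 0" "ev [l x, z, l x] (\<lambda>\<mu>s. D F \<mu>s x) = 0"
proof -
  obtain c where c: "nabla_vec g (l x) l x = c *\<^sub>R l x" using nabla_l_l[OF x] by blast
  have 1: "ev [c *\<^sub>R l x, v] (\<lambda>\<mu>s. F \<mu>s x) = 0" for v
    by (simp only: ev_slot_head_scaleR field_strength_l[OF x] scaleR_zero_right)
  have 2: "ev [v, c *\<^sub>R l x] (\<lambda>\<mu>s. F \<mu>s x) = 0" for v
    using ev_list_update_scaleR[of 1 "[v, l x]" c "l x" "\<lambda>\<mu>s. F \<mu>s x"] field_strength_l'[OF x, of v]
    by (simp del: ev.simps)
  have "ev (l x # map (\<lambda>Y. Y x) [l, \<lambda>_. z]) (\<lambda>\<mu>s. D F \<mu>s x) = 0"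
  proof (rule ev_gauge_covd_eq_0[OF x smooth_field_strength])
    fix i assume "i < length [l, \<lambda>_. z]"
    then consider "i = 0" | "i = 1" by fastforce
    then show "ev ((map (\<lambda>Y. Y x) [l, \<lambda>_. z])[i := nabla_vec g (l x) ([l, \<lambda>_. z] ! i) x]) (\<lambda>\<mu>s. F \<mu>s x) = 0"
      by cases (use field_strength_l[OF x] 1 in \<open>simp_all add: c del: ev.simps\<close>)
  qed (use field_strength_l differentiable_l[OF x] in \<open>auto simp del: ev.simps\<close>)
  then show "ev [l x, l x, z] (\<lambda>\<mu>s. D F \<mu>s x) = 0" by (simp del: ev.simps)
  have "ev (l x # map (\<lambda>Y. Y x) [\<lambda>_. z, l]) (\<lambda>\<mu>s. D F \<mu>s x) = 0"
  proof (rule ev_gauge_covd_eq_0[OF x smooth_field_strength])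
    fix i assume "i < length [\<lambda>_. z, l]"
    then consider "i = 0" | "i = 1" by fastforce
    then show "ev ((map (\<lambda>Y. Y x) [\<lambda>_. z, l])[i := nabla_vec g (l x) ([\<lambda>_. z, l] ! i) x]) (\<lambda>\<mu>s. F \<mu>s x) = 0"
      by cases (use field_strength_l'[OF x] 2 in \<open>simp_all add: c del: ev.simps\<close>)
  qed (use field_strength_l' differentiable_l[OF x] in \<open>auto simp del: ev.simps\<close>)
  then show "ev [l x, z, l x] (\<lambda>\<mu>s. D F \<mu>s x) = 0" by (simp del: ev.simps)
qed

lemma ev_bianchi:
  assumes x: "x \<in> S"
  shows "ev [u, v, w] (\<lambda>\<mu>s. D F \<mu>s x) = - ev [v, w, u] (\<lambda>\<mu>s. D F \<mu>s x) - ev [w, u, v] (\<lambda>\<mu>s. D F \<mu>s x)"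
proof -
  let ?T = "\<lambda>\<mu>s. D F \<mu>s x"
  have p: "perm_list [1, 2, 0]" "perm_list [2, 0, 1]" by (auto intro!: perm_listI)
  have "ev [u, v, w] (\<lambda>\<mu>s. ?T \<mu>s + rearrange [1, 2, 0] ?T \<mu>s + rearrange [2, 0, 1] ?T \<mu>s) = ev [u, v, w] (\<lambda>\<mu>s. 0)"
  proof (rule ev_cong)
    fix \<mu>s :: "'n list" assume "length \<mu>s = length [u, v, w]"
    then obtain \<kappa> \<eta> \<mu> where "\<mu>s = [\<kappa>, \<eta>, \<mu>]" by (auto simp: length_Suc_conv)
    then show "?T \<mu>s + rearrange [1, 2, 0] ?T \<mu>s + rearrange [2, 0, 1] ?T \<mu>s = 0"
      using bianchi_identity[OF x, of \<kappa> \<eta> \<mu>] by (simp add: rearrange_def)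
  qed
  then have "ev [u, v, w] ?T + ev [u, v, w] (rearrange [1, 2, 0] ?T) + ev [u, v, w] (rearrange [2, 0, 1] ?T) = 0"
    unfolding ev_add by (simp del: ev.simps)
  moreover have "ev [u, v, w] (rearrange [1, 2, 0] ?T) = ev [v, w, u] ?T"
    by (subst ev_rearrange[OF p(1)]) (simp_all del: ev.simps)
  moreover have "ev [u, v, w] (rearrange [2, 0, 1] ?T) = ev [w, u, v] ?T"
    by (subst ev_rearrange[OF p(2)]) (simp_all del: ev.simps)
  ultimately show ?thesis by (simp add: eq_neg_iff_add_eq_0 algebra_simps del: ev.simps)
qed

lemma ev_gauge_covd_field_strength_antisym:
  assumes x: "x \<in> S"
  shows "ev [u, v, w] (\<lambda>\<mu>s. D F \<mu>s x) = - ev [u, w, v] (\<lambda>\<mu>s. D F \<mu>s x)"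
proof -
  have p: "perm_list [1, 0]" "perm_list [0, 2, 1]" by (auto intro!: perm_listI)
  have anti: "D F \<mu>s x = cscale (-1) (rearrange [0, 2, 1] (D F) \<mu>s x)" if "length \<mu>s = 3" for \<mu>s
  proof -
    have "D F \<mu>s x = D (\<lambda>\<mu>s x. cscale (-1) (rearrange [1, 0] F \<mu>s x)) \<mu>s x"
    proof (rule gauge_covd_cong)
      fix \<nu>s :: "'n list" and y assume "length \<nu>s = 2"
      then obtain \<kappa> \<eta> where "\<nu>s = [\<kappa>, \<eta>]" by (auto simp: numeral_2_eq_2 length_Suc_conv)
      then show "F \<nu>s y = cscale (-1) (rearrange [1, 0] F \<nu>s y)"
        using field_strength_antisym[of \<kappa> \<eta> y] by (simp add: rearrange_def flip: uminus_eq_cscale)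
    qed (use that x in auto)
    also have "\<dots> = cscale (-1) (D (rearrange [1, 0] F) \<mu>s x)"
      by (rule gauge_covd_cscale) (use that x in \<open>auto intro: smooth_tensor_rearrange smooth_field_strength\<close>)
    also have "D (rearrange [1, 0] F) \<mu>s x = rearrange [0, 2, 1] (D F) \<mu>s x"
      using gauge_covd_rearrange[OF p(1), of "tl \<mu>s" F "hd \<mu>s" x] that
      by (cases \<mu>s) (simp_all add: numeral_2_eq_2)
    finally show ?thesis .
  qed
  have "D F \<mu>s x = - rearrange [0, 2, 1] (\<lambda>\<mu>s. D F \<mu>s x) \<mu>s" if "length \<mu>s = 3" for \<mu>s
    using anti[OF that] unfolding rearrange_def uminus_eq_cscale .
  then have "ev [u, v, w] (\<lambda>\<mu>s. D F \<mu>s x) = ev [u, v, w] (\<lambda>\<mu>s. - rearrange [0, 2, 1] (\<lambda>\<mu>s. D F \<mu>s x) \<mu>s)"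
    by (rule ev_cong) (metis length_Cons list.size(3) numeral_3_eq_3)
  also have "\<dots> = - ev [u, w, v] (\<lambda>\<mu>s. D F \<mu>s x)"
    unfolding ev_uminus by (subst ev_rearrange[OF p(2)]) (simp_all del: ev.simps)
  finally show ?thesis .
qed

text \<open>Checked on frame components. If a form slot is \<open>l\<close>, the previous lemma
  applies; if both are \<open>e 1\<close>, antisymmetry does. Otherwise the Bianchi identity moves
  \<open>l\<close> into a form slot and puts a frame vector of weight at most 0 into the derivative
  slot; the total weight is then at least 1 - 1 = 0, and \<open>ev_gauge_covd_nonpositive\<close>
  applies.\<close>

lemma gauge_covd_field_strength_l:
  assumes x: "x \<in> S"
  shows "ev [l x, v, w] (\<lambda>\<mu>s. D F \<mu>s x) = 0"
proof -
  obtain e where e: "null_frame (g x) e" "e 0 = l x" using frame[OF x] by blast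
  interpret null_frame_at "g x" e by (rule null_frame_atI[OF x e(1)])
  let ?T = "slot (l x) (\<lambda>\<mu>s. D F \<mu>s x)"
  note l_l = gauge_covd_field_strength_l_l[OF x]
  have filt: "filt x (e a) (frame_weight a)" if "a < CARD('n)" for a
    using frame_in_filtration[OF that] by (simp add: e(2))
  have fl: "filt x (l x) 1" by (auto simp: in_boost_filtration_def intro: exI[of _ 1])
  \<comment> \<open>Two slots have weight at least -2, so order -3 means that the tensor vanishes
    altogether.\<close>
  have "boost_order_le (g x) (e 0) (-3) 2 ?T"
  proof (rule boost_order_le_if_frame)
    fix as assume "length as = 2" "set as \<subseteq> {..<CARD('n)}"
    then obtain a b where ab: "as = [a, b]" "a < CARD('n)" "b < CARD('n)"
      by (auto simp: numeral_2_eq_2 length_Suc_conv)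
    have "ev [l x, e a, e b] (\<lambda>\<mu>s. D F \<mu>s x) = 0"
    proof -
      have "a \<noteq> 0 \<Longrightarrow> b \<noteq> 0 \<Longrightarrow> \<not> (a = 1 \<and> b = 1) \<Longrightarrow> frame_weight a + frame_weight b \<ge> -1"
        by (auto simp: frame_weight_def)
      then consider "a = 0" | "b = 0" | "a = 1" "b = 1" | "a \<noteq> 0" "b \<noteq> 0" "frame_weight a + frame_weight b \<ge> -1"
        by blast
      then show ?thesis
      proof cases
        case 3
        have "2 *\<^sub>R ev [l x, e 1, e 1] (\<lambda>\<mu>s. D F \<mu>s x) = 0"
          using ev_gauge_covd_field_strength_antisym[OF x, of "l x" "e 1" "e 1"]
          unfolding scaleR_2 eq_neg_iff_add_eq_0 .
        then show ?thesis using 3 by (simp del: ev.simps)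
      next
        case 4
        have "ev [e a, e b, l x] (\<lambda>\<mu>s. D F \<mu>s x) = 0"
          by (rule ev_gauge_covd_nonpositive[OF smooth_field_strength order_field_strength x filt[OF ab(2)], where ws = "[frame_weight b, 1]"])
             (use 4 filt[OF ab(3)] fl in \<open>auto simp: frame_weight_def\<close>)
        moreover have "ev [e b, l x, e a] (\<lambda>\<mu>s. D F \<mu>s x) = 0"
          by (rule ev_gauge_covd_nonpositive[OF smooth_field_strength order_field_strength x filt[OF ab(3)], where ws = "[1, frame_weight a]"])
             (use 4 filt[OF ab(2)] fl in \<open>auto simp: frame_weight_def\<close>)
        ultimately show ?thesis using ev_bianchi[OF x, of "l x" "e a" "e b"] by (simp del: ev.simps)
      qed (use l_l e(2) in \<open>simp_all del: ev.simps\<close>)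
    qed
    then show "frame_comp e ?T as = 0" by (simp add: frame_comp_eq_ev ab(1))
  qed
  from boost_order_leD[OF this, of "[v, w]" "[-1, -1]"] show ?thesis
    by (simp add: in_boost_filtration_def)
qed

text \<open>Starting from D_l F = 0, each further derivative along \<open>l\<close> is taken of an
  expression that vanishes on \<open>S\<close>. Since nabla_l l is proportional to \<open>l\<close>,
  and since the last two arguments are unrestricted, the correction terms are instances of the
  induction hypothesis.\<close>

lemma ev_gauge_covd_pow_l:
  assumes "x \<in> S" "length us = Suc m" "length zs = 2" "\<forall>u\<in>set us. \<exists>c. u = c *\<^sub>R l x"
  shows "ev (us @ zs) (\<lambda>\<mu>s. (D ^^ Suc m) F \<mu>s x) = 0"
  using assms
proof (induction m arbitrary: x us zs)
  case 0
  obtain u v w where uvw: "us = [u]" "zs = [v, w]"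
    using 0(2,3) by (auto simp: numeral_2_eq_2 length_Suc_conv)
  then obtain c where "u = c *\<^sub>R l x" using 0(4) by auto
  with uvw show ?case
    by (simp add: ev_slot_head_scaleR gauge_covd_field_strength_l[OF 0(1)] del: ev.simps)
next
  case (Suc m)
  note x = Suc.prems(1)
  obtain c0 us' where us: "us = (c0 *\<^sub>R l x) # us'" "length us' = Suc m" "\<forall>u\<in>set us'. \<exists>c. u = c *\<^sub>R l x"
  proof -
    obtain u us' where u: "us = u # us'" "length us' = Suc m"
      using Suc.prems(2) by (auto simp: length_Suc_conv)
    then obtain c where "u = c *\<^sub>R l x" using Suc.prems(4) by auto
    with u that show ?thesis using Suc.prems(4) by auto
  qed
  have "\<forall>i<length us'. \<exists>c. us' ! i = c *\<^sub>R l x" using us(3) by simp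
  then obtain c where c: "\<And>i. i < length us' \<Longrightarrow> us' ! i = c i *\<^sub>R l x" by metis
  \<comment> \<open>The multiples of \<open>l\<close> at x are extended as constant multiples of the
    field \<open>l\<close>, the other two vectors as constants.\<close>
  define Ys where "Ys = map (\<lambda>i y. c i *\<^sub>R l y) [0..<Suc m] @ map (\<lambda>z y. z) zs"
  have Ysy: "map (\<lambda>Y. Y y) Ys = map (\<lambda>i. c i *\<^sub>R l y) [0..<Suc m] @ zs" for y
    by (simp add: Ys_def comp_def del: upt_Suc)
  have Ysx: "map (\<lambda>Y. Y x) Ys = us' @ zs"
    unfolding Ysy using us(2) c by (auto intro!: nth_equalityI simp del: upt_Suc)
  have len: "length Ys = Suc m + 2" using Suc.prems(3) by (simp add: Ys_def)
  have "ev (l x # map (\<lambda>Y. Y x) Ys) (\<lambda>\<mu>s. D ((D ^^ Suc m) F) \<mu>s x) = 0"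
  proof (rule ev_gauge_covd_eq_0[OF x smooth_tensor_gauge_covd_pow[OF smooth_field_strength]])
    show "\<forall>Y\<in>set Ys. Y differentiable at x"
      using differentiable_l[OF x] by (auto simp: Ys_def)
    show "ev (map (\<lambda>Y. Y y) Ys) (\<lambda>\<mu>s. (D ^^ Suc m) F \<mu>s y) = 0" if "y \<in> S" for y
      unfolding Ysy by (rule Suc.IH[OF that]) (use Suc.prems(3) in auto)
    fix i assume i: "i < length Ys"
    show "ev ((map (\<lambda>Y. Y x) Ys)[i := nabla_vec g (l x) (Ys ! i) x]) (\<lambda>\<mu>s. (D ^^ Suc m) F \<mu>s x) = 0"
    proof (cases "i < Suc m")
      case True
      then have "Ys ! i = (\<lambda>y. c i *\<^sub>R l y)" by (simp add: Ys_def nth_append del: upt_Suc)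
      moreover obtain k where "nabla_vec g (l x) l x = k *\<^sub>R l x" using nabla_l_l[OF x] by blast
      ultimately have "nabla_vec g (l x) (Ys ! i) x = (c i * k) *\<^sub>R l x"
        by (simp add: nabla_vec_scaleR[OF differentiable_l[OF x]])
      then have "\<forall>u\<in>set (us'[i := nabla_vec g (l x) (Ys ! i) x]). \<exists>c. u = c *\<^sub>R l x"
        using us(3) set_update_subset_insert[of us' i] by fastforce
      then show ?thesis
        unfolding Ysx using True us(2) Suc.IH[OF x _ Suc.prems(3)] by (simp add: list_update_append del: funpow.simps)
    next
      case False
      then have "(us' @ zs)[i := v] = us' @ zs[i - Suc m := v]" for v
        using us(2) by (simp add: list_update_append)
      then show ?thesis
        unfolding Ysx using Suc.IH[OF x us(2) _ us(3)] Suc.prems(3) by (simp del: funpow.simps)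
    qed
  qed
  then have "ev (l x # us' @ zs) (\<lambda>\<mu>s. (D ^^ Suc (Suc m)) F \<mu>s x) = 0"
    by (simp add: Ysx del: ev.simps)
  then show ?case
    unfolding us(1) append_Cons ev_slot_head_scaleR by (simp del: ev.simps funpow.simps)
qed

section \<open>Reordering the derivative indices\<close>

lemma list_all2_swap:
  fixes ws :: "int list"
  assumes "list_all2 P (us @ a # b # vs) ws"
  shows "\<exists>ws'. list_all2 P (us @ b # a # vs) ws' \<and> sum_list ws' = sum_list ws \<and>
    ws' ! length us = ws ! Suc (length us)"
proof -
  obtain ws1 wa wb ws2 where ws: "ws = ws1 @ wa # wb # ws2" "length ws1 = length us"
    "list_all2 P us ws1" "P a wa" "P b wb" "list_all2 P vs ws2"
    using assms by (auto simp: list_all2_append1 list_all2_Cons1)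
  then show ?thesis
    by (intro exI[of _ "ws1 @ wb # wa # ws2"]) (simp add: list_all2_appendI nth_append)
qed

text \<open>The induction is strong because a commutator inside D^N F, once differentiated, involves
  all derivatives of F up to order N - 2.\<close>

lemma boost_order_gauge_covd_pow_field_strength:
  "x \<in> S \<Longrightarrow> boost_order_le (g x) (l x) (-1) (N + 2) (\<lambda>\<mu>s. (D ^^ N) F \<mu>s x)"
proof (induction N arbitrary: x rule: less_induct)
  case (less N)
  show ?case
  proof (cases N)
    case 0
    then show ?thesis using order_field_strength[OF less.prems] by (simp add: numeral_2_eq_2)
  next
    case (Suc M)
    note x = less.prems
    have IH: "boost_order_le (g y) (l y) (-1) (n + 2) (\<lambda>\<mu>s. (D ^^ n) F \<mu>s y)" if "n \<le> M" "y \<in> S" for n y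
      using less.IH[of n y] that Suc by simp
    have order: "order_upto i (-1) (j + 2) ((D ^^ j) F)" if "i + j \<le> M" for i j
      unfolding order_upto_def
    proof (intro allI impI ballI)
      fix a y assume "a \<le> i" "y \<in> S"
      then show "boost_order_le (g y) (l y) (-1) (j + 2 + a) (\<lambda>\<mu>s. (D ^^ a) ((D ^^ j) F) \<mu>s y)"
        using IH[of "a + j" y] that by (simp add: funpow_add add.commute add.left_commute)
    qed
    \<comment> \<open>Both exchanged slots, \<open>length us\<close> and its successor, must be
      derivative slots, which are numbered 0 to M; hence the strict inequality.\<close>
    have swap: "ev (us @ a # b # vs) (\<lambda>\<mu>s. (D ^^ N) F \<mu>s x) = ev (us @ b # a # vs) (\<lambda>\<mu>s. (D ^^ N) F \<mu>s x)"
      if us: "length us < M" "length us + length vs = M + 1" and ws: "list_all2 (filt x) (us @ a # b # vs) ws" "sum_list ws > -1"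
      for us vs a b ws
    proof -
      define p where "p = length us"
      \<comment> \<open>Of the N = p + 2 + j derivatives, p stand in front of the exchanged pair and
        j behind it.\<close>
      define j where "j = M - 1 - p"
      let ?T = "(D ^^ j) F"
      let ?s = "swap_slots (j + 2)"
      let ?\<sigma> = "[0..<p] @ map ((+) p) ?s"
      have pj: "p + j = M - 1" "p + j \<le> M" "length vs = j + 2" "Suc (Suc (p + j)) = N"
        using us Suc by (auto simp: j_def p_def)
      note sT = smooth_tensor_gauge_covd_pow[OF smooth_field_strength, of j]
      note sDDT = smooth_tensor_gauge_covd[OF smooth_tensor_gauge_covd[OF sT]]
      have "order_upto p (-1) 2 F" using order[of p 0] pj by (simp add: numeral_2_eq_2)
      from order_upto_commutator[OF sT order[OF pj(2)] this]
      have "boost_order_le (g x) (l x) (-1) (j + 2 + 2 + p)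
          (\<lambda>\<mu>s. (D ^^ p) (\<lambda>\<mu>s x. D (D ?T) \<mu>s x - rearrange ?s (D (D ?T)) \<mu>s x) \<mu>s x)"
        using x by (simp add: order_upto_def)
      then have "ev (us @ a # b # vs) (\<lambda>\<mu>s. (D ^^ p) (\<lambda>\<mu>s x. D (D ?T) \<mu>s x - rearrange ?s (D (D ?T)) \<mu>s x) \<mu>s x) = 0"
        by (rule boost_order_leD[where ws = ws]) (use ws pj(3) p_def in auto)
      moreover have "(D ^^ p) (\<lambda>\<mu>s x. D (D ?T) \<mu>s x - rearrange ?s (D (D ?T)) \<mu>s x) \<mu>s x
          = (D ^^ N) F \<mu>s x - rearrange ?\<sigma> (\<lambda>\<mu>s. (D ^^ N) F \<mu>s x) \<mu>s"
        if "length \<mu>s = length (us @ a # b # vs)" for \<mu>s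
      proof -
        have DN: "(D ^^ p) (D (D ?T)) = (D ^^ N) F"
        proof -
          have "(D ^^ p) ((D ^^ Suc (Suc j)) F) = (D ^^ (p + Suc (Suc j))) F"
            by (simp only: funpow_add comp_apply)
          then show ?thesis using pj(4) by simp
        qed
        have lm: "length \<mu>s = length ?s + p"
          unfolding perm_list_swap_slots(2) using that pj(3) by (simp add: p_def)
        have "(D ^^ p) (\<lambda>\<mu>s x. D (D ?T) \<mu>s x - rearrange ?s (D (D ?T)) \<mu>s x) \<mu>s x
            = (D ^^ p) (D (D ?T)) \<mu>s x - (D ^^ p) (rearrange ?s (D (D ?T))) \<mu>s x"
          by (rule gauge_covd_pow_diff[OF sDDT smooth_tensor_rearrange[OF sDDT] x]) (simp add: lm)
        then show ?thesis
          using gauge_covd_pow_rearrange[OF perm_list_swap_slots(1) lm x, of "D (D ?T)"]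
          unfolding DN by (simp add: rearrange_def)
      qed
      ultimately have "ev (us @ a # b # vs) (\<lambda>\<mu>s. (D ^^ N) F \<mu>s x - rearrange ?\<sigma> (\<lambda>\<mu>s. (D ^^ N) F \<mu>s x) \<mu>s) = 0"
        using ev_cong by (metis (no_types, lifting))
      moreover have "ev (us @ a # b # vs) (rearrange ?\<sigma> (\<lambda>\<mu>s. (D ^^ N) F \<mu>s x))
          = ev (map ((!) (us @ a # b # vs)) ?\<sigma>) (\<lambda>\<mu>s. (D ^^ N) F \<mu>s x)"
        by (rule ev_rearrange[OF perm_list_shift[OF perm_list_swap_slots(1)]])
           (use pj(3) in \<open>simp add: p_def; presburger\<close>)
      moreover have "map ((!) (us @ a # b # vs)) ?\<sigma> = us @ b # a # vs"
      proof -
        have "map ((!) (a # b # vs)) [2..<j + 2 + 2] = vs"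
          using map_nth_upt_drop[of "[a, b]" 2 vs "j + 2 + 2"] pj(3) by (simp del: upt_Suc)
        then show ?thesis
          using nth_map_shift[of us p "a # b # vs" ?s] by (simp add: p_def del: upt_Suc)
      qed
      ultimately show ?thesis by (simp add: ev_diff)
    qed
    \<comment> \<open>\<open>X\<close> travels to the left past the last vector of
      \<open>us\<close>, taking its weight along; therefore the induction on \<open>us\<close> runs
      from the right.\<close>
    have front: "ev (us @ X # vs) (\<lambda>\<mu>s. (D ^^ N) F \<mu>s x) = 0"
      if "length us \<le> M" "length us + length vs = M + 2" "list_all2 (filt x) (us @ X # vs) ws" "sum_list ws > -1" "ws ! length us \<le> 0"
      for us X vs ws
      using that
    proof (induction us arbitrary: vs ws rule: rev_induct)
      case Nil
      then obtain u ws' where ws: "ws = u # ws'" "filt x X u" "list_all2 (filt x) vs ws'"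
        by (auto simp: list_all2_Cons1)
      have "ev (X # vs) (\<lambda>\<mu>s. D ((D ^^ M) F) \<mu>s x) = 0"
        by (rule ev_gauge_covd_nonpositive[OF smooth_tensor_gauge_covd_pow[OF smooth_field_strength] IH[OF order_refl] x ws(2) _ _ ws(3)])
           (use Nil ws in auto)
      then show ?case by (simp add: Suc del: ev.simps)
    next
      case (snoc a us)
      from list_all2_swap[of "filt x" us a X vs ws] snoc.prems(3)
      obtain ws' where ws': "list_all2 (filt x) (us @ X # a # vs) ws'" "sum_list ws' = sum_list ws" "ws' ! length us = ws ! Suc (length us)"
        by auto
      have "ev (us @ a # X # vs) (\<lambda>\<mu>s. (D ^^ N) F \<mu>s x) = ev (us @ X # a # vs) (\<lambda>\<mu>s. (D ^^ N) F \<mu>s x)"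
        by (rule swap) (use snoc.prems in auto)
      also have "\<dots> = 0"
        by (rule snoc.IH[OF _ _ ws'(1)]) (use snoc.prems ws' in auto)
      finally show ?case by simp
    qed
    show ?thesis
      unfolding boost_order_le_def
    proof (intro allI impI)
      fix vs ws assume vs: "length vs = N + 2" "list_all2 (filt x) vs ws" "sum_list ws > -1"
      show "ev vs (\<lambda>\<mu>s. (D ^^ N) F \<mu>s x) = 0"
      \<comment> \<open>Slots 0 to M are the derivative slots. If none has weight at most 0, then
        all have weight 1 and contain multiples of \<open>l\<close>.\<close>
      proof (cases "\<exists>p\<le>M. ws ! p \<le> 0")
        case True
        then obtain p where p: "p \<le> M" "ws ! p \<le> 0" by blast
        have "vs = take p vs @ vs ! p # drop (Suc p) vs"
          using vs(1) p(1) Suc by (intro id_take_nth_drop) simp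
        with front[of "take p vs" "drop (Suc p) vs" "vs ! p" ws] show ?thesis
          using vs p Suc by auto
      next
        case False
        have "\<forall>u\<in>set (take (Suc M) vs). \<exists>c. u = c *\<^sub>R l x"
        proof
          fix u assume "u \<in> set (take (Suc M) vs)"
          then obtain i where "i < Suc M" and i: "u = vs ! i" "i < length vs" by (auto simp: in_set_conv_nth)
          then have "filt x u (ws ! i)" using vs(2) list_all2_nthD by blast
          moreover have "ws ! i > 0" using False \<open>i < Suc M\<close> by (meson less_Suc_eq_le not_le)
          ultimately show "\<exists>c. u = c *\<^sub>R l x" by (auto simp: in_boost_filtration_def)
        qed
        then have "ev (take (Suc M) vs @ drop (Suc M) vs) (\<lambda>\<mu>s. (D ^^ Suc M) F \<mu>s x) = 0"
          using vs(1) Suc by (intro ev_gauge_covd_pow_l x) auto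
        then show ?thesis using Suc by simp
      qed
    qed
  qed
qed

end

section \<open>Components with respect to the generators\<close>

lemma gen_coeff_expansion:
  fixes t :: "'a::finite \<Rightarrow> complex^'N::finite^'N"
  assumes "inj t" "independent (range t)" "X \<in> span (range t)"
  shows "X = (\<Sum>a\<in>UNIV. gen_coeff t a X *\<^sub>R t a)"
proof -
  have "X = (\<Sum>b\<in>range t. representation (range t) X b *\<^sub>R b)"
    using sum_representation_eq[OF assms(2,3), of "range t"] by simp
  also have "\<dots> = (\<Sum>a\<in>UNIV. representation (range t) X (t a) *\<^sub>R t a)"
    by (rule sum.reindex_cong[OF assms(1)]) auto
  finally show ?thesis by (simp add: gen_coeff_def)
qed

text \<open>\<open>gen_coeff\<close> is 0 off the span and so need not be linear on all matrices,
  whereas pulling it out of an evaluation requires a linear map.\<close>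

lemma gen_coeff_linear_extension:
  fixes t :: "'a::finite \<Rightarrow> complex^'N::finite^'N"
  assumes "inj t" "independent (range t)"
  shows "\<exists>\<phi>. linear \<phi> \<and> (\<forall>X\<in>span (range t). gen_coeff t a X = \<phi> X)"
proof -
  obtain \<phi> :: "complex^'N^'N \<Rightarrow> real" where \<phi>: "linear \<phi>" "\<And>Y. Y \<in> range t \<Longrightarrow> \<phi> Y = (if Y = t a then 1 else 0)"
    using linear_independent_extend[OF assms(2), of "\<lambda>Y. if Y = t a then 1 else 0"] by blast
  have "gen_coeff t a X = \<phi> X" if "X \<in> span (range t)" for X
  proof -
    have "\<phi> X = (\<Sum>b\<in>UNIV. gen_coeff t b X * \<phi> (t b))"
      by (subst gen_coeff_expansion[OF assms that]) (simp add: linear_sum[OF \<phi>(1)] linear_scale[OF \<phi>(1)])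
    also have "\<dots> = (\<Sum>b\<in>UNIV. if b = a then gen_coeff t b X else 0)"
      using assms(1) by (intro sum.cong) (auto simp: \<phi>(2) inj_def)
    finally show ?thesis by simp
  qed
  with \<phi>(1) show ?thesis by blast
qed

text \<open>\<open>L\<close> is linear, takes values in the span and fixes it pointwise. It commutes
  with differentiation, so the derivative of f equals its own image under \<open>L\<close>.\<close>

lemma partial_deriv_in_span:
  fixes t :: "'a::finite \<Rightarrow> complex^'N::finite^'N"
  assumes t: "inj t" "independent (range t)"
    and S: "open S" "x \<in> S" and f: "f differentiable (at x)" "\<And>y. y \<in> S \<Longrightarrow> f y \<in> span (range t)"
  shows "partial_deriv i f x \<in> span (range t)"
proof -
  obtain \<phi> where \<phi>: "\<And>a. linear (\<phi> a)" "\<And>a X. X \<in> span (range t) \<Longrightarrow> gen_coeff t a X = \<phi> a X"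
    using gen_coeff_linear_extension[OF t] by metis
  define L where "L X = (\<Sum>a\<in>UNIV. \<phi> a X *\<^sub>R t a)" for X
  have "linear L"
    unfolding L_def
    by (intro linearI) (simp_all add: linear_add[OF \<phi>(1)] linear_scale[OF \<phi>(1)] scaleR_add_left sum.distrib scaleR_sum_right)
  then have "bounded_linear L" using linear_conv_bounded_linear by blast
  have "L (f y) = f y" if "y \<in> S" for y
    using gen_coeff_expansion[OF t f(2)[OF that]] by (simp add: L_def \<phi>(2)[OF f(2)[OF that], symmetric])
  then have "partial_deriv i f x = partial_deriv i (\<lambda>y. L (f y)) x"
    by (intro partial_deriv_cong_open[OF S]) simp
  also have "\<dots> = L (partial_deriv i f x)"
    by (rule partial_deriv_bounded_linear[OF \<open>bounded_linear L\<close> f(1)])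
  also have "\<dots> \<in> span (range t)"
    unfolding L_def by (intro span_sum span_scale span_base) auto
  finally show ?thesis .
qed

lemma bracket_in_span:
  fixes t :: "'a::finite \<Rightarrow> complex^'N::finite^'N"
  assumes f: "\<And>a b. commutator (t a) (t b) = (\<Sum>c\<in>UNIV. cscale (\<i> * of_real (f c a b)) (t c))"
    and X: "X \<in> span (range t)" and Y: "Y \<in> span (range t)"
  shows "bracket X Y \<in> span (range t)"
proof -
  have gen: "bracket (t a) (t b) \<in> span (range t)" for a b
  proof -
    \<comment> \<open>The two factors i turn the imaginary coefficients of the commutator into real
      ones.\<close>
    have "- cscale \<i> (cscale (\<i> * of_real r) Z) = r *\<^sub>R Z" for r and Z :: "complex^'N^'N"
      by (simp add: cscale_def vec_eq_iff mult.assoc[symmetric] scaleR_conv_of_real[where 'a = complex])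
    then have "bracket (t a) (t b) = (\<Sum>c\<in>UNIV. f c a b *\<^sub>R t c)"
      by (simp add: bracket_def f linear_sum[OF linear_cscale] sum_negf[symmetric])
    also have "\<dots> \<in> span (range t)" by (intro span_sum span_scale span_base) auto
    finally show ?thesis .
  qed
  have "bracket (t a) Y \<in> span (range t)" for a
    using Y
  proof (induction rule: span_induct_alt)
    case (step c Z Y)
    then show ?case using gen by (auto simp: bracket_simps intro!: span_add span_scale)
  qed (simp add: linear_0[OF linear_bracket(1)] span_zero)
  then have *: "bracket Z Y \<in> span (range t)" if "Z \<in> range t" for Z using that by auto
  show ?thesis
    using X
  proof (induction rule: span_induct_alt)
    case (step c Z X)
    then show ?case using *[of Z] by (auto simp: bracket_simps linear_scale[OF linear_bracket(2)] intro!: span_add span_scale)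
  qed (simp add: linear_0[OF linear_bracket(2)] span_zero)
qed

section \<open>Fields with values in the Lie algebra\<close>

locale algebra_valued_chart = gauge_chart g S A
  for g :: "'n::finite metric" and S and A :: "('n, 'N::finite) potential" +
  fixes t :: "'a::finite \<Rightarrow> complex^'N^'N" and f :: "'a \<Rightarrow> 'a \<Rightarrow> 'a \<Rightarrow> real"
  assumes t: "inj t" "independent (range t)"
    and structure_constants: "commutator (t a) (t b) = (\<Sum>c\<in>UNIV. cscale (\<i> * of_real (f c a b)) (t c))"
    and A_in_span: "x \<in> S \<Longrightarrow> A \<mu> x \<in> span (range t)"
begin

lemma covd_in_span:
  assumes T: "smooth_tensor S T" "\<And>\<mu>s x. x \<in> S \<Longrightarrow> T \<mu>s x \<in> span (range t)" and x: "x \<in> S"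
  shows "covd g T \<mu>s x \<in> span (range t)"
proof (cases \<mu>s)
  case (Cons \<kappa> \<nu>s)
  have "partial_deriv \<kappa> (T \<nu>s) x \<in> span (range t)"
    by (rule partial_deriv_in_span[OF t open_S x smooth_tensor_differentiable[OF T(1) x] T(2)])
  moreover have "act (connection g x \<kappa>) (\<lambda>\<nu>s. T \<nu>s x) \<nu>s \<in> span (range t)"
    unfolding act_def by (intro span_sum span_scale T(2) x)
  ultimately show ?thesis unfolding Cons covd_Cons by (rule span_diff)
qed (simp add: span_zero)

lemma field_strength_in_span:
  assumes x: "x \<in> S"
  shows "F \<mu>s x \<in> span (range t)"
proof -
  have "smooth_tensor S (\<lambda>\<nu>s. A (hd \<nu>s))" by (simp add: smooth_tensor_def smooth_A)
  from covd_in_span[OF this A_in_span x]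
  have c: "covd g (\<lambda>\<nu>s. A (hd \<nu>s)) \<nu>s x \<in> span (range t)" for \<nu>s by simp
  have "F \<mu>s x = covd g (\<lambda>\<nu>s. A (hd \<nu>s)) [\<mu>s ! 0, \<mu>s ! 1] x - covd g (\<lambda>\<nu>s. A (hd \<nu>s)) [\<mu>s ! 1, \<mu>s ! 0] x
       + bracket (A (\<mu>s ! 0) x) (A (\<mu>s ! 1) x)"
    by (simp add: field_strength_def Let_def bracket_def del: covd.simps)
  also have "\<dots> \<in> span (range t)"
    by (intro span_add span_diff c bracket_in_span[OF structure_constants] A_in_span x)
  finally show ?thesis .
qed

lemma gauge_covd_in_span:
  assumes T: "smooth_tensor S T" "\<And>\<mu>s x. x \<in> S \<Longrightarrow> T \<mu>s x \<in> span (range t)" and x: "x \<in> S"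
  shows "D T \<mu>s x \<in> span (range t)"
proof -
  have "D T \<mu>s x = covd g T \<mu>s x + bracket (A (hd \<mu>s) x) (T (tl \<mu>s) x)"
    by (simp add: gauge_covd_def bracket_def)
  also have "\<dots> \<in> span (range t)"
    by (intro span_add covd_in_span[OF T x] bracket_in_span[OF structure_constants] A_in_span x T(2))
  finally show ?thesis .
qed

lemma gauge_covd_pow_field_strength_in_span: "x \<in> S \<Longrightarrow> (D ^^ j) F \<mu>s x \<in> span (range t)"
proof (induction j arbitrary: \<mu>s x)
  case (Suc j)
  then show ?case
    using gauge_covd_in_span[OF smooth_tensor_gauge_covd_pow[OF smooth_field_strength]] by simp
qed (simp add: field_strength_in_span)

end

text \<open>Type N and the invariants refer to the real components along the generators, while
  brackets and matrix products live on matrix-valued tensors; this passes between the two.\<close>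

lemma boost_order_le_gen_coeff_iff:
  fixes t :: "'a::finite \<Rightarrow> complex^'N::finite^'N"
  assumes t: "inj t" "independent (range t)" and T: "\<And>\<mu>s. T \<mu>s \<in> span (range t)"
  shows "boost_order_le h l b r T \<longleftrightarrow> (\<forall>a. boost_order_le h l b r (\<lambda>\<mu>s. gen_coeff t a (T \<mu>s)))"
proof
  assume *: "boost_order_le h l b r T"
  show "\<forall>a. boost_order_le h l b r (\<lambda>\<mu>s. gen_coeff t a (T \<mu>s))"
  proof
    fix a
    obtain \<phi> where \<phi>: "linear \<phi>" "\<And>X. X \<in> span (range t) \<Longrightarrow> gen_coeff t a X = \<phi> X"
      using gen_coeff_linear_extension[OF t] by metis
    show "boost_order_le h l b r (\<lambda>\<mu>s. gen_coeff t a (T \<mu>s))"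
      using boost_order_le_linear_image[OF \<phi>(1) *] by (simp add: \<phi>(2)[OF T])
  qed
next
  assume *: "\<forall>a. boost_order_le h l b r (\<lambda>\<mu>s. gen_coeff t a (T \<mu>s))"
  show "boost_order_le h l b r T"
    unfolding boost_order_le_def
  proof (intro allI impI)
    fix vs ws assume vs: "length vs = r" "list_all2 (in_boost_filtration h l) vs ws" "sum_list ws > b"
    have "ev vs T = ev vs (\<lambda>\<mu>s. \<Sum>a\<in>UNIV. gen_coeff t a (T \<mu>s) *\<^sub>R t a)"
      by (rule arg_cong[where f = "ev vs"]) (rule ext, rule gen_coeff_expansion[OF t T])
    also have "\<dots> = (\<Sum>a\<in>UNIV. ev vs (\<lambda>\<mu>s. gen_coeff t a (T \<mu>s)) *\<^sub>R t a)"
      by (simp add: ev_sum ev_linear_image[OF bounded_linear.linear[OF bounded_linear_scaleR_left]])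
    also have "\<dots> = 0"
      using boost_order_leD[OF *[rule_format] vs] by simp
    finally show "ev vs T = 0" .
  qed
qed

section \<open>Kundt vector fields\<close>

context lorentz_chart begin

text \<open>Lowering an index commutes with the Levi-Civita derivative: g(Z, l) is differentiated
  once as a metric product and once as the covector of \<open>l\<close> evaluated on a constant
  \<open>Z\<close>, and the terms with the derivative of \<open>Z\<close> agree.\<close>

lemma ev_grad_l:
  assumes x: "x \<in> S" and l: "smooth_on l S"
  shows "ev [X, Z] (\<lambda>\<mu>s. grad_l g l \<mu>s x) = metric_form (g x) Z (nabla_vec g X l x)"
proof -
  let ?L = "\<lambda>\<mu>s x. (g x *v l x) $ hd \<mu>s"
  have L: "smooth_tensor S ?L"
    unfolding smooth_tensor_def matrix_vector_mult_def
    by (auto intro!: smooth_on_sum smooth_on_mult smooth_on_vec_nth[OF _ l] smooth_metric open_S)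
  have e: "ev [Z] (\<lambda>\<mu>s. ?L \<mu>s y) = metric_form (g y) Z (l y)" for y and Z :: "real^'n"
    by (simp add: slot_def metric_form_def inner_vec_def)
  note d = smooth_on_differentiable[OF l open_S x]
  have "metric_form (g x) (nabla_vec g X (\<lambda>_. Z) x) (l x) + metric_form (g x) Z (nabla_vec g X l x)
      = frechet_derivative (\<lambda>y. ev (map (\<lambda>Y. Y y) [\<lambda>_. Z]) (\<lambda>\<mu>s. ?L \<mu>s y)) (at x) X"
    using frechet_derivative_metric_form[OF x _ d, of "\<lambda>_. Z" X] by (simp add: e del: ev.simps)
  also have "\<dots> = ev [X, Z] (\<lambda>\<mu>s. covd g ?L \<mu>s x) + metric_form (g x) (nabla_vec g X (\<lambda>_. Z) x) (l x)"
    by (subst frechet_derivative_ev[OF x L]) (simp_all add: e del: ev.simps covd.simps)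
  finally show ?thesis by (simp add: grad_l_def)
qed

text \<open>It suffices that nabla_X l is orthogonal to each \<open>e b\<close> with b \<noteq> 1,
  since the product with \<open>e 1\<close> is the coefficient of \<open>l\<close>. For b = 0 this
  is nullness. For b \<ge> 2 expand \<open>X\<close>: orthogonality to \<open>l\<close> removes the
  part along \<open>e 1\<close>, geodesy that along \<open>l\<close>, and the optical matrix the
  rest.\<close>

lemma nabla_kundt_vector:
  assumes x: "x \<in> S" and card: "CARD('n) \<ge> 2"
    and l: "smooth_on l S" "\<And>y. y \<in> S \<Longrightarrow> metric_form (g y) (l y) (l y) = 0" "geodetic_at g l x"
    and e: "null_frame (g x) e" "e 0 = l x"
    and opt: "\<And>i j. i \<in> {2..<CARD('n)} \<Longrightarrow> j \<in> {2..<CARD('n)} \<Longrightarrow> optical g l x e i j = 0"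
    and X: "metric_form (g x) (l x) X = 0"
  shows "\<exists>c. nabla_vec g X l x = c *\<^sub>R l x"
proof -
  interpret null_frame_at "g x" e
    by (simp add: null_frame_at_def metric_sym x card e)
  let ?G = "\<lambda>\<mu>s. grad_l g l \<mu>s x"
  let ?W = "nabla_vec g X l x"
  have "metric_form (g x) (e b) ?W = 0" if b: "b < CARD('n)" "b \<noteq> 1" for b
  proof (cases "b = 0")
    case True
    then show ?thesis using nabla_null_orthogonal[OF x l(1,2)] by (simp add: e(2))
  next
    case False
    have "ev [e a, e b] ?G = 0 \<or> metric_form (g x) (e (frame_dual a)) X = 0" if a: "a < CARD('n)" for a
    proof -
      consider "a = 0" | "a = 1" | "2 \<le> a" by linarith
      then show ?thesis
      proof cases
        case 1
        obtain \<kappa> where \<kappa>: "\<And>\<mu>. (\<Sum>\<nu>\<in>UNIV. l x $ \<nu> * grad_l g l [\<nu>, \<mu>] x) = \<kappa> * (g x *v l x) $ \<mu>"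
          using l(3) unfolding geodetic_at_def by blast
        have "ev [l x, e b] ?G = (\<Sum>\<mu>\<in>UNIV. e b $ \<mu> * (\<kappa> * (g x *v l x) $ \<mu>))"
          by (simp add: slot_def \<kappa>[symmetric])
        also have "\<dots> = \<kappa> * metric_form (g x) (e b) (e 0)"
          by (simp add: metric_form_def inner_vec_def sum_distrib_left mult.left_commute e(2))
        also have "\<dots> = 0" using metric_frame[of b 0] b False card by (simp add: frame_dual_def)
        finally show ?thesis by (simp add: 1 e(2))
      next
        case 2
        then show ?thesis by (simp add: frame_dual_def e(2) X)
      next
        case 3
        then show ?thesis using opt[of b a] a b False by (simp add: optical_def frame_comp_eq_ev)
      qed
    qed
    then have "(\<Sum>a<CARD('n). metric_form (g x) (e (frame_dual a)) X *\<^sub>R ev [e a, e b] ?G) = 0"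
      by (intro sum.neutral) auto
    then have "ev [\<Sum>a<CARD('n). metric_form (g x) (e (frame_dual a)) X *\<^sub>R e a, e b] ?G = 0"
      unfolding ev.simps(2)[of _ "[e b]"] slot_sum_scaleR ev_sum ev_scaleR .
    then show ?thesis
      unfolding frame_expansion[symmetric] ev_grad_l[OF x l(1)] .
  qed
  then have z: "metric_form (g x) (e (frame_dual a)) ?W = 0" if "a < CARD('n)" "a \<noteq> 0" for a
    using frame_dual_less[OF card that(1)] that(2) by (auto simp: frame_dual_def split: if_splits)
  have "?W = (\<Sum>a<CARD('n). metric_form (g x) (e (frame_dual a)) ?W *\<^sub>R e a)"
    by (rule frame_expansion)
  also have "\<dots> = (\<Sum>a\<in>{0}. metric_form (g x) (e (frame_dual a)) ?W *\<^sub>R e a)"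
    using card z by (intro sum.mono_neutral_right) auto
  finally show ?thesis using e(2) by auto
qed

end

lemma optical_eq_0:
  fixes e :: "nat \<Rightarrow> real^'n::finite"
  assumes "expansion g l x e = 0" "shear g l x e i j = 0" "twist g l x e i j = 0"
  shows "optical g l x e i j = 0"
  using assms unfolding shear_def twist_def by (simp split: if_splits)

section \<open>Null gauge fields\<close>

lemma (in null_frame_at) type_N_boost_order:
  assumes "type_N_in_frame t e T"
  shows "boost_order_le h (e 0) (-1) 2 (\<lambda>\<mu>s. gen_coeff t a (T \<mu>s))"
proof (rule boost_order_le_if_frame)
  fix as assume as: "length as = 2" "set as \<subseteq> {..<CARD('n)}" "boost_weight as > -1"
  then obtain b c where "as = [b, c]" "b < CARD('n)" "c < CARD('n)"
    by (auto simp: numeral_2_eq_2 length_Suc_conv)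
  then show "frame_comp e (\<lambda>\<mu>s. gen_coeff t a (T \<mu>s)) as = 0"
    using assms as(3) unfolding type_N_in_frame_def by force
qed

lemma field_jet_0: "field_jet g A x 0 = (\<lambda>\<mu>s. field_strength g A \<mu>s x)"
  by (simp add: field_jet_def fun_eq_iff)

theorem mainTheorem3:
  fixes \<A> :: "('m::{t2_space, second_countable_topology}, 'n::finite) chart set"
    and g :: "('m, 'n) chart \<Rightarrow> 'n metric"
    and G :: "(complex^'N::finite^'N) set"
    and t :: "'a::finite \<Rightarrow> complex^'N^'N"
    and A :: "('m, 'n) chart \<Rightarrow> ('n, 'N) potential"
  assumes "CARD('n) \<ge> 4"
    and "spacetime \<A> g"
    and "gauge_group G t"
    and "gauge_field \<A> t A"
    and "null_field \<A> t g A"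
  shows "VSI_upto 0 \<A> G t g A \<and>
    (\<forall>l. degenerate_kundt \<A> g l \<longrightarrow> aligned_null_field \<A> t g A l \<longrightarrow> VSI \<A> G t g A)"
proof (intro conjI allI impI)
  have card: "CARD('n) \<ge> 2" using assms(1) by simp
  have t: "inj t" "independent (range t)"
    using assms(3) by (simp_all add: gauge_group_def)
  obtain f where f: "\<And>a b. commutator (t a) (t b) = (\<Sum>c\<in>UNIV. cscale (\<i> * of_real (f c a b)) (t c))"
    using assms(3) unfolding gauge_group_def by blast
  have chart: "lorentz_chart (g c) (chart_image c)" if "c \<in> \<A>" for c
    using assms(2) that by (simp add: lorentz_chart_def spacetime_def smooth_atlas_def)
  have lorentzian: "lorentzian (g c x)" if "c \<in> \<A>" "x \<in> chart_image c" for c x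
    using lorentz_chart.metric[OF chart[OF that(1)]] that(2) by (simp add: lorentz_metric_on_def)
  have frame_at: "null_frame_at (g c x) e" if "c \<in> \<A>" "x \<in> chart_image c" "null_frame (g c x) e" for c x e
    using lorentz_chart.metric_sym[OF chart[OF that(1)] that(2)] that(3) card by (simp add: null_frame_at_def)

  show "VSI_upto 0 \<A> G t g A"
    unfolding VSI_upto_def
  proof (intro allI impI ballI)
    fix P :: "('n, 'N) concomitant" and c x
    assume P: "polynomial_gauge_scalar G t 0 P" and c: "c \<in> \<A>" and x: "x \<in> chart_image c"
    obtain e where e: "null_frame (g c x) e" "type_N_in_frame t e (\<lambda>\<mu>s. field_strength (g c) (A c) \<mu>s x)"
      using assms(5) c x unfolding null_field_def by blast
    interpret null_frame_at "g c x" e by (rule frame_at[OF c x e(1)])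
    show "P (g c x) (field_jet (g c) (A c) x) [] = 0"
    proof (rule polynomial_gauge_scalar_vanishes[OF P lorentzian[OF c x] t(2)])
      fix j :: nat and a assume "j \<le> 0"
      with type_N_boost_order[OF e(2), of a]
      show "boost_order_le (g c x) (e 0) (-1) (j + 2) (\<lambda>\<mu>s. gen_coeff t a (field_jet (g c) (A c) x j \<mu>s))"
        by (simp add: field_jet_0 numeral_2_eq_2)
    qed
  qed

  fix l assume kundt: "degenerate_kundt \<A> g l" and aligned: "aligned_null_field \<A> t g A l"
  show "VSI \<A> G t g A"
    unfolding VSI_def VSI_upto_def
  proof (intro allI impI ballI)
    fix k and P :: "('n, 'N) concomitant" and c x
    assume P: "polynomial_gauge_scalar G t k P" and c: "c \<in> \<A>" and x: "x \<in> chart_image c"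
    interpret lorentz_chart "g c" "chart_image c" by (rule chart[OF c])
    interpret algebra_valued_chart "g c" "chart_image c" "A c" t f
      using assms(4) c t f by unfold_locales (auto simp: gauge_field_def potential_on_def)
    have e: "\<exists>e. null_frame (g c y) e \<and> e 0 = l c y \<and> type_N_in_frame t e (\<lambda>\<mu>s. field_strength (g c) (A c) \<mu>s y)"
      if "y \<in> chart_image c" for y
      using aligned c that unfolding aligned_null_field_def by blast
    have l: "smooth_on (l c) (chart_image c)"
      using kundt c by (simp add: degenerate_kundt_def kundt_vector_def vector_field_def)
    have null: "metric_form (g c y) (l c y) (l c y) = 0" "geodetic_at (g c) (l c) y" if "y \<in> chart_image c" for y
      using kundt c that by (simp_all add: degenerate_kundt_def kundt_vector_def)
    \<comment> \<open>Goals 4 to 7 are \<open>nabla_l\<close>, \<open>frame\<close>,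
      \<open>order_field_strength\<close> and \<open>order_riemann\<close>; the frames provided by
      alignment turn each of the componentwise hypotheses into a condition on
      \<open>l\<close>.\<close>
    interpret kundt_chart "g c" "chart_image c" "A c" "l c"
    proof (unfold_locales, goal_cases)
      case (4 y X)
      obtain e where e: "null_frame (g c y) e" "e 0 = l c y" using e[OF 4(1)] by blast
      have "optical (g c) (l c) y e i j = 0" if "i \<in> {2..<CARD('n)}" "j \<in> {2..<CARD('n)}" for i j
        using kundt c 4(1) e that unfolding degenerate_kundt_def kundt_vector_def
        by (intro optical_eq_0) blast+
      from nabla_kundt_vector[OF 4(1) card l null(1) null(2)[OF 4(1)] e this 4(2)]
      show ?case .
    next
      case (5 y)
      then show ?case using e by blast
    next
      case (6 y)
      obtain e where e: "null_frame (g c y) e" "e 0 = l c y" "type_N_in_frame t e (\<lambda>\<mu>s. field_strength (g c) (A c) \<mu>s y)"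
        using e[OF 6] by blast
      show ?case
        using null_frame_at.type_N_boost_order[OF frame_at[OF c 6 e(1)] e(3)]
        by (simp add: boost_order_le_gen_coeff_iff[OF t field_strength_in_span[OF 6]] e(2))
    next
      case (7 y k)
      obtain e where e: "null_frame (g c y) e" "e 0 = l c y" using e[OF 7] by blast
      have "boost_order_le (g c y) (e 0) 0 (k + 4) (\<lambda>\<mu>s. (covd (g c) ^^ k) (riemann (g c)) \<mu>s y)"
        by (rule null_frame_at.boost_order_le_if_frame[OF frame_at[OF c 7 e(1)]])
           (use kundt c 7 e in \<open>unfold degenerate_kundt_def, force\<close>)
      then show ?case by (simp add: e(2))
    qed (use card l null in auto)
    obtain e where e: "null_frame (g c x) e" "e 0 = l c x" using e[OF x] by blast
    interpret null_frame_at "g c x" e by (rule frame_at[OF c x e(1)])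
    show "P (g c x) (field_jet (g c) (A c) x) [] = 0"
    proof (rule polynomial_gauge_scalar_vanishes[OF P lorentzian[OF c x] t(2)])
      fix j a
      have "boost_order_le (g c x) (e 0) (-1) (j + 2) (\<lambda>\<mu>s. field_jet (g c) (A c) x j \<mu>s)"
        using boost_order_gauge_covd_pow_field_strength[OF x, of j] by (simp add: field_jet_def e(2))
      moreover have "field_jet (g c) (A c) x j \<mu>s \<in> span (range t)" for \<mu>s
        using gauge_covd_pow_field_strength_in_span[OF x] by (simp add: field_jet_def)
      ultimately show "boost_order_le (g c x) (e 0) (-1) (j + 2) (\<lambda>\<mu>s. gen_coeff t a (field_jet (g c) (A c) x j \<mu>s))"
        using boost_order_le_gen_coeff_iff[OF t, of "field_jet (g c) (A c) x j"] by blast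
    qed
  qed
qed

end
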